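(* Let $n\ge 0$ be an integer, let $u_0,\dots,u_n\in\mathcal{H}(\mathbb{D})$, $\vec u=\{u_k\}_{k=0}^n$, let $\tau$ be a holomorphic self-map of $\mathbb{D}$, and let $\nu$ be a weight on $\mathbb{D}$. Let $\gamma=\gamma(X)$ be the parameter attached to the space $X$ as in the context. (A) Suppose that $X=H^\infty$ or $X=A^{-\alpha}$ ($\alpha>0$). Then the following conditions are equivalent: (a) $S^{n}_{\vec{u},\tau}: X\to H_\nu^\infty$ is bounded. (b) $\displaystyle\sup_{z\in\mathbb{D}}\sum_{k=0}^{n}\frac{\nu(z)|u_k(z)|}{(1-|\tau(z)|^2)^{k+\gamma}}<\infty$. (c) $M_k=\displaystyle\sup_{z\in\mathbb{D}}\frac{\nu(z)|u_k(z)|}{(1-|\tau(z)|^2)^{k+\gamma}}<\infty$ for each $0\le k\le n$. (d) $\displaystyle\sup_{a\in\mathbb{D}}\|S^{n}_{\vec{u},\tau}(f_a(\sigma_a)^k)\|_{H_\nu^\infty}<\infty$ for each $0\le k\le n$. (e) $\displaystyle\sup_{m\in\mathbb{N}}m^{\gamma}\|S^{n}_{\vec{u},\tau}(p_m)\|_{H_\nu^\infty}<\infty$, where $p_m(z)=z^m$, $z\in\mathbb{D}$. (B) If $X=A_\alpha^p$ ($0<p<\infty$, $\alpha>-1$) or $X=H^p$ ($0<p<\infty$), then conditions (a)–(d) are equivalent.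
   Context: $\mathbb{D}$ is the open unit disk in $\mathbb{C}$ and $\mathcal{H}(\mathbb{D})$ is the space of holomorphic functions on $\mathbb{D}$. A weight is a continuous function $\nu:\mathbb{D}\to(0,\infty)$, and $H_\nu^\infty=\{f\in\mathcal{H}(\mathbb{D}):\|f\|_{H_\nu^\infty}=\sup_{z\in\mathbb{D}}\nu(z)|f(z)|<\infty\}$ (for $f\in\mathcal{H}(\mathbb{D})$ not in this space the supremum is $+\infty$). Spaces $X$: $H^\infty$ is the space of bounded holomorphic functions with the sup norm; $A^{-\alpha}$ ($\alpha>0$) is $H_\nu^\infty$ for $\nu(z)=(1-|z|^2)^\alpha$; $A_\alpha^p$ ($0<p<\infty$, $\alpha>-1$) is the weighted Bergman space of $f\in\mathcal{H}(\mathbb{D})$ with $\|f\|_{A_\alpha^p}^p=\int_{\mathbb{D}}|f(z)|^p\,dA_\alpha(z)<\infty$, where $dA_\alpha(z)=(\alpha+1)(1-|z|^2)^\alpha dA(z)$ and $A$ is normalized area measure on $\mathbb{D}$; $H^p$ ($0<p<\infty$) is the Hardy space of $f\in\mathcal{H}(\mathbb{D})$ with $\|f\|_{H^p}^p=\sup_{0<r<1}\int_{\partial\mathbb{D}}|f(r\zeta)|^p\,dm(\zeta)<\infty$, where $m$ is normalized Lebesgue measure on $\partial\mathbb{D}$. The parameter $\gamma$: $\gamma=0$ if $X=H^\infty$; $\gamma=\alpha$ if $X=A^{-\alpha}$; $\gamma=\frac{\alpha+2}{p}$ if $X=A_\alpha^p$; $\gamma=\frac1p$ if $X=H^p$. The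 operator: $S^{n}_{\vec{u},\tau}(f)(z)=\sum_{k=0}^{n}u_k(z)f^{(k)}(\tau(z))$ for $f\in\mathcal{H}(\mathbb{D})$, $z\in\mathbb{D}$, where $f^{(k)}$ is the $k$-th derivative. An operator is bounded if it maps every bounded set of $X$ into a bounded set of the target. For $a\in\mathbb{D}$: $\sigma_a(z)=\frac{a-z}{1-\bar a z}$ and $f_a(z)=\left(\frac{1-|a|^2}{(1-\bar a z)^2}\right)^{\gamma}$, $z\in\mathbb{D}$; $(\sigma_a)^k$ is the $k$-th (pointwise) power.
   Formalization: In (e) it is also required that S(p_m) has finite norm for every m ≥ 0, including m = 0 (so u_0 lies in H_ν^∞); without this (e) does not imply (a)–(d), e.g. n = 0, τ = 0, u_0 of infinite norm. *)

theory Defs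
  imports "HOL-Complex_Analysis.Complex_Analysis"
begin

abbreviation disk :: "complex set"
  where "disk \<equiv> ball 0 1"

text \<open>
  Functions on the disk are total functions on the complex plane; every notion below depends only on
  their values on \<open>disk\<close>. All (quasi-)norms are defined on arbitrary functions, with values in
  \<open>[0, \<infinity>]\<close>, and the space belonging to a norm consists of the holomorphic functions of finite norm.
\<close>

type_synonym fun_norm = "(complex \<Rightarrow> complex) \<Rightarrow> ennreal"

definition space_of :: "fun_norm \<Rightarrow> (complex \<Rightarrow> complex) set"
  where "space_of N = {f. f holomorphic_on disk \<and> N f < \<infinity>}"

definition bounded_set :: "fun_norm \<Rightarrow> (complex \<Rightarrow> complex) set \<Rightarrow> bool"
  where "bounded_set N B \<longleftrightarrow> B \<subseteq> space_of N \<and> (SUP f\<in>B. N f) < \<infinity>"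

definition bounded_operator ::
    "fun_norm \<Rightarrow> fun_norm \<Rightarrow> ((complex \<Rightarrow> complex) \<Rightarrow> (complex \<Rightarrow> complex)) \<Rightarrow> bool"
  where "bounded_operator N N' T \<longleftrightarrow> (\<forall>B. bounded_set N B \<longrightarrow> bounded_set N' (T ` B))"

definition is_weight :: "(complex \<Rightarrow> real) \<Rightarrow> bool"
  where "is_weight \<nu> \<longleftrightarrow> continuous_on disk \<nu> \<and> (\<forall>z\<in>disk. 0 < \<nu> z)"

definition weighted_norm :: "(complex \<Rightarrow> real) \<Rightarrow> fun_norm"
  where "weighted_norm \<nu> f = (SUP z\<in>disk. ennreal (\<nu> z * norm (f z)))"

definition sup_norm :: "fun_norm"
  where "sup_norm f = (SUP z\<in>disk. ennreal (norm (f z)))"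

definition ennreal_root :: "real \<Rightarrow> ennreal \<Rightarrow> ennreal"
  where "ennreal_root p x = (if x = \<infinity> then \<infinity> else ennreal (enn2real x powr (1 / p)))"

definition disk_area :: "complex measure"
  where "disk_area = uniform_measure lborel disk"

definition weighted_area :: "real \<Rightarrow> complex measure"
  where "weighted_area \<alpha> =
    density disk_area (\<lambda>z. ennreal ((\<alpha> + 1) * (1 - (norm z)\<^sup>2) powr \<alpha>))"

definition bergman_norm :: "real \<Rightarrow> real \<Rightarrow> fun_norm"
  where "bergman_norm p \<alpha> f =
    ennreal_root p (\<integral>\<^sup>+z\<in>disk. ennreal (norm (f z) powr p) \<partial>weighted_area \<alpha>)"

text \<open>
  Normalized Lebesgue measure on the unit circle is the image under \<open>cis\<close> of the uniform
  distribution on \<open>[0, 2\<pi>]\<close>; integrals over the circle are written in this parametrization.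
\<close>

definition hardy_norm :: "real \<Rightarrow> fun_norm"
  where "hardy_norm p f = ennreal_root p
    (SUP r\<in>{0<..<1}. \<integral>\<^sup>+t. ennreal (norm (f (of_real r * cis t)) powr p)
                          \<partial>uniform_measure lborel {0..2 * pi})"

text \<open>
  \<open>Growth \<alpha>\<close> stands for $A^{-\alpha}$, \<open>Bergman p \<alpha>\<close> for $A^p_\alpha$, \<open>Hardy p\<close> for $H^p$. The ranges of
  the parameters are not part of the datatype.
\<close>

datatype hspace = Hinfty | Growth real | Bergman real real | Hardy real

fun norm_of :: "hspace \<Rightarrow> fun_norm"
  where
    "norm_of Hinfty = sup_norm"
  | "norm_of (Growth \<alpha>) = weighted_norm (\<lambda>z. (1 - (norm z)\<^sup>2) powr \<alpha>)"
  | "norm_of (Bergman p \<alpha>) = bergman_norm p \<alpha>"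
  | "norm_of (Hardy p) = hardy_norm p"

fun gamma_of :: "hspace \<Rightarrow> real"
  where
    "gamma_of Hinfty = 0"
  | "gamma_of (Growth \<alpha>) = \<alpha>"
  | "gamma_of (Bergman p \<alpha>) = (\<alpha> + 2) / p"
  | "gamma_of (Hardy p) = 1 / p"

definition S_op ::
    "nat \<Rightarrow> (nat \<Rightarrow> complex \<Rightarrow> complex) \<Rightarrow> (complex \<Rightarrow> complex) \<Rightarrow> (complex \<Rightarrow> complex) \<Rightarrow> complex \<Rightarrow> complex"
  where "S_op n u \<tau> f z = (\<Sum>k\<le>n. u k z * (deriv ^^ k) f (\<tau> z))"

definition sigma :: "complex \<Rightarrow> complex \<Rightarrow> complex"
  where "sigma a z = (a - z) / (1 - cnj a * z)"

text \<open>
  For \<open>a\<close> and \<open>z\<close> in the disk, \<open>1 - cnj a * z\<close> lies in the right half plane, so the base of the power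
  avoids the branch cut of the principal logarithm.
\<close>

definition test_fun :: "real \<Rightarrow> complex \<Rightarrow> complex \<Rightarrow> complex"
  where "test_fun \<gamma> a z =
    (of_real (1 - (norm a)\<^sup>2) / (1 - cnj a * z)\<^sup>2) powr of_real \<gamma>"

definition cond_a :: "hspace \<Rightarrow> nat \<Rightarrow> (nat \<Rightarrow> complex \<Rightarrow> complex) \<Rightarrow> (complex \<Rightarrow> complex) \<Rightarrow>
    (complex \<Rightarrow> real) \<Rightarrow> bool"
  where "cond_a X n u \<tau> \<nu> \<longleftrightarrow> bounded_operator (norm_of X) (weighted_norm \<nu>) (S_op n u \<tau>)"

definition cond_b :: "hspace \<Rightarrow> nat \<Rightarrow> (nat \<Rightarrow> complex \<Rightarrow> complex) \<Rightarrow> (complex \<Rightarrow> complex) \<Rightarrow>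
    (complex \<Rightarrow> real) \<Rightarrow> bool"
  where "cond_b X n u \<tau> \<nu> \<longleftrightarrow>
    (SUP z\<in>disk. ennreal (\<Sum>k\<le>n. \<nu> z * norm (u k z) /
       (1 - (norm (\<tau> z))\<^sup>2) powr (real k + gamma_of X))) < \<infinity>"

definition cond_c :: "hspace \<Rightarrow> nat \<Rightarrow> (nat \<Rightarrow> complex \<Rightarrow> complex) \<Rightarrow> (complex \<Rightarrow> complex) \<Rightarrow>
    (complex \<Rightarrow> real) \<Rightarrow> bool"
  where "cond_c X n u \<tau> \<nu> \<longleftrightarrow>
    (\<forall>k\<le>n. (SUP z\<in>disk. ennreal (\<nu> z * norm (u k z) /
       (1 - (norm (\<tau> z))\<^sup>2) powr (real k + gamma_of X))) < \<infinity>)"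

definition cond_d :: "hspace \<Rightarrow> nat \<Rightarrow> (nat \<Rightarrow> complex \<Rightarrow> complex) \<Rightarrow> (complex \<Rightarrow> complex) \<Rightarrow>
    (complex \<Rightarrow> real) \<Rightarrow> bool"
  where "cond_d X n u \<tau> \<nu> \<longleftrightarrow>
    (\<forall>k\<le>n. (SUP a\<in>disk. weighted_norm \<nu>
       (S_op n u \<tau> (\<lambda>z. test_fun (gamma_of X) a z * sigma a z ^ k))) < \<infinity>)"

text \<open>
  The supremum runs over all \<open>m \<ge> 0\<close>. In \<^typ>\<open>ennreal\<close> we have \<open>0 * \<infinity> = 0\<close>, and \<open>0 powr \<gamma> = 0\<close> even
  for \<open>\<gamma> = 0\<close>, so the term \<open>m = 0\<close> of the supremum vanishes. The first conjunct restores its content: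
  a finite supremum includes that every monomial, the constant \<open>1\<close> too, is mapped to a function of
  finite norm. Without it \<open>(e)\<close> would not imply the other conditions: take \<open>n = 0\<close>, \<open>\<tau> = 0\<close> and \<open>u 0\<close>
  of infinite norm.
\<close>

definition cond_e :: "hspace \<Rightarrow> nat \<Rightarrow> (nat \<Rightarrow> complex \<Rightarrow> complex) \<Rightarrow> (complex \<Rightarrow> complex) \<Rightarrow>
    (complex \<Rightarrow> real) \<Rightarrow> bool"
  where "cond_e X n u \<tau> \<nu> \<longleftrightarrow>
    (\<forall>m::nat. weighted_norm \<nu> (S_op n u \<tau> (\<lambda>z. z ^ m)) < \<infinity>) \<and>
    (SUP m::nat. ennreal (real m powr gamma_of X) *
       weighted_norm \<nu> (S_op n u \<tau> (\<lambda>z. z ^ m))) < \<infinity>"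

end

theory Submission
  imports Defs
begin

text \<open>
  The conditions couple the spaces \<open>X\<close> to the operator only through two facts: the growth estimate
  \<open>|f z| \<le> C \<parallel>f\<parallel> (1 - |z|)\<^sup>-\<^sup>\<gamma>\<close> and the uniform boundedness of the functions \<open>f\<^sub>a \<sigma>\<^sub>a\<^sup>k\<close> in \<open>X\<close>. By Cauchy's
  inequalities the first one turns (c) into a bound for the operator. Conversely, a function with a
  zero of order \<open>k\<close> at \<open>\<tau> z\<close> removes the terms with index below \<open>k\<close> from the operator at \<open>z\<close>, so the
  coefficients can be bounded one after the other, from \<open>k = n\<close> down to \<open>k = 0\<close>. Such functions are
  \<open>f\<^sub>a \<sigma>\<^sub>a\<^sup>k\<close> with \<open>a = \<tau> z\<close> for (d), and \<open>(x\<^sup>N - a\<^sup>N)\<^sup>k x\<^sup>N\<close> with \<open>N\<close> comparable to \<open>1 / (1 - |a|)\<close> for (e).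

  For Hardy and Bergman spaces the growth estimate replaces subharmonicity of \<open>|f|\<^sup>p\<close> by the mean value
  property of \<open>f\<close> itself: for \<open>p \<le> 1\<close> write \<open>|f| = |f|\<^sup>p |f|\<^sup>1\<^sup>-\<^sup>p\<close> and absorb the second factor into the
  left side, for large \<open>p\<close> apply this to a power of \<open>f\<close>.
\<close>

subsection \<open>Bounding the coefficients by test functions\<close>

text \<open>For \<open>p < 1\<close> the norms of \<open>X\<close> are not subadditive, so no
  functions are added inside \<open>X\<close>; what is known about \<open>X\<close> enters through
  bounds of the form \<open>norm_of X f \<le> ennreal M\<close>. The exponent
  \<open>k + \<gamma>\<close> has two sources: the height \<open>(1 - |a|)\<close> to the power
  \<open>-\<gamma>\<close> of the test function near \<open>a\<close>, and one factor
  \<open>1 / (1 - |a|)\<close> for each derivative. For \<open>x^N - a^N\<close> the derivative at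
  \<open>a\<close> is \<open>N a^(N - 1)\<close>; \<open>N\<close> comparable to
  \<open>1 / (1 - |a|)\<close> makes it that large while \<open>|a|^N\<close> stays away from 0.
  Condition (e) needs monomials of norm \<open>O(m powr -\<gamma>)\<close>. This holds in the growth
  spaces, but in a Hardy space every monomial has norm 1, which is why (e) is absent from (B). The
  hard estimate is the uniform bound for the Bergman norms of the test functions, an integral of
  \<open>|1 - cnj a * z|\<close> to the power \<open>-2 (\<alpha> + 2)\<close> against the weight.
  On each circle, two powers of the kernel are integrated exactly by Cauchy's formula and the others
  are replaced by their maximum; rotation invariance of area and the distribution of
  \<open>1 - |z|^2\<close> then reduce the disk to an integral over \<open>[0, 1]\<close>.\<close>

lemma SUP_ennreal_finite_iff:
  assumes "\<And>z. z \<in> S \<Longrightarrow> 0 \<le> f z"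
  shows "(SUP z\<in>S. ennreal (f z)) < \<infinity> \<longleftrightarrow> (\<exists>B. \<forall>z\<in>S. f z \<le> B)"
proof
  assume fin: "(SUP z\<in>S. ennreal (f z)) < \<infinity>"
  have "f z \<le> enn2real (SUP z\<in>S. ennreal (f z))" if "z \<in> S" for z
  proof -
    have "ennreal (f z) \<le> (SUP z\<in>S. ennreal (f z))"
      using that by (intro SUP_upper)
    then have "enn2real (ennreal (f z)) \<le> enn2real (SUP z\<in>S. ennreal (f z))"
      using fin by (intro enn2real_mono) auto
    then show ?thesis using assms[OF that] by simp
  qed
  then show "\<exists>B. \<forall>z\<in>S. f z \<le> B" by blast
next
  assume "\<exists>B. \<forall>z\<in>S. f z \<le> B"
  then obtain B where "\<forall>z\<in>S. f z \<le> B" by blast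
  then have "(SUP z\<in>S. ennreal (f z)) \<le> ennreal B"
    by (intro SUP_least) (auto intro: ennreal_leI)
  then show "(SUP z\<in>S. ennreal (f z)) < \<infinity>"
    by (simp add: order_le_less_trans)
qed

text \<open>One differentiation turns \<open>\<phi>^(k+1) \<psi>\<close> into
  \<open>\<phi>^k \<psi>2\<close> with another holomorphic cofactor, so an induction over all
  \<open>\<psi>\<close> replaces the Leibniz rule. Since \<open>\<phi> w = 0\<close>,
  \<open>\<psi>2 w = (k + 1) * deriv \<phi> w * \<psi> w\<close>; these factors multiply up to the
  factorial.\<close>

lemma higher_deriv_power_mult_at_zero:
  assumes S: "open S" "w \<in> S" and \<phi>: "\<phi> holomorphic_on S" "\<phi> w = 0"
    and "\<psi> holomorphic_on S"
  shows "(\<forall>j<k. (deriv ^^ j) (\<lambda>x. \<phi> x ^ k * \<psi> x) w = 0) \<and>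
         (deriv ^^ k) (\<lambda>x. \<phi> x ^ k * \<psi> x) w = fact k * deriv \<phi> w ^ k * \<psi> w"
  using \<open>\<psi> holomorphic_on S\<close>
proof (induction k arbitrary: \<psi>)
  case 0
  then show ?case by simp
next
  case (Suc k)
  define \<psi>2 where "\<psi>2 = (\<lambda>x. of_nat (Suc k) * deriv \<phi> x * \<psi> x + \<phi> x * deriv \<psi> x)"
  have hol2: "\<psi>2 holomorphic_on S"
    unfolding \<psi>2_def using \<phi> Suc.prems S
    by (intro holomorphic_intros) auto
  have dv: "deriv (\<lambda>x. \<phi> x ^ Suc k * \<psi> x) x = \<phi> x ^ k * \<psi>2 x" if "x \<in> S" for x
  proof -
    have d1: "(\<phi> has_field_derivative deriv \<phi> x) (at x)"
      using \<phi> S that holomorphic_derivI by blast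
    have d2: "(\<psi> has_field_derivative deriv \<psi> x) (at x)"
      using Suc.prems S that holomorphic_derivI by blast
    have "((\<lambda>x. \<phi> x ^ Suc k * \<psi> x) has_field_derivative \<phi> x ^ k * \<psi>2 x) (at x)"
      by (rule derivative_eq_intros d1 d2 refl)+ (simp add: \<psi>2_def algebra_simps)
    then show ?thesis by (rule DERIV_imp_deriv)
  qed
  \<comment> \<open>The derivative is known only on \<open>S\<close>, so further derivatives at
    \<open>w\<close> are compared through equality near \<open>w\<close>.\<close>
  have ev: "\<forall>\<^sub>F x in nhds w. deriv (\<lambda>x. \<phi> x ^ Suc k * \<psi> x) x = \<phi> x ^ k * \<psi>2 x"
    using S dv by (auto simp: eventually_nhds)
  have step: "(deriv ^^ Suc i) (\<lambda>x. \<phi> x ^ Suc k * \<psi> x) w = (deriv ^^ i) (\<lambda>x. \<phi> x ^ k * \<psi>2 x) w" for i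
    using higher_deriv_cong_ev[OF ev refl, of i] by (simp only: funpow_Suc_right o_def)
  note IH = Suc.IH[OF hol2]
  have "(deriv ^^ j) (\<lambda>x. \<phi> x ^ Suc k * \<psi> x) w = 0" if "j < Suc k" for j
  proof (cases j)
    case 0
    then show ?thesis using \<phi> by simp
  next
    case (Suc i)
    then show ?thesis using step[of i] IH that by simp
  qed
  moreover have "(deriv ^^ Suc k) (\<lambda>x. \<phi> x ^ Suc k * \<psi> x) w
      = fact (Suc k) * deriv \<phi> w ^ Suc k * \<psi> w"
    unfolding step using IH \<phi> by (simp add: \<psi>2_def)
  ultimately show ?case by blast
qed

text \<open>Cauchy's inequality on the circle about \<open>w\<close> of half the distance to the
  boundary. There \<open>1 - norm x\<close> is comparable to \<open>1 - norm w\<close>, so a growth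
  bound for \<open>f\<close> supplies a single \<open>B\<close>.\<close>

lemma norm_higher_deriv_le_disk:
  assumes hol: "f holomorphic_on disk" and w: "w \<in> disk"
    and B: "\<And>x. x \<in> disk \<Longrightarrow> norm (x - w) \<le> (1 - norm w) / 2 \<Longrightarrow> norm (f x) \<le> B"
  shows "norm ((deriv ^^ k) f w) \<le> fact k * 2 ^ k * B / (1 - norm w) ^ k"
proof -
  define r where "r = (1 - norm w) / 2"
  have r: "r > 0" using w by (simp add: r_def)
  have sub: "cball w r \<subseteq> disk"
  proof
    fix x assume "x \<in> cball w r"
    then have "norm (x - w) \<le> r" by (simp add: dist_norm norm_minus_commute)
    moreover have "norm x \<le> norm (x - w) + norm w" using norm_triangle_sub[of x w] by simp
    ultimately show "x \<in> disk" using w by (simp add: r_def)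
  qed
  have "norm ((deriv ^^ k) f w) \<le> fact k * B / r ^ k"
  proof (rule Cauchy_inequality)
    show "f holomorphic_on ball w r"
      using hol sub by (meson ball_subset_cball holomorphic_on_subset)
    show "continuous_on (cball w r) f"
      using hol sub holomorphic_on_imp_continuous_on continuous_on_subset by blast
    show "norm (f x) \<le> B" if "norm (w - x) = r" for x
    proof (rule B)
      show "x \<in> disk" using that sub by (auto simp: dist_norm)
      show "norm (x - w) \<le> (1 - norm w) / 2" using that by (simp add: r_def norm_minus_commute)
    qed
  qed (fact r)
  then show ?thesis by (simp add: r_def field_simps)
qed

text \<open>Solves a triangular system of inequalities from the last unknown backwards: for
  \<open>k = n\<close> the sum is empty, and bounds for all larger indices are inserted into the
  inequality for \<open>k\<close>. Induction on \<open>n - k\<close> expresses this descent.\<close>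

lemma triangular_bounded:
  fixes A :: "nat \<Rightarrow> 'z \<Rightarrow> real"
  assumes nn: "\<And>k z. z \<in> S \<Longrightarrow> 0 \<le> A k z"
    and rec: "\<And>k z. k \<le> n \<Longrightarrow> z \<in> S \<Longrightarrow> A k z \<le> D + C * (\<Sum>j\<in>{k<..n}. A j z)"
    and "k \<le> n" and C: "0 \<le> C"
  shows "\<exists>B. \<forall>z\<in>S. A k z \<le> B"
  using \<open>k \<le> n\<close>
proof (induction "n - k" arbitrary: k rule: less_induct)
  case less
  have "\<exists>B. \<forall>z\<in>S. A j z \<le> B" if "j \<in> {k<..n}" for j
    using that less(1)[of j] by auto
  then obtain B where B: "\<And>j z. j \<in> {k<..n} \<Longrightarrow> z \<in> S \<Longrightarrow> A j z \<le> B j"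
    by metis
  have "A k z \<le> D + C * (\<Sum>j\<in>{k<..n}. B j)" if "z \<in> S" for z
    using rec[OF less(2) that] B that C
    by (intro order_trans[OF rec[OF less(2) that]] add_left_mono mult_left_mono sum_mono) auto
  then show ?case by blast
qed

text \<open>The common core of (d) implies (c) and (e) implies (c); only the family \<open>h\<close>
  differs. For \<open>h k w\<close> at \<open>w = \<tau> z\<close>, \<open>diag\<close> makes the
  term of index \<open>k\<close> large, while \<open>up\<close> and Cauchy's inequality control the
  terms of higher index by the normalized coefficients \<open>A j z\<close>, which yields a
  triangular system.\<close>

lemma pointwise_bounds_of_tests:
  fixes \<gamma> c C D :: real
  assumes \<tau>: "\<tau> ` disk \<subseteq> disk" and \<nu>: "\<And>z. z \<in> disk \<Longrightarrow> 0 \<le> \<nu> z"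
    and hol: "\<And>k w. k \<le> n \<Longrightarrow> w \<in> disk \<Longrightarrow> h k w holomorphic_on disk"
    and low: "\<And>j k w. j < k \<Longrightarrow> k \<le> n \<Longrightarrow> w \<in> disk \<Longrightarrow> (deriv ^^ j) (h k w) w = 0"
    and diag: "\<And>k w. k \<le> n \<Longrightarrow> w \<in> disk \<Longrightarrow>
        c \<le> norm ((deriv ^^ k) (h k w) w) * (1 - norm w) ^ k * (1 - norm w) powr \<gamma>"
    and up: "\<And>k w x. k \<le> n \<Longrightarrow> w \<in> disk \<Longrightarrow> x \<in> disk \<Longrightarrow> norm (x - w) \<le> (1 - norm w) / 2 \<Longrightarrow>
        norm (h k w x) * (1 - norm w) powr \<gamma> \<le> C"
    and S: "\<And>k z. k \<le> n \<Longrightarrow> z \<in> disk \<Longrightarrow> \<nu> z * norm (S_op n u \<tau> (h k (\<tau> z)) z) \<le> D"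
    and c: "c > 0" and k: "k \<le> n"
  shows "\<exists>B. \<forall>z\<in>disk. \<nu> z * norm (u k z) / (1 - norm (\<tau> z)) powr (real k + \<gamma>) \<le> B"
proof -
  define A where "A = (\<lambda>k z. \<nu> z * norm (u k z) / (1 - norm (\<tau> z)) powr (real k + \<gamma>))"
  define E where "E = (fact n * 2 ^ n * C)"
  \<comment> \<open>At the origin the weight factor is 1, so \<open>C\<close> dominates a
    norm.\<close>
  have C0: "0 \<le> C"
    using up[of 0 0 0] by (simp) (smt (verit, best) norm_ge_zero)
  have rec: "A k z \<le> D / c + E / c * (\<Sum>j\<in>{k<..n}. A j z)" if k: "k \<le> n" and z: "z \<in> disk" for k z
  proof -
    define w where "w = \<tau> z"
    define t where "t = 1 - norm w"
    have w: "w \<in> disk" using \<tau> z w_def by blast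
    then have t: "t > 0" by (simp add: t_def)
    have pw: "t powr (real j + \<gamma>) = t ^ j * t powr \<gamma>" for j
      using t by (simp add: powr_add powr_realpow)
    have Aj: "\<nu> z * norm (u j z) = A j z * (t ^ j * t powr \<gamma>)" for j
      using t by (simp add: A_def w_def[symmetric] t_def[symmetric] pw)
    \<comment> \<open>The scaling by \<open>t\<close> to the power \<open>j + \<gamma>\<close> is
      the inverse of the one in \<open>A j z\<close>; hence the bound depends on neither
      \<open>w\<close> nor \<open>j\<close>.\<close>
    have dj: "norm ((deriv ^^ j) (h k w) w) * (t ^ j * t powr \<gamma>) \<le> E" if "j \<le> n" for j
    proof -
      have "norm ((deriv ^^ j) (h k w) w) \<le> fact j * 2 ^ j * (C / t powr \<gamma>) / (1 - norm w) ^ j"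
      proof (rule norm_higher_deriv_le_disk[OF hol[OF k w] w])
        fix x assume "x \<in> disk" "norm (x - w) \<le> (1 - norm w) / 2"
        then show "norm (h k w x) \<le> C / t powr \<gamma>"
          using up[OF k w] t by (simp add: field_simps t_def)
      qed
      then have "norm ((deriv ^^ j) (h k w) w) * (t ^ j * t powr \<gamma>) \<le> fact j * 2 ^ j * C"
        using t by (simp add: field_simps flip: t_def)
      also have "\<dots> \<le> E"
        unfolding E_def using that C0
        by (intro mult_mono) (auto intro: fact_mono)
      finally show ?thesis .
    qed
    define T where "T = (\<lambda>j. u j z * (deriv ^^ j) (h k w) w)"
    have Sx: "S_op n u \<tau> (h k w) z = T k + (\<Sum>j\<in>{k<..n}. T j)"
    proof -
      have "S_op n u \<tau> (h k w) z = (\<Sum>j\<le>n. T j)"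
        by (simp add: S_op_def T_def w_def)
      also have "\<dots> = (\<Sum>j\<in>{k..n}. T j)"
        using low[OF _ k w] by (intro sum.mono_neutral_right) (auto simp: T_def)
      also have "\<dots> = T k + (\<Sum>j\<in>{k<..n}. T j)"
        using k by (simp add: sum.head)
      finally show ?thesis .
    qed
    have nT: "\<nu> z * norm (T j) = A j z * (norm ((deriv ^^ j) (h k w) w) * (t ^ j * t powr \<gamma>))" for j
      using Aj[of j] by (simp add: T_def norm_mult mult_ac)
    have A0: "0 \<le> A j z" for j using \<nu>[OF z] by (simp add: A_def)
    have "A k z * c \<le> \<nu> z * norm (T k)"
      unfolding nT using diag[OF k w] A0 by (intro mult_left_mono) (auto simp: t_def mult_ac)
    also have "norm (T k) \<le> norm (S_op n u \<tau> (h k w) z) + norm (\<Sum>j\<in>{k<..n}. T j)"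
      unfolding Sx using norm_triangle_ineq4[of "T k + (\<Sum>j\<in>{k<..n}. T j)" "(\<Sum>j\<in>{k<..n}. T j)"] by simp
    also have "norm (\<Sum>j\<in>{k<..n}. T j) \<le> (\<Sum>j\<in>{k<..n}. norm (T j))" by (rule norm_sum)
    finally have "A k z * c \<le> \<nu> z * norm (S_op n u \<tau> (h k w) z) + (\<Sum>j\<in>{k<..n}. \<nu> z * norm (T j))"
      using \<nu>[OF z] by (simp add: distrib_left sum_distrib_left mult_left_mono)
    also have "\<dots> \<le> D + (\<Sum>j\<in>{k<..n}. A j z * E)"
    proof (intro add_mono sum_mono)
      show "\<nu> z * norm (S_op n u \<tau> (h k w) z) \<le> D" using S[OF k z] by (simp add: w_def)
      show "\<nu> z * norm (T j) \<le> A j z * E" if "j \<in> {k<..n}" for j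
        unfolding nT using that dj A0 by (intro mult_left_mono) auto
    qed
    finally have "A k z * c \<le> D + E * (\<Sum>j\<in>{k<..n}. A j z)"
      by (simp add: sum_distrib_left mult_ac)
    then show ?thesis using c by (simp add: field_simps)
  qed
  have "\<exists>B. \<forall>z\<in>disk. A k z \<le> B"
  proof (rule triangular_bounded[OF _ rec k])
    show "0 \<le> A k z" if "z \<in> disk" for k z using \<nu>[OF that] by (simp add: A_def)
    show "0 \<le> E / c" using c C0 by (simp add: E_def)
  qed
  then show ?thesis by (simp add: A_def)
qed

subsection \<open>The conditions (a) to (d)\<close>

text \<open>A real bound \<open>M\<close> in place of the norm keeps the estimate within the reals
  and applies to a whole bounded set with one \<open>M\<close>.\<close>

definition point_eval_bound :: "hspace \<Rightarrow> bool"
  where "point_eval_bound X \<longleftrightarrow> (\<exists>C\<ge>0. \<forall>f M. f holomorphic_on disk \<longrightarrow> 0 \<le> M \<longrightarrow>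
    norm_of X f \<le> ennreal M \<longrightarrow> (\<forall>z\<in>disk. norm (f z) \<le> C * M / (1 - norm z) powr gamma_of X))"

text \<open>One \<open>C\<close> can serve all \<open>k\<close> because
  \<open>|sigma a z| \<le> 1\<close> on the disk.\<close>

definition test_bound :: "hspace \<Rightarrow> bool"
  where "test_bound X \<longleftrightarrow> (\<exists>C\<ge>0. \<forall>a\<in>disk. \<forall>k.
    norm_of X (\<lambda>z. test_fun (gamma_of X) a z * sigma a z ^ k) \<le> ennreal C)"

lemma one_minus_norm_square_bounds:
  fixes w :: "'a::real_normed_vector"
  assumes "norm w < 1"
  shows "0 < 1 - (norm w)\<^sup>2" "1 - norm w \<le> 1 - (norm w)\<^sup>2" "1 - (norm w)\<^sup>2 \<le> 2 * (1 - norm w)"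
proof -
  have eq: "1 - (norm w)\<^sup>2 = (1 - norm w) * (1 + norm w)" by (simp add: power2_eq_square algebra_simps)
  show "0 < 1 - (norm w)\<^sup>2" unfolding eq using assms by (intro mult_pos_pos) (auto simp: add_pos_nonneg)
  show "1 - norm w \<le> 1 - (norm w)\<^sup>2" unfolding eq using assms by (simp add: mult_le_cancel_left1)
  show "1 - (norm w)\<^sup>2 \<le> 2 * (1 - norm w)" unfolding eq using mult_left_mono[of "1 + norm w" 2 "1 - norm w"] assms by (simp add: mult.commute)
qed

lemma weighted_norm_le_iff:
  assumes "0 \<le> B"
  shows "weighted_norm \<nu> f \<le> ennreal B \<longleftrightarrow> (\<forall>z\<in>disk. \<nu> z * norm (f z) \<le> B)"
  unfolding weighted_norm_def using assms by (simp add: SUP_le_iff ennreal_le_iff)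

text \<open>\<open>1 - |w|\<close> and \<open>1 - |w|^2\<close> differ by a factor between 1 and 2,
  and the exponent is nonnegative, so the two weights agree up to
  \<open>2 powr (k + \<gamma>)\<close>. All later estimates use \<open>1 - |w|\<close>, the distance
  to the boundary.\<close>

lemma cond_c_iff:
  assumes \<tau>: "\<tau> ` disk \<subseteq> disk" and nu: "\<forall>z\<in>disk. 0 \<le> \<nu> z" and \<gamma>: "0 \<le> gamma_of X"
  shows "cond_c X n u \<tau> \<nu> \<longleftrightarrow>
    (\<forall>k\<le>n. \<exists>B. \<forall>z\<in>disk. \<nu> z * norm (u k z) / (1 - norm (\<tau> z)) powr (real k + gamma_of X) \<le> B)"
proof -
  note \<nu> = nu[rule_format]
  have eq: "cond_c X n u \<tau> \<nu> \<longleftrightarrow>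
    (\<forall>k\<le>n. \<exists>B. \<forall>z\<in>disk. \<nu> z * norm (u k z) / (1 - (norm (\<tau> z))\<^sup>2) powr (real k + gamma_of X) \<le> B)"
    unfolding cond_c_def using \<nu> by (intro all_cong SUP_ennreal_finite_iff) simp
  have 1: "\<nu> z * norm (u k z) / (1 - (norm (\<tau> z))\<^sup>2) powr (real k + gamma_of X)
      \<le> \<nu> z * norm (u k z) / (1 - norm (\<tau> z)) powr (real k + gamma_of X)"
    and 2: "\<nu> z * norm (u k z) / (1 - norm (\<tau> z)) powr (real k + gamma_of X)
      \<le> 2 powr (real k + gamma_of X) * (\<nu> z * norm (u k z) / (1 - (norm (\<tau> z))\<^sup>2) powr (real k + gamma_of X))"
    if z: "z \<in> disk" for z k
  proof -
    define s where "s = real k + gamma_of X"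
    have s: "s \<ge> 0" using \<gamma> by (simp add: s_def)
    have w: "norm (\<tau> z) < 1" using \<tau> z by (auto simp: image_subset_iff)
    note b = one_minus_norm_square_bounds[OF w]
    have p1: "(1 - norm (\<tau> z)) powr s \<le> (1 - (norm (\<tau> z))\<^sup>2) powr s"
      using s w b by (intro powr_mono2) auto
    show "\<nu> z * norm (u k z) / (1 - (norm (\<tau> z))\<^sup>2) powr (real k + gamma_of X)
      \<le> \<nu> z * norm (u k z) / (1 - norm (\<tau> z)) powr (real k + gamma_of X)"
      unfolding s_def[symmetric] using p1 w b \<nu>[OF z] by (intro divide_left_mono mult_pos_pos) auto
    have "(1 - (norm (\<tau> z))\<^sup>2) powr s \<le> (2 * (1 - norm (\<tau> z))) powr s"
      using s w b by (intro powr_mono2) auto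
    also have "\<dots> = 2 powr s * (1 - norm (\<tau> z)) powr s"
      using w by (subst powr_mult) auto
    finally have "(1 - (norm (\<tau> z))\<^sup>2) powr s \<le> 2 powr s * (1 - norm (\<tau> z)) powr s" .
    then have "\<nu> z * norm (u k z) * (1 - (norm (\<tau> z))\<^sup>2) powr s
       \<le> \<nu> z * norm (u k z) * (2 powr s * (1 - norm (\<tau> z)) powr s)"
      using \<nu>[OF z] by (intro mult_left_mono) auto
    then show "\<nu> z * norm (u k z) / (1 - norm (\<tau> z)) powr (real k + gamma_of X)
      \<le> 2 powr (real k + gamma_of X) * (\<nu> z * norm (u k z) / (1 - (norm (\<tau> z))\<^sup>2) powr (real k + gamma_of X))"
      unfolding s_def[symmetric] using w b by (simp add: field_simps)
  qed
  show ?thesis unfolding eq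
  proof (intro all_cong iffI)
    fix k
    assume "\<exists>B. \<forall>z\<in>disk. \<nu> z * norm (u k z) / (1 - (norm (\<tau> z))\<^sup>2) powr (real k + gamma_of X) \<le> B"
    then obtain B where B: "\<And>z. z \<in> disk \<Longrightarrow>
      \<nu> z * norm (u k z) / (1 - (norm (\<tau> z))\<^sup>2) powr (real k + gamma_of X) \<le> B" by blast
    show "\<exists>B. \<forall>z\<in>disk. \<nu> z * norm (u k z) / (1 - norm (\<tau> z)) powr (real k + gamma_of X) \<le> B"
      by (intro exI[of _ "2 powr (real k + gamma_of X) * B"] ballI order_trans[OF 2]
          mult_left_mono B) auto
  next
    fix k
    assume "\<exists>B. \<forall>z\<in>disk. \<nu> z * norm (u k z) / (1 - norm (\<tau> z)) powr (real k + gamma_of X) \<le> B"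
    then show "\<exists>B. \<forall>z\<in>disk. \<nu> z * norm (u k z) / (1 - (norm (\<tau> z))\<^sup>2) powr (real k + gamma_of X) \<le> B"
      using order_trans[OF 1] by blast
  qed
qed

lemma cond_b_iff_cond_c:
  assumes \<nu>: "\<And>z. z \<in> disk \<Longrightarrow> 0 \<le> \<nu> z"
  shows "cond_b X n u \<tau> \<nu> \<longleftrightarrow> cond_c X n u \<tau> \<nu>"
proof -
  define A where "A = (\<lambda>k z. \<nu> z * norm (u k z) / (1 - (norm (\<tau> z))\<^sup>2) powr (real k + gamma_of X))"
  have nn: "0 \<le> A k z" if "z \<in> disk" for k z using \<nu>[OF that] by (simp add: A_def)
  have b: "cond_b X n u \<tau> \<nu> \<longleftrightarrow> (\<exists>B. \<forall>z\<in>disk. (\<Sum>k\<le>n. A k z) \<le> B)"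
    using SUP_ennreal_finite_iff[of disk "\<lambda>z. \<Sum>k\<le>n. A k z"] nn
    by (simp add: cond_b_def A_def sum_nonneg)
  have c: "cond_c X n u \<tau> \<nu> \<longleftrightarrow> (\<forall>k\<le>n. \<exists>B. \<forall>z\<in>disk. A k z \<le> B)"
    using SUP_ennreal_finite_iff[of disk "A k" for k] nn by (simp add: cond_c_def A_def)
  show ?thesis unfolding b c
  proof
    assume "\<exists>B. \<forall>z\<in>disk. (\<Sum>k\<le>n. A k z) \<le> B"
    then obtain B where B: "\<And>z. z \<in> disk \<Longrightarrow> (\<Sum>k\<le>n. A k z) \<le> B" by blast
    show "\<forall>k\<le>n. \<exists>B. \<forall>z\<in>disk. A k z \<le> B"
    proof (intro allI impI exI ballI)
      fix k z assume "k \<le> n" "z \<in> disk"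
      then have "A k z \<le> (\<Sum>k\<le>n. A k z)" using nn by (intro member_le_sum) auto
      then show "A k z \<le> B" using B[OF \<open>z \<in> disk\<close>] by simp
    qed
  next
    assume "\<forall>k\<le>n. \<exists>B. \<forall>z\<in>disk. A k z \<le> B"
    then obtain B where "\<And>k z. k \<le> n \<Longrightarrow> z \<in> disk \<Longrightarrow> A k z \<le> B k" by metis
    then show "\<exists>B. \<forall>z\<in>disk. (\<Sum>k\<le>n. A k z) \<le> B"
      by (intro exI[of _ "\<Sum>k\<le>n. B k"] ballI sum_mono) auto
  qed
qed

text \<open>The constant \<open>K\<close> is the same for all \<open>f\<close>. This serves bounded
  sets in (a) and also the decaying norms of the monomials in (e).\<close>

lemma S_op_norm_bound:
  assumes \<tau>: "\<tau> ` disk \<subseteq> disk" and \<nu>: "\<And>z. z \<in> disk \<Longrightarrow> 0 \<le> \<nu> z" and \<gamma>: "0 \<le> gamma_of X"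
    and c: "cond_c X n u \<tau> \<nu>" and P: "point_eval_bound X"
  shows "\<exists>K\<ge>0. \<forall>f M. f holomorphic_on disk \<longrightarrow> 0 \<le> M \<longrightarrow> norm_of X f \<le> ennreal M \<longrightarrow>
    weighted_norm \<nu> (S_op n u \<tau> f) \<le> ennreal (K * M)"
proof -
  have nu: "\<forall>z\<in>disk. 0 \<le> \<nu> z" using \<nu> by blast
  let ?g = "gamma_of X"
  obtain C where C: "C \<ge> 0" "\<And>f M z. f holomorphic_on disk \<Longrightarrow> 0 \<le> M \<Longrightarrow>
      norm_of X f \<le> ennreal M \<Longrightarrow> z \<in> disk \<Longrightarrow> norm (f z) \<le> C * M / (1 - norm z) powr ?g"
    using P unfolding point_eval_bound_def by metis
  obtain B where B: "\<And>k z. k \<le> n \<Longrightarrow> z \<in> disk \<Longrightarrow>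
      \<nu> z * norm (u k z) / (1 - norm (\<tau> z)) powr (real k + ?g) \<le> B k"
  proof -
    have "\<forall>k. \<exists>B. k \<le> n \<longrightarrow> (\<forall>z\<in>disk. \<nu> z * norm (u k z) / (1 - norm (\<tau> z)) powr (real k + ?g) \<le> B)"
      using c[unfolded cond_c_iff[OF \<tau> nu \<gamma>]] by blast
    from choice[OF this] show thesis using that by blast
  qed
  have B0: "0 \<le> B k" if "k \<le> n" for k
    by (rule order_trans[OF _ B[OF that, of 0]]) (use \<nu>[of 0] in auto)
  define K where "K = (\<Sum>k\<le>n. B k * (fact k * 2 ^ k * (2 powr ?g * C)))"
  have K0: "K \<ge> 0" unfolding K_def using B0 C by (intro sum_nonneg mult_nonneg_nonneg) auto
  have "weighted_norm \<nu> (S_op n u \<tau> f) \<le> ennreal (K * M)"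
    if f: "f holomorphic_on disk" and M: "0 \<le> M" and nf: "norm_of X f \<le> ennreal M" for f M
  proof -
    have "\<nu> z * norm (S_op n u \<tau> f z) \<le> K * M" if z: "z \<in> disk" for z
    proof -
      define w where "w = \<tau> z"
      define t where "t = 1 - norm w"
      have w: "w \<in> disk" using \<tau> z w_def by blast
      then have t: "t > 0" by (simp add: t_def)
      have d: "norm ((deriv ^^ k) f w) \<le> fact k * 2 ^ k * (2 powr ?g * C) * M / t powr (real k + ?g)" for k
      proof -
        have "norm ((deriv ^^ k) f w) \<le> fact k * 2 ^ k * (C * M / (t / 2) powr ?g) / (1 - norm w) ^ k"
        proof (rule norm_higher_deriv_le_disk[OF f w])
          fix x assume x: "x \<in> disk" "norm (x - w) \<le> (1 - norm w) / 2"
          \<comment> \<open>Halving the distance to the boundary costs the factor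
            \<open>2 powr \<gamma>\<close> that appears in \<open>K\<close>.\<close>
          then have "t / 2 \<le> 1 - norm x"
            using norm_triangle_sub[of x w] by (simp add: t_def field_simps)
          then have "(t / 2) powr ?g \<le> (1 - norm x) powr ?g" using t \<gamma> by (intro powr_mono2) auto
          then have "C * M / (1 - norm x) powr ?g \<le> C * M / (t / 2) powr ?g"
            using t x C M by (intro divide_left_mono) auto
          with C(2)[OF f M nf x(1)] show "norm (f x) \<le> C * M / (t / 2) powr ?g" by linarith
        qed
        also have "\<dots> = fact k * 2 ^ k * (2 powr ?g * C) * M / t powr (real k + ?g)"
          using t by (simp add: powr_add powr_realpow powr_divide mult_ac flip: t_def)
        finally show ?thesis .
      qed
      have "\<nu> z * norm (S_op n u \<tau> f z) \<le> \<nu> z * (\<Sum>k\<le>n. norm (u k z) * norm ((deriv ^^ k) f w))"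
        unfolding S_op_def w_def using \<nu>[OF z]
        by (intro mult_left_mono order_trans[OF norm_sum]) (auto simp: norm_mult)
      also have "\<dots> = (\<Sum>k\<le>n. \<nu> z * norm (u k z) * norm ((deriv ^^ k) f w))"
        by (simp add: sum_distrib_left mult.assoc)
      also have "\<dots> \<le> (\<Sum>k\<le>n. B k * (fact k * 2 ^ k * (2 powr ?g * C)) * M)"
      proof (rule sum_mono)
        fix k assume "k \<in> {..n}"
        then have k: "k \<le> n" by simp
        let ?e = "fact k * 2 ^ k * (2 powr ?g * C) * M"
        have "\<nu> z * norm (u k z) * norm ((deriv ^^ k) f w)
          \<le> \<nu> z * norm (u k z) * (?e / t powr (real k + ?g))"
          using \<nu>[OF z] by (intro mult_left_mono d) auto
        also have "\<dots> = \<nu> z * norm (u k z) / t powr (real k + ?g) * ?e" by simp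
        also have "\<dots> \<le> B k * ?e"
          using B[OF k z] C M by (intro mult_right_mono) (auto simp: t_def w_def)
        finally show "\<nu> z * norm (u k z) * norm ((deriv ^^ k) f w)
            \<le> B k * (fact k * 2 ^ k * (2 powr ?g * C)) * M" by (simp add: mult.assoc)
      qed
      also have "\<dots> = K * M" by (simp add: K_def sum_distrib_right)
      finally show ?thesis .
    qed
    then show ?thesis using K0 M by (subst weighted_norm_le_iff) auto
  qed
  with K0 show ?thesis by blast
qed

lemma S_op_holomorphic:
  assumes "\<And>k. k \<le> n \<Longrightarrow> u k holomorphic_on disk" "\<tau> holomorphic_on disk" "\<tau> ` disk \<subseteq> disk"
    "f holomorphic_on disk"
  shows "S_op n u \<tau> f holomorphic_on disk"
proof -
  have "(\<lambda>z. (deriv ^^ k) f (\<tau> z)) holomorphic_on disk" for k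
    using holomorphic_on_compose_gen[OF assms(2) holomorphic_higher_deriv[OF assms(4) open_ball] assms(3)]
    by (simp add: o_def)
  then have "(\<lambda>z. \<Sum>k\<le>n. u k z * (deriv ^^ k) f (\<tau> z)) holomorphic_on disk"
    using assms(1) by (intro holomorphic_on_sum holomorphic_on_mult) auto
  then show ?thesis by (simp add: S_op_def[abs_def])
qed

section \<open>The test functions and the disk automorphisms\<close>

lemma one_minus_cnj_mult_props:
  assumes "a \<in> disk" "z \<in> disk"
  shows "0 < Re (1 - cnj a * z)" "1 - norm a \<le> norm (1 - cnj a * z)" "1 - cnj a * z \<noteq> 0"
proof -
  have l: "norm (cnj a * z) \<le> norm a"
    using assms by (simp add: norm_mult mult_left_le)
  have "norm (cnj a * z) < 1" using l assms by simp
  then have "Re (cnj a * z) < 1" using complex_Re_le_cmod[of "cnj a * z"] by linarith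
  then show "0 < Re (1 - cnj a * z)" by simp
  then show "1 - cnj a * z \<noteq> 0" by force
  show "1 - norm a \<le> norm (1 - cnj a * z)"
    using norm_triangle_ineq2[of 1 "cnj a * z"] l by simp
qed

lemma norm_test_fun:
  assumes "a \<in> disk" "z \<in> disk"
  shows "norm (test_fun \<gamma> a z) = ((1 - (norm a)\<^sup>2) / (norm (1 - cnj a * z))\<^sup>2) powr \<gamma>"
proof -
  have "0 < 1 - (norm a)\<^sup>2" using one_minus_norm_square_bounds[of a] assms by simp
  then show ?thesis
    unfolding test_fun_def
    by (subst norm_powr_real_powr') (simp_all add: norm_divide norm_power del: of_real_diff)
qed

lemma holomorphic_test_fun:
  assumes a: "a \<in> disk"
  shows "test_fun \<gamma> a holomorphic_on disk"
proof -
  let ?s = "1 - (norm a)\<^sup>2"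
  have s: "0 < ?s" using one_minus_norm_square_bounds[of a] a by simp
  have "complex_of_real ?s / (1 - cnj a * z)\<^sup>2 \<notin> \<real>\<^sub>\<le>\<^sub>0" if z: "z \<in> disk" for z
  proof
    define v where "v = 1 / (1 - cnj a * z)"
    assume "complex_of_real ?s / (1 - cnj a * z)\<^sup>2 \<in> \<real>\<^sub>\<le>\<^sub>0"
    then have "complex_of_real ?s * v\<^sup>2 \<in> \<real>\<^sub>\<le>\<^sub>0" by (simp add: v_def power_divide)
    then have n: "?s * ((Re v)\<^sup>2 - (Im v)\<^sup>2) \<le> 0" "?s * (2 * Re v * Im v) = 0"
      by (auto simp: complex_nonpos_Reals_iff Re_power2 Im_power2 simp del: of_real_diff)
    \<comment> \<open>The reciprocal of a point of the right half plane lies there again. A real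
      square of \<open>v\<close> then forces \<open>Im v = 0\<close>, which makes the square
      positive.\<close>
    have r: "Re v > 0"
      using one_minus_cnj_mult_props[OF a z] by (simp add: v_def Re_divide' zero_less_divide_iff)
    with n s have "Im v = 0" by auto
    with n have "?s * (Re v)\<^sup>2 \<le> 0" by simp
    moreover have "?s * (Re v)\<^sup>2 > 0" using s r by (intro mult_pos_pos) auto
    ultimately show False by linarith
  qed
  moreover have "(1 - cnj a * z) \<noteq> 0" if "z \<in> disk" for z
    using one_minus_cnj_mult_props[OF a that] by simp
  ultimately have "(\<lambda>z. (of_real ?s / (1 - cnj a * z)\<^sup>2) powr of_real \<gamma>) holomorphic_on disk"
    by (intro holomorphic_on_powr holomorphic_intros) auto
  then show ?thesis by (simp add: test_fun_def[abs_def])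
qed

lemma sigma_eq_moebius: "sigma a z = - Moebius_function 0 a z"
  by (simp add: sigma_def Moebius_function_def minus_divide_left)

lemma holomorphic_sigma: "a \<in> disk \<Longrightarrow> sigma a holomorphic_on disk"
proof -
  assume "a \<in> disk"
  then have "Moebius_function 0 a holomorphic_on disk"
    by (intro Moebius_function_holomorphic) simp
  then have "(\<lambda>z. - Moebius_function 0 a z) holomorphic_on disk" by (rule holomorphic_on_minus)
  then show ?thesis by (simp add: sigma_eq_moebius[abs_def])
qed

lemma norm_sigma_le: "a \<in> disk \<Longrightarrow> z \<in> disk \<Longrightarrow> norm (sigma a z) \<le> 1"
  using Moebius_function_norm_lt_1[of a z 0] by (simp add: sigma_eq_moebius)

lemma deriv_sigma:
  assumes "a \<in> disk"
  shows "deriv (sigma a) a = - 1 / of_real (1 - (norm a)\<^sup>2)"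
proof -
  have nz: "1 - cnj a * a \<noteq> 0" using one_minus_cnj_mult_props[OF assms assms] by simp
  have sig: "(sigma a has_field_derivative
     ((- 1) * (1 - cnj a * a) - (a - a) * (- cnj a)) / ((1 - cnj a * a) * (1 - cnj a * a))) (at a)"
    unfolding sigma_def[abs_def] by (rule derivative_eq_intros refl nz | simp)+
  have cancel: "- x / (x * x) = - 1 / x" if "x \<noteq> 0" for x :: complex
    using that by (simp add: divide_simps)
  from sig have "deriv (sigma a) a = - (1 - cnj a * a) / ((1 - cnj a * a) * (1 - cnj a * a))"
    by (subst DERIV_imp_deriv) auto
  also have "\<dots> = - 1 / (1 - cnj a * a)" by (rule cancel[OF nz])
  also have "cnj a * a = of_real ((norm a)\<^sup>2)"
    by (metis complex_norm_square mult.commute)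
  finally show ?thesis by simp
qed

lemma norm_test_fun_mult_sigma_le:
  assumes "a \<in> disk" "z \<in> disk"
  shows "norm (test_fun \<gamma> a z * sigma a z ^ k) \<le> norm (test_fun \<gamma> a z)"
  using norm_sigma_le[OF assms] by (simp add: norm_mult norm_power mult_left_le power_le_one)

lemma holomorphic_test_fun_mult_sigma:
  "a \<in> disk \<Longrightarrow> (\<lambda>z. test_fun \<gamma> a z * sigma a z ^ k) holomorphic_on disk"
  by (intro holomorphic_intros holomorphic_test_fun holomorphic_sigma)

lemma cond_d_imp_cond_c:
  assumes \<tau>: "\<tau> ` disk \<subseteq> disk" and \<nu>: "\<And>z. z \<in> disk \<Longrightarrow> 0 \<le> \<nu> z" and \<gamma>: "0 \<le> gamma_of X"
    and d: "cond_d X n u \<tau> \<nu>"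
  shows "cond_c X n u \<tau> \<nu>"
proof -
  have nu: "\<forall>z\<in>disk. 0 \<le> \<nu> z" using \<nu> by blast
  define g where "g = gamma_of X"
  define h where "h = (\<lambda>k a z. test_fun g a z * sigma a z ^ k)"
  have g0: "0 \<le> g" using \<gamma> by (simp add: g_def)
  have "\<exists>B\<ge>0. \<forall>a\<in>disk. \<forall>z\<in>disk. \<nu> z * norm (S_op n u \<tau> (h k a) z) \<le> B" if "k \<le> n" for k
  proof -
    have fin: "(SUP a\<in>disk. weighted_norm \<nu> (S_op n u \<tau> (h k a))) < \<infinity>"
      using d that by (simp add: cond_d_def h_def g_def)
    define B where "B = enn2real (SUP a\<in>disk. weighted_norm \<nu> (S_op n u \<tau> (h k a)))"
    have B0: "0 \<le> B" by (simp add: B_def)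
    have "weighted_norm \<nu> (S_op n u \<tau> (h k a)) \<le> ennreal B" if "a \<in> disk" for a
    proof -
      have "ennreal B = (SUP a\<in>disk. weighted_norm \<nu> (S_op n u \<tau> (h k a)))"
        unfolding B_def using fin by (intro ennreal_enn2real) auto
      then show ?thesis using that by (auto intro: SUP_upper)
    qed
    then show ?thesis using B0 by (auto simp: weighted_norm_le_iff[OF B0] intro!: exI[of _ B])
  qed
  then obtain B where B: "\<And>k. k \<le> n \<Longrightarrow> 0 \<le> B k"
    "\<And>k a z. k \<le> n \<Longrightarrow> a \<in> disk \<Longrightarrow> z \<in> disk \<Longrightarrow> \<nu> z * norm (S_op n u \<tau> (h k a) z) \<le> B k"
    by metis
  have hold: "(\<lambda>x. sigma w x ^ k * test_fun g w x) = h k w" for k w by (simp add: h_def mult.commute)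
  have "\<exists>B. \<forall>z\<in>disk. \<nu> z * norm (u k z) / (1 - norm (\<tau> z)) powr (real k + g) \<le> B" if "k \<le> n" for k
  \<comment> \<open>With \<open>s = 1 - |w|^2\<close> and \<open>t = 1 - |w|\<close>, the
    \<open>k\<close>-th derivative of the test at \<open>w\<close> has modulus \<open>k!\<close>
    times \<open>s\<close> to the power \<open>-(k + g)\<close>; \<open>t / s \<ge> 1 / 2\<close>
    gives \<open>c\<close>. Both \<open>s / 2\<close> and \<open>t\<close> are at most
    \<open>|1 - cnj w * x|\<close>, which gives \<open>C\<close>. The sum in \<open>D\<close> merely
    dominates all \<open>B k\<close>.\<close>
  proof (rule pointwise_bounds_of_tests[OF \<tau> \<nu>, where h = h and c = "1 / 2 powr (real n + g)"
        and C = "2 powr g" and D = "\<Sum>k\<le>n. B k" and n = n])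
    fix k w assume k: "k \<le> n" and w: "w \<in> disk"
    show "h k w holomorphic_on disk" unfolding h_def by (rule holomorphic_test_fun_mult_sigma[OF w])
    have s0: "sigma w w = 0" by (simp add: sigma_def)
    note hd = higher_deriv_power_mult_at_zero[OF open_ball w holomorphic_sigma[OF w] s0
       holomorphic_test_fun[OF w], of k g, unfolded hold]
    show "(deriv ^^ j) (h k w) w = 0" if "j < k" for j using hd that by blast
    define t where "t = 1 - norm w"
    define s where "s = 1 - (norm w)\<^sup>2"
    have st: "0 < t" "0 < s" "t \<le> s" "s \<le> 2 * t"
      using one_minus_norm_square_bounds[of w] w by (auto simp: s_def t_def)
    have tf: "norm (test_fun g w w) = (1 / s) powr g"
    proof -
      have "1 - cnj w * w = of_real s"
        by (simp add: s_def) (metis complex_norm_square mult.commute of_real_power)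
      then show ?thesis unfolding norm_test_fun[OF w w] s_def[symmetric]
        using st(2) by (simp add: power2_eq_square)
    qed
    have "norm ((deriv ^^ k) (h k w) w) * t ^ k * t powr g = fact k * ((t / s) ^ k * (t / s) powr g)"
      using hd st tf by (simp add: deriv_sigma[OF w] norm_mult norm_power norm_divide s_def[symmetric]
          powr_divide power_divide del: of_real_diff)
    also have "\<dots> = fact k * (t / s) powr (real k + g)"
      using st by (simp add: powr_add powr_realpow)
    also have "\<dots> \<ge> 1 * (1 / 2) powr (real n + g)"
    proof (rule mult_mono)
      have "(1 / 2) powr (real n + g) \<le> (1 / 2) powr (real k + g)"
        using k by (intro powr_mono') auto
      also have "\<dots> \<le> (t / s) powr (real k + g)"
        using st g0 by (intro powr_mono2) (auto simp: field_simps)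
      finally show "(1 / 2) powr (real n + g) \<le> (t / s) powr (real k + g)" .
    qed (auto simp: fact_ge_1)
    finally show "1 / 2 powr (real n + g) \<le> norm ((deriv ^^ k) (h k w) w) * (1 - norm w) ^ k * (1 - norm w) powr g"
      by (simp add: t_def powr_divide)
    fix x assume x: "x \<in> disk"
    have "norm (h k w x) * t powr g \<le> norm (test_fun g w x) * t powr g"
      unfolding h_def using norm_test_fun_mult_sigma_le[OF w x] by (intro mult_right_mono) auto
    also have "\<dots> = (s / (norm (1 - cnj w * x))\<^sup>2 * t) powr g"
      unfolding norm_test_fun[OF w x] s_def[symmetric] using st by (subst powr_mult) auto
    also have "\<dots> \<le> 2 powr g"
    proof (rule powr_mono2[OF g0])
      have nz: "norm (1 - cnj w * x) > 0" "t \<le> norm (1 - cnj w * x)"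
        using one_minus_cnj_mult_props[OF w x] by (auto simp: t_def)
      have "s * t \<le> 2 * t * t" using st by (intro mult_right_mono) auto
      also have "\<dots> \<le> 2 * (norm (1 - cnj w * x))\<^sup>2"
        using nz st by (simp add: power2_eq_square mult_mono)
      finally show "s / (norm (1 - cnj w * x))\<^sup>2 * t \<le> 2" using nz by (simp add: field_simps)
      show "0 \<le> s / (norm (1 - cnj w * x))\<^sup>2 * t" using st by simp
    qed
    finally show "norm (h k w x) * (1 - norm w) powr g \<le> 2 powr g" by (simp add: t_def)
  next
    fix k z assume k: "k \<le> n" and z: "z \<in> disk"
    have "\<tau> z \<in> disk" using \<tau> z by blast
    then have "\<nu> z * norm (S_op n u \<tau> (h k (\<tau> z)) z) \<le> B k" using B k z by blast
    also have "\<dots> \<le> (\<Sum>k\<le>n. B k)" using k B(1) by (intro member_le_sum) auto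
    finally show "\<nu> z * norm (S_op n u \<tau> (h k (\<tau> z)) z) \<le> (\<Sum>k\<le>n. B k)" .
  qed (use that in auto)
  then show ?thesis unfolding cond_c_iff[OF \<tau> nu \<gamma>] g_def by blast
qed

text \<open>The cycle is (c), (a), (d), (c), with (b) attached to (c). \<open>P\<close> is used for
  (c) to (a), \<open>T\<close> for (a) to (d).\<close>

lemma cond_a_b_c_d_equivalent:
  assumes hol: "\<And>k. k \<le> n \<Longrightarrow> u k holomorphic_on disk" "\<tau> holomorphic_on disk"
    and \<tau>: "\<tau> ` disk \<subseteq> disk" and \<nu>: "\<And>z. z \<in> disk \<Longrightarrow> 0 \<le> \<nu> z" and \<gamma>: "0 \<le> gamma_of X"
    and P: "point_eval_bound X" and T: "test_bound X"
  shows "(cond_a X n u \<tau> \<nu> \<longleftrightarrow> cond_b X n u \<tau> \<nu>) \<and> (cond_b X n u \<tau> \<nu> \<longleftrightarrow> cond_c X n u \<tau> \<nu>) \<and>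
    (cond_c X n u \<tau> \<nu> \<longleftrightarrow> cond_d X n u \<tau> \<nu>)"
proof -
  have bc: "cond_b X n u \<tau> \<nu> \<longleftrightarrow> cond_c X n u \<tau> \<nu>" by (rule cond_b_iff_cond_c[OF \<nu>])
  have dc: "cond_d X n u \<tau> \<nu> \<Longrightarrow> cond_c X n u \<tau> \<nu>" by (rule cond_d_imp_cond_c[OF \<tau> \<nu> \<gamma>])
  have ca: "cond_a X n u \<tau> \<nu>" if c: "cond_c X n u \<tau> \<nu>"
  proof -
    obtain K where K: "K \<ge> 0" "\<And>f M. f holomorphic_on disk \<Longrightarrow> 0 \<le> M \<Longrightarrow> norm_of X f \<le> ennreal M \<Longrightarrow>
      weighted_norm \<nu> (S_op n u \<tau> f) \<le> ennreal (K * M)"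
      using S_op_norm_bound[OF \<tau> \<nu> \<gamma> c P] by metis
    show ?thesis unfolding cond_a_def bounded_operator_def
    proof (intro allI impI)
      fix B assume B: "bounded_set (norm_of X) B"
      define M where "M = enn2real (SUP f\<in>B. norm_of X f)"
      have fh: "f holomorphic_on disk" and fM: "norm_of X f \<le> ennreal M" if "f \<in> B" for f
      proof -
        show "f holomorphic_on disk" using B that by (auto simp: bounded_set_def space_of_def)
        have "ennreal M = (SUP f\<in>B. norm_of X f)"
          unfolding M_def using B by (intro ennreal_enn2real) (auto simp: bounded_set_def)
        then show "norm_of X f \<le> ennreal M" using that by (auto intro: SUP_upper)
      qed
      have M0: "0 \<le> M" by (simp add: M_def)
      have le: "weighted_norm \<nu> (S_op n u \<tau> f) \<le> ennreal (K * M)" if "f \<in> B" for f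
        using K(2)[OF fh[OF that] M0 fM[OF that]] .
      have "(SUP g\<in>S_op n u \<tau> ` B. weighted_norm \<nu> g) \<le> ennreal (K * M)"
        using le by (intro SUP_least) auto
      moreover have "S_op n u \<tau> f \<in> space_of (weighted_norm \<nu>)" if "f \<in> B" for f
        using S_op_holomorphic[OF hol \<tau> fh[OF that]] le[OF that]
        by (auto simp: space_of_def intro: order_le_less_trans)
      ultimately show "bounded_set (weighted_norm \<nu>) (S_op n u \<tau> ` B)"
        by (auto simp: bounded_set_def intro: order_le_less_trans)
    qed
  qed
  have ad: "cond_d X n u \<tau> \<nu>" if a: "cond_a X n u \<tau> \<nu>"
    unfolding cond_d_def
  proof (intro allI impI)
    fix k assume "k \<le> n"
    define h where "h = (\<lambda>a z. test_fun (gamma_of X) a z * sigma a z ^ k)"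
    obtain C where C: "\<And>a. a \<in> disk \<Longrightarrow> norm_of X (h a) \<le> ennreal C"
      using T unfolding test_bound_def h_def by metis
    have sup: "(SUP f\<in>h ` disk. norm_of X f) < \<infinity>"
      using C by (intro order_le_less_trans[OF SUP_least[of _ _ "ennreal C"]]) auto
    have "norm_of X (h a) < \<infinity>" if "a \<in> disk" for a
      using order_le_less_trans[OF C[OF that] ennreal_less_top] by simp
    \<comment> \<open>For fixed \<open>k\<close> the whole family over \<open>a\<close> is one
      bounded set of \<open>X\<close>, so (a) bounds all its images at once.\<close>
    with sup have "bounded_set (norm_of X) (h ` disk)"
      using holomorphic_test_fun_mult_sigma by (auto simp: bounded_set_def space_of_def h_def)
    then have "bounded_set (weighted_norm \<nu>) (S_op n u \<tau> ` h ` disk)"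
      using a by (simp add: cond_a_def bounded_operator_def)
    then show "(SUP a\<in>disk. weighted_norm \<nu>
       (S_op n u \<tau> (\<lambda>z. test_fun (gamma_of X) a z * sigma a z ^ k))) < \<infinity>"
      by (simp add: bounded_set_def h_def image_image)
  qed
  show ?thesis using bc dc ca ad by blast
qed

subsection \<open>Monomials and the spaces defined by growth\<close>

text \<open>\<open>Suc m\<close> keeps the denominator positive at \<open>m = 0\<close>. The
  property is special to the growth spaces: in \<open>H^p\<close> monomials have norm 1, and in
  Bergman spaces they decay only like \<open>m\<close> to the power
  \<open>-(\<alpha> + 1) / p\<close>.\<close>

definition monomial_bound :: "hspace \<Rightarrow> bool"
  where "monomial_bound X \<longleftrightarrow> (\<exists>C\<ge>0. \<forall>m. norm_of X (\<lambda>z. z ^ m) \<le> ennreal (C / real (Suc m) powr gamma_of X))"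

lemma higher_deriv_sum_monomials:
  fixes c :: "'i \<Rightarrow> complex"
  assumes "finite I"
  shows "(deriv ^^ k) (\<lambda>x. \<Sum>i\<in>I. c i * x ^ e i) z = (\<Sum>i\<in>I. c i * (deriv ^^ k) (\<lambda>x. x ^ e i) z)"
  using assms
proof (induction I)
  case empty
  then show ?case by simp
next
  case (insert i I)
  have "(deriv ^^ k) (\<lambda>x. \<Sum>i\<in>insert i I. c i * x ^ e i) z
      = (deriv ^^ k) (\<lambda>x. c i * x ^ e i + (\<Sum>i\<in>I. c i * x ^ e i)) z"
    using insert by simp
  also have "\<dots> = (deriv ^^ k) (\<lambda>x. c i * x ^ e i) z + (deriv ^^ k) (\<lambda>x. \<Sum>i\<in>I. c i * x ^ e i) z"
    by (rule higher_deriv_add[of _ UNIV]) (auto intro!: holomorphic_intros)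
  also have "(deriv ^^ k) (\<lambda>x. c i * x ^ e i) z = c i * (deriv ^^ k) (\<lambda>x. x ^ e i) z"
    by (rule higher_deriv_cmult[of _ UNIV]) (auto intro!: holomorphic_intros)
  finally show ?case using insert by simp
qed

text \<open>Carries the bounds of (e), which concern single monomials, over to the test
  polynomials.\<close>

lemma S_op_sum_monomials:
  assumes "finite I"
  shows "S_op n u \<tau> (\<lambda>x. \<Sum>i\<in>I. c i * x ^ e i) z = (\<Sum>i\<in>I. c i * S_op n u \<tau> (\<lambda>x. x ^ e i) z)"
proof -
  have "S_op n u \<tau> (\<lambda>x. \<Sum>i\<in>I. c i * x ^ e i) z
      = (\<Sum>k\<le>n. \<Sum>i\<in>I. u k z * (c i * (deriv ^^ k) (\<lambda>x. x ^ e i) (\<tau> z)))"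
    by (simp add: S_op_def higher_deriv_sum_monomials[OF assms] sum_distrib_left)
  also have "\<dots> = (\<Sum>i\<in>I. \<Sum>k\<le>n. u k z * (c i * (deriv ^^ k) (\<lambda>x. x ^ e i) (\<tau> z)))"
    by (rule sum.swap)
  finally show ?thesis by (simp add: S_op_def sum_distrib_left mult_ac)
qed

lemma cond_c_imp_cond_e:
  assumes \<tau>: "\<tau> ` disk \<subseteq> disk" and \<nu>: "\<And>z. z \<in> disk \<Longrightarrow> 0 \<le> \<nu> z" and \<gamma>: "0 \<le> gamma_of X"
    and c: "cond_c X n u \<tau> \<nu>" and P: "point_eval_bound X" and m: "monomial_bound X"
  shows "cond_e X n u \<tau> \<nu>"
proof -
  let ?g = "gamma_of X"
  obtain K where K: "K \<ge> 0" "\<And>f M. f holomorphic_on disk \<Longrightarrow> 0 \<le> M \<Longrightarrow> norm_of X f \<le> ennreal M \<Longrightarrow>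
      weighted_norm \<nu> (S_op n u \<tau> f) \<le> ennreal (K * M)"
    using S_op_norm_bound[OF \<tau> \<nu> \<gamma> c P] by metis
  obtain C where C: "C \<ge> 0" "\<And>m. norm_of X (\<lambda>z. z ^ m) \<le> ennreal (C / real (Suc m) powr ?g)"
    using m unfolding monomial_bound_def by metis
  have W: "weighted_norm \<nu> (S_op n u \<tau> (\<lambda>z. z ^ m)) \<le> ennreal (K * (C / real (Suc m) powr ?g))" for m
    using C by (intro K(2)) (auto intro!: holomorphic_intros)
  have "ennreal (real m powr ?g) * weighted_norm \<nu> (S_op n u \<tau> (\<lambda>z. z ^ m)) \<le> ennreal (K * C)" for m
  proof -
    have "ennreal (real m powr ?g) * weighted_norm \<nu> (S_op n u \<tau> (\<lambda>z. z ^ m))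
        \<le> ennreal (real m powr ?g) * ennreal (K * (C / real (Suc m) powr ?g))"
      by (intro mult_left_mono W) auto
    also have "\<dots> = ennreal (real m powr ?g * (K * (C / real (Suc m) powr ?g)))"
      by (rule ennreal_mult'[symmetric]) simp
    also have "\<dots> \<le> ennreal (K * C)"
    proof (rule ennreal_leI)
      have "real m powr ?g \<le> real (Suc m) powr ?g" using \<gamma> by (intro powr_mono2) auto
      then have "real m powr ?g / real (Suc m) powr ?g * (K * C) \<le> 1 * (K * C)"
        using K C by (intro mult_right_mono) (auto simp: divide_le_eq)
      then show "real m powr ?g * (K * (C / real (Suc m) powr ?g)) \<le> K * C" by simp
    qed
    finally show ?thesis .
  qed
  then have "(SUP m. ennreal (real m powr ?g) * weighted_norm \<nu> (S_op n u \<tau> (\<lambda>z. z ^ m))) \<le> ennreal (K * C)"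
    by (intro SUP_least)
  then have "(SUP m. ennreal (real m powr ?g) * weighted_norm \<nu> (S_op n u \<tau> (\<lambda>z. z ^ m))) < \<infinity>"
    by (rule order_le_less_trans) simp
  moreover have "weighted_norm \<nu> (S_op n u \<tau> (\<lambda>z. z ^ m)) < \<infinity>" for m
    by (rule order_le_less_trans[OF W]) simp
  ultimately show ?thesis by (simp add: cond_e_def)
qed

text \<open>Serves to keep \<open>|w|^N\<close> away from 0: with \<open>t = 1 - |w|\<close> it
  gives \<open>|w|^N \<ge> exp (- 2 t N)\<close>. The range \<open>t \<le> 1 / 2\<close> is the
  reason for a separate choice of test functions when \<open>|w| < 1 / 2\<close>.\<close>

lemma exp_minus_double_le:
  fixes t :: real
  assumes "0 \<le> t" "t \<le> 1 / 2"
  shows "exp (- (2 * t)) \<le> 1 - t"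
proof -
  have "- t - 2 * t\<^sup>2 \<le> ln (1 - t)" using assms by (intro ln_one_minus_pos_lower_bound) auto
  moreover have "t\<^sup>2 \<le> t / 2"
    using mult_left_mono[of t "1/2" t] assms by (simp add: power2_eq_square)
  ultimately have "- (2 * t) \<le> ln (1 - t)" by simp
  then have "exp (- (2 * t)) \<le> exp (ln (1 - t))" by simp
  also have "\<dots> = 1 - t" using assms by simp
  finally show ?thesis .
qed

text \<open>The factor \<open>N powr \<gamma>\<close> in the test polynomial has two roles: it gives
  the polynomial the height \<open>(1 - |w|)\<close> to the power \<open>-\<gamma>\<close>, and
  after binomial expansion it is absorbed by the weight \<open>m powr \<gamma>\<close> of the
  monomials.\<close>

lemma cond_e_imp_cond_c:
  assumes \<tau>: "\<tau> ` disk \<subseteq> disk" and \<nu>: "\<And>z. z \<in> disk \<Longrightarrow> 0 \<le> \<nu> z" and \<gamma>: "0 \<le> gamma_of X"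
    and e: "cond_e X n u \<tau> \<nu>"
  shows "cond_c X n u \<tau> \<nu>"
proof -
  have nu: "\<forall>z\<in>disk. 0 \<le> \<nu> z" using \<nu> by blast
  define g where "g = gamma_of X"
  have g0: "0 \<le> g" using \<gamma> by (simp add: g_def)
  \<comment> \<open>The first conjunct of \<open>cond_e\<close> makes these norms finite, also for
    \<open>m = 0\<close>, so passing to reals loses nothing.\<close>
  define W where "W = (\<lambda>m. enn2real (weighted_norm \<nu> (S_op n u \<tau> (\<lambda>z. z ^ m))))"
  have W0: "0 \<le> W m" for m by (simp add: W_def)
  have We: "ennreal (W m) = weighted_norm \<nu> (S_op n u \<tau> (\<lambda>z. z ^ m))" for m
    unfolding W_def using e by (intro ennreal_enn2real) (auto simp: cond_e_def)
  have Wz: "\<nu> z * norm (S_op n u \<tau> (\<lambda>z. z ^ m) z) \<le> W m" if "z \<in> disk" for m z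
    using We[of m] that weighted_norm_le_iff[OF W0, of \<nu> "S_op n u \<tau> (\<lambda>z. z ^ m)" m] by auto
  have "(SUP m. ennreal (real m powr g * W m)) < \<infinity>"
    using e by (simp add: cond_e_def ennreal_mult' We g_def)
  then obtain D where D: "\<And>m. real m powr g * W m \<le> D"
    using SUP_ennreal_finite_iff[of UNIV "\<lambda>m. real m powr g * W m"] W0 by auto
  have D0: "0 \<le> D" by (rule order_trans[OF _ D[of 0]]) (use W0 in auto)
  \<comment> \<open>\<open>D\<close> serves the exponents occurring for
    \<open>|w| \<ge> 1 / 2\<close>; the sum serves the unweighted monomials of degree at most
    \<open>n\<close> occurring near the origin.\<close>
  define E where "E = D + (\<Sum>m\<le>n. W m)"
  have E: "D \<le> E" "\<And>m. m \<le> n \<Longrightarrow> W m \<le> E"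
  proof -
    show "D \<le> E" unfolding E_def using W0 by (simp add: sum_nonneg)
    show "W m \<le> E" if "m \<le> n" for m
      using member_le_sum[of m "{..n}" W] W0 D0 that by (simp add: E_def)
  qed
  \<comment> \<open>Near the origin \<open>x\<^sup>N\<close> would vanish to the order \<open>N\<close> at \<open>w = 0\<close>, so \<open>(x - w)\<^sup>k\<close> is used there.\<close>
  define N where "N = (\<lambda>w::complex. if norm w < 1 / 2 then 1 else nat \<lceil>1 / (1 - norm w)\<rceil>)"
  \<comment> \<open>Away from the origin \<open>x ^ L w\<close> raises every exponent of the
    binomial expansion to at least \<open>N w\<close>. Without it the constant term would have
    \<open>m = 0\<close>, where the weight of (e) gives no decay.\<close>
  define L where "L = (\<lambda>w::complex. if norm w < 1 / 2 then 0 else N w)"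
  define h where "h = (\<lambda>k w x. (x ^ N w - w ^ N w) ^ k * (of_real (real (N w) powr g) * x ^ L w) :: complex)"
  \<comment> \<open>\<open>N w\<close> times the distance to the boundary lies between 1/2 and 2.
    The upper bound yields \<open>|w|^N \<ge> exp (- 4)\<close>; near the origin both exponents are
    0 and the powers equal 1, even at \<open>w = 0\<close>.\<close>
  have N: "1 \<le> real (N w) * (2 * (1 - norm w))" "real (N w) * (1 - norm w) \<le> 2" "1 \<le> N w"
    and Lw: "exp (- 4) \<le> norm w ^ (N w - 1)" "exp (- 4) \<le> norm w ^ L w"
    if w: "w \<in> disk" for w
  proof -
    define t where "t = 1 - norm w"
    have t: "0 < t" "t \<le> 1" using w by (auto simp: t_def)
    have "1 \<le> real (N w) * (2 * t) \<and> real (N w) * t \<le> 2 \<and> 1 \<le> N w \<and>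
        exp (- 4) \<le> norm w ^ (N w - 1) \<and> exp (- 4) \<le> norm w ^ L w"
    proof (cases "norm w < 1 / 2")
      case True
      then show ?thesis using t by (auto simp: N_def L_def t_def intro: order_trans[OF _ norm_ge_zero])
    next
      case False
      then have Nw: "N w = nat \<lceil>1 / t\<rceil>" and Leq: "L w = N w" by (auto simp: N_def L_def t_def)
      have c: "1 / t \<le> real (N w)" "real (N w) \<le> 1 / t + 1"
        unfolding Nw using t by (auto simp: of_nat_ceiling)
      have "1 / t \<ge> 1" using t by simp
      then have "1 \<le> N w" using c by linarith
      moreover have a: "1 \<le> real (N w) * t" using c(1) t by (simp add: field_simps)
      moreover have b: "real (N w) * t \<le> 2"
      proof -
        have "real (N w) * t \<le> (1 / t + 1) * t" using c(2) t by (intro mult_right_mono) auto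
        also have "\<dots> = 1 + t" using t by (simp add: distrib_right)
        finally show ?thesis using t by linarith
      qed
      moreover have ex: "exp (- 4) \<le> norm w ^ N w"
      proof -
        have "exp (- 4) \<le> exp (real (N w) * (- (2 * t)))" using b by (simp add: mult.commute)
        also have "\<dots> = exp (- (2 * t)) ^ N w" by (rule exp_of_nat_mult)
        also have "\<dots> \<le> (1 - t) ^ N w"
          using t False by (intro power_mono exp_minus_double_le) (auto simp: t_def)
        finally show ?thesis by (simp add: t_def)
      qed
      moreover have "norm w ^ N w \<le> norm w ^ (N w - 1)" using w by (intro power_decreasing) auto
      ultimately show ?thesis unfolding Leq by auto
    qed
    then show "1 \<le> real (N w) * (2 * (1 - norm w))" "real (N w) * (1 - norm w) \<le> 2" "1 \<le> N w"
      "exp (- 4) \<le> norm w ^ (N w - 1)" "exp (- 4) \<le> norm w ^ L w" by (auto simp: t_def)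
  qed
  have "\<exists>B. \<forall>z\<in>disk. \<nu> z * norm (u k z) / (1 - norm (\<tau> z)) powr (real k + g) \<le> B" if "k \<le> n" for k
  \<comment> \<open>In \<open>c\<close>, up to \<open>n\<close> factors \<open>|w|^(N - 1)\<close>
    and one factor \<open>|w|^L\<close> each contribute \<open>exp (- 4)\<close>. In
    \<open>C\<close>, the factor \<open>2 ^ n\<close> bounds \<open>|x^N - w^N|^k\<close> and
    \<open>2 powr g\<close> bounds \<open>(N t) powr g\<close>. In \<open>D\<close>,
    \<open>2 ^ n\<close> is the sum of the binomial coefficients.\<close>
  proof (rule pointwise_bounds_of_tests[OF \<tau> \<nu>, where h = h
        and c = "(1 / 2) powr (real n + g) * exp (- 4) ^ Suc n"
        and C = "2 ^ n * 2 powr g" and D = "2 ^ n * E" and n = n])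
    fix k w assume k: "k \<le> n" and w: "w \<in> disk"
    let ?N = "N w"
    define t where "t = 1 - norm w"
    have t: "0 < t" "t \<le> 1" using w by (auto simp: t_def)
    note N = N[OF w, folded t_def] and Lw = Lw[OF w]
    show "h k w holomorphic_on disk" unfolding h_def by (intro holomorphic_intros)
    have hd: "(\<forall>j<k. (deriv ^^ j) (h k w) w = 0) \<and>
         (deriv ^^ k) (h k w) w = fact k * deriv (\<lambda>x. x ^ ?N - w ^ ?N) w ^ k * (of_real (real ?N powr g) * w ^ L w)"
      unfolding h_def by (rule higher_deriv_power_mult_at_zero[OF open_UNIV UNIV_I]) (auto intro!: holomorphic_intros)
    then show "(deriv ^^ j) (h k w) w = 0" if "j < k" for j using that by blast
    have "((\<lambda>x. x ^ ?N - w ^ ?N) has_field_derivative of_nat ?N * w ^ (?N - 1)) (at w)"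
      by (auto intro!: derivative_eq_intros)
    then have dv: "deriv (\<lambda>x. x ^ ?N - w ^ ?N) w = of_nat ?N * w ^ (?N - 1)" by (rule DERIV_imp_deriv)
    have "norm ((deriv ^^ k) (h k w) w) * t ^ k * t powr g
       = fact k * (((real ?N * t) ^ k * (real ?N * t) powr g) * ((norm w ^ (?N - 1)) ^ k * norm w ^ L w))"
      using hd dv t by (simp add: norm_mult norm_power power_mult_distrib powr_mult mult_ac)
    also have "(real ?N * t) ^ k * (real ?N * t) powr g = (real ?N * t) powr (real k + g)"
      using t N by (simp add: powr_add powr_realpow)
    also have "fact k * ((real ?N * t) powr (real k + g) * ((norm w ^ (?N - 1)) ^ k * norm w ^ L w))
        \<ge> 1 * ((1 / 2) powr (real n + g) * (exp (- 4) ^ n * exp (- 4)))"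
    proof (intro mult_mono Lw)
      have "(1 / 2) powr (real n + g) \<le> (1 / 2) powr (real k + g)"
        using k by (intro powr_mono') auto
      also have "\<dots> \<le> (real ?N * t) powr (real k + g)"
        using N g0 by (intro powr_mono2) (auto simp: field_simps)
      finally show "(1 / 2) powr (real n + g) \<le> (real ?N * t) powr (real k + g)" .
      have "exp (- 4 :: real) ^ n \<le> exp (- 4) ^ k" using k by (intro power_decreasing) auto
      also have "\<dots> \<le> (norm w ^ (?N - 1)) ^ k" using Lw by (intro power_mono) auto
      finally show "exp (- 4) ^ n \<le> (norm w ^ (?N - 1)) ^ k" .
    qed (auto simp: fact_ge_1)
    finally show "(1 / 2) powr (real n + g) * exp (- 4) ^ Suc n
        \<le> norm ((deriv ^^ k) (h k w) w) * (1 - norm w) ^ k * (1 - norm w) powr g"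
      by (simp add: t_def mult_ac)
    fix x assume x: "x \<in> disk"
    have pw: "norm (y ^ m) \<le> 1" if "y \<in> disk" for y :: complex and m
      using that by (simp add: norm_power power_le_one)
    have "norm (x ^ ?N - w ^ ?N) \<le> 2"
      using norm_triangle_ineq4[of "x ^ ?N" "w ^ ?N"] pw[OF x, of ?N] pw[OF w, of ?N] by linarith
    then have "norm (x ^ ?N - w ^ ?N) ^ k \<le> 2 ^ k" by (intro power_mono) auto
    also have "\<dots> \<le> 2 ^ n" using k by (intro power_increasing) auto
    finally have a: "norm (x ^ ?N - w ^ ?N) ^ k \<le> 2 ^ n" .
    have b: "(real ?N * t) powr g \<le> 2 powr g" using N g0 t by (intro powr_mono2) auto
    have "norm (h k w x) * t powr g = norm (x ^ ?N - w ^ ?N) ^ k * ((real ?N * t) powr g * norm (x ^ L w))"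
      using t by (simp add: h_def norm_mult norm_power powr_mult mult_ac)
    also have "\<dots> \<le> 2 ^ n * (2 powr g * 1)"
      by (intro mult_mono a b pw x) auto
    finally show "norm (h k w x) * (1 - norm w) powr g \<le> 2 ^ n * 2 powr g" by (simp add: t_def)
  next
    fix k z assume k: "k \<le> n" and z: "z \<in> disk"
    define w where "w = \<tau> z"
    have w: "w \<in> disk" using \<tau> z w_def by blast
    define p where "p = real (N w) powr g"
    define c where "c = (\<lambda>i. of_nat (k choose i) * (- (w ^ N w)) ^ (k - i) * of_real p)"
    have hs: "h k w = (\<lambda>x. \<Sum>i\<le>k. c i * x ^ (N w * i + L w))"
    proof
      fix x
      have "h k w x = (x ^ N w + - (w ^ N w)) ^ k * (of_real p * x ^ L w)" by (simp add: h_def p_def)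
      also have "\<dots> = (\<Sum>i\<le>k. of_nat (k choose i) * (x ^ N w) ^ i * (- (w ^ N w)) ^ (k - i)) * (of_real p * x ^ L w)"
        by (simp only: binomial_ring)
      also have "\<dots> = (\<Sum>i\<le>k. c i * x ^ (N w * i + L w))"
        unfolding sum_distrib_right by (intro sum.cong) (auto simp: c_def power_add power_mult)
      finally show "h k w x = (\<Sum>i\<le>k. c i * x ^ (N w * i + L w))" .
    qed
    \<comment> \<open>Near the origin \<open>p = 1\<close> and the exponent is
      \<open>i \<le> n\<close>; elsewhere the exponent is \<open>N w * (i + 1)\<close>, hence at
      least \<open>N w\<close>.\<close>
    have each: "p * W (N w * i + L w) \<le> E" if "i \<le> n" for i
    proof (cases "norm w < 1 / 2")
      case True
      then have "N w = 1" "L w = 0" by (auto simp: N_def L_def)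
      then show ?thesis using E(2)[OF that] by (simp add: p_def)
    next
      case False
      then have L: "L w = N w" by (simp add: L_def)
      have "p \<le> real (N w * i + L w) powr g"
        unfolding p_def L using g0 by (intro powr_mono2) auto
      then have "p * W (N w * i + L w) \<le> real (N w * i + L w) powr g * W (N w * i + L w)"
        using W0 by (intro mult_right_mono) auto
      then show ?thesis using D[of "N w * i + L w"] E(1) by linarith
    qed
    have nc: "norm (c i) \<le> real (k choose i) * p" for i
    proof -
      have "norm (c i) = real (k choose i) * p * norm w ^ (N w * (k - i))"
        by (simp add: c_def norm_mult norm_power p_def power_mult)
      also have "\<dots> \<le> real (k choose i) * p * 1"
        using w by (intro mult_left_mono power_le_one) (auto simp: p_def)
      finally show ?thesis by simp
    qed
    have "\<nu> z * norm (S_op n u \<tau> (h k w) z)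
        \<le> \<nu> z * (\<Sum>i\<le>k. norm (c i * S_op n u \<tau> (\<lambda>x. x ^ (N w * i + L w)) z))"
      unfolding hs S_op_sum_monomials[OF finite_atMost]
      using \<nu>[OF z] by (intro mult_left_mono norm_sum)
    also have "\<dots> = (\<Sum>i\<le>k. norm (c i) * (\<nu> z * norm (S_op n u \<tau> (\<lambda>x. x ^ (N w * i + L w)) z)))"
      by (simp add: sum_distrib_left norm_mult mult_ac)
    also have "\<dots> \<le> (\<Sum>i\<le>k. real (k choose i) * E)"
    proof (rule sum_mono)
      fix i assume "i \<in> {..k}"
      then have "i \<le> n" using k by simp
      have "norm (c i) * (\<nu> z * norm (S_op n u \<tau> (\<lambda>x. x ^ (N w * i + L w)) z))
          \<le> (real (k choose i) * p) * W (N w * i + L w)"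
        by (intro mult_mono nc Wz z) (use \<nu>[OF z] in \<open>auto simp: p_def\<close>)
      also have "\<dots> \<le> real (k choose i) * E"
        using each[OF \<open>i \<le> n\<close>] by (simp add: mult.assoc mult_left_mono)
      finally show "norm (c i) * (\<nu> z * norm (S_op n u \<tau> (\<lambda>x. x ^ (N w * i + L w)) z))
        \<le> real (k choose i) * E" .
    qed
    also have "\<dots> = 2 ^ k * E"
      by (simp flip: sum_distrib_right of_nat_sum add: choose_row_sum)
    also have "\<dots> \<le> 2 ^ n * E"
      using k E(1) D0 by (intro mult_right_mono power_increasing) auto
    finally show "\<nu> z * norm (S_op n u \<tau> (h k (\<tau> z)) z) \<le> 2 ^ n * E" by (simp add: w_def)
  qed (use that in auto)
  then show ?thesis unfolding cond_c_iff[OF \<tau> nu \<gamma>] g_def by blast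
qed

section \<open>Point evaluations, test functions and monomials in \<open>H^\<infinity>\<close> and
  the growth spaces\<close>

lemma point_eval_bound_Hinfty: "point_eval_bound Hinfty"
  unfolding point_eval_bound_def
  by (intro exI[of _ 1]) (auto simp: sup_norm_def SUP_le_iff ennreal_le_iff)

lemma test_bound_Hinfty: "test_bound Hinfty"
  unfolding test_bound_def
proof (intro exI[of _ 1] conjI ballI allI)
  fix a :: complex and k assume a: "a \<in> disk"
  have "norm (test_fun 0 a z * sigma a z ^ k) \<le> 1" if z: "z \<in> disk" for z
    using norm_test_fun_mult_sigma_le[OF a z, of 0 k] norm_test_fun[OF a z, of 0]
    by (smt (verit) powr_zero_eq_one powr_0)
  then show "norm_of Hinfty (\<lambda>z. test_fun (gamma_of Hinfty) a z * sigma a z ^ k) \<le> ennreal 1"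
    by (simp add: sup_norm_def SUP_le_iff)
qed simp

lemma monomial_bound_Hinfty: "monomial_bound Hinfty"
  unfolding monomial_bound_def
  by (intro exI[of _ 1]) (auto simp: sup_norm_def SUP_le_iff norm_power power_le_one)

lemma point_eval_bound_Growth:
  assumes "\<alpha> > 0"
  shows "point_eval_bound (Growth \<alpha>)"
  unfolding point_eval_bound_def
proof (intro exI[of _ 1] conjI allI impI ballI)
  fix f M z assume M: "0 \<le> M" and le: "norm_of (Growth \<alpha>) f \<le> ennreal M" and z: "z \<in> disk"
  have b: "1 - norm z > 0" using z by simp
  have "(1 - norm z) powr \<alpha> \<le> (1 - (norm z)\<^sup>2) powr \<alpha>"
    using one_minus_norm_square_bounds[of z] b assms by (intro powr_mono2) auto
  then have "(1 - norm z) powr \<alpha> * norm (f z) \<le> (1 - (norm z)\<^sup>2) powr \<alpha> * norm (f z)"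
    by (intro mult_right_mono) auto
  also have "\<dots> \<le> M" using le z by (simp add: weighted_norm_le_iff[OF M])
  finally show "norm (f z) \<le> 1 * M / (1 - norm z) powr gamma_of (Growth \<alpha>)"
    using b by (simp add: field_simps)
qed simp

text \<open>Both \<open>1 - |z|\<close> and \<open>1 - |a|\<close> are at most
  \<open>|1 - cnj a * z|\<close>; passing to squares of the moduli costs a factor 2 each, whence
  \<open>4 powr \<alpha>\<close>.\<close>

lemma test_bound_Growth:
  assumes "\<alpha> > 0"
  shows "test_bound (Growth \<alpha>)"
  unfolding test_bound_def
proof (intro exI[of _ "4 powr \<alpha>"] conjI ballI allI)
  fix a :: complex and k assume a: "a \<in> disk"
  have "(1 - (norm z)\<^sup>2) powr \<alpha> * norm (test_fun \<alpha> a z * sigma a z ^ k) \<le> 4 powr \<alpha>" if z: "z \<in> disk" for z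
  proof -
    let ?d = "norm (1 - cnj a * z)"
    have d: "?d > 0" "1 - norm a \<le> ?d" using one_minus_cnj_mult_props[OF a z] by auto
    \<comment> \<open>The modulus is symmetric in \<open>a\<close> and \<open>z\<close>, as
      conjugation shows.\<close>
    have d2: "1 - norm z \<le> ?d" using one_minus_cnj_mult_props(2)[OF z a]
      by (metis complex_cnj_cnj complex_cnj_diff complex_cnj_mult complex_cnj_one complex_mod_cnj mult.commute)
    note ba = one_minus_norm_square_bounds[of a] and bz = one_minus_norm_square_bounds[of z]
    have "(1 - (norm z)\<^sup>2) * (1 - (norm a)\<^sup>2) \<le> (2 * ?d) * (2 * ?d)"
      using ba bz d d2 a z by (intro mult_mono) auto
    then have q: "(1 - (norm z)\<^sup>2) * ((1 - (norm a)\<^sup>2) / ?d\<^sup>2) \<le> 4"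
      using d by (simp add: field_simps power2_eq_square)
    have "(1 - (norm z)\<^sup>2) powr \<alpha> * norm (test_fun \<alpha> a z * sigma a z ^ k)
        \<le> (1 - (norm z)\<^sup>2) powr \<alpha> * ((1 - (norm a)\<^sup>2) / ?d\<^sup>2) powr \<alpha>"
      using norm_test_fun_mult_sigma_le[OF a z, of \<alpha> k] norm_test_fun[OF a z, of \<alpha>]
      by (intro mult_left_mono) auto
    also have "\<dots> = ((1 - (norm z)\<^sup>2) * ((1 - (norm a)\<^sup>2) / ?d\<^sup>2)) powr \<alpha>"
      using ba bz a z by (subst powr_mult) auto
    also have "\<dots> \<le> 4 powr \<alpha>" using q ba bz a z assms by (intro powr_mono2) auto
    finally show ?thesis .
  qed
  then show "norm_of (Growth \<alpha>) (\<lambda>z. test_fun (gamma_of (Growth \<alpha>)) a z * sigma a z ^ k) \<le> ennreal (4 powr \<alpha>)"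
    by (simp add: weighted_norm_le_iff)
qed simp

text \<open>With \<open>t = 1 - |z|\<close> and \<open>s = (m + 1) t\<close>, the claim reduces to
  boundedness of \<open>s powr \<alpha> * exp (- s)\<close>; its maximum at
  \<open>s = \<alpha>\<close> is reached through \<open>ln x \<le> x - 1\<close> at
  \<open>x = s / \<alpha>\<close>.\<close>

lemma monomial_bound_Growth:
  assumes "\<alpha> > 0"
  shows "monomial_bound (Growth \<alpha>)"
  unfolding monomial_bound_def
proof (intro exI[of _ "2 powr \<alpha> * (\<alpha> powr \<alpha> * exp 1)"] conjI allI)
  fix m
  have "(1 - (norm z)\<^sup>2) powr \<alpha> * norm (z ^ m) \<le> 2 powr \<alpha> * (\<alpha> powr \<alpha> * exp 1) / real (Suc m) powr \<alpha>"
    if z: "z \<in> disk" for z :: complex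
  proof -
    define t where "t = 1 - norm z"
    have t: "0 < t" "t \<le> 1" using z by (auto simp: t_def)
    define s where "s = real (Suc m) * t"
    have s: "0 < s" using t by (simp add: s_def)
    have "norm z \<le> exp (- t)" using exp_ge_add_one_self[of "- t"] by (simp add: t_def)
    then have "norm (z ^ m) \<le> exp (- t) ^ m" by (simp add: norm_power power_mono)
    \<comment> \<open>The shift from \<open>m\<close> to \<open>m + 1\<close> leaves
      \<open>exp t \<le> exp 1\<close>, the last factor of the constant.\<close>
    also have "\<dots> = exp (t - s)"
      by (simp add: s_def algebra_simps flip: exp_of_nat_mult)
    also have "\<dots> \<le> exp (1 - s)" using t by simp
    finally have zm: "norm (z ^ m) \<le> exp (1 - s)" .
    have "ln (s / \<alpha>) \<le> s / \<alpha> - 1" using s assms by (intro ln_le_minus_one) auto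
    then have "\<alpha> * ln (s / \<alpha>) \<le> s"
      using assms mult_left_mono[of "ln (s / \<alpha>)" "s / \<alpha> - 1" \<alpha>] by (simp add: algebra_simps)
    then have "(s / \<alpha>) powr \<alpha> \<le> exp s" using s assms by (simp add: powr_def)
    then have se: "s powr \<alpha> \<le> \<alpha> powr \<alpha> * exp s"
      using s assms by (simp add: powr_divide field_simps)
    have "real (Suc m) powr \<alpha> * ((1 - (norm z)\<^sup>2) powr \<alpha> * norm (z ^ m))
        \<le> real (Suc m) powr \<alpha> * ((2 * t) powr \<alpha> * exp (1 - s))"
      using one_minus_norm_square_bounds[of z] z assms
      by (intro mult_left_mono mult_mono zm powr_mono2) (auto simp: t_def)
    also have "\<dots> = 2 powr \<alpha> * s powr \<alpha> * exp (1 - s)"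
      using t by (simp add: s_def powr_mult mult_ac)
    also have "\<dots> \<le> 2 powr \<alpha> * (\<alpha> powr \<alpha> * exp s) * exp (1 - s)"
      using se by (intro mult_right_mono mult_left_mono) auto
    also have "\<dots> = 2 powr \<alpha> * (\<alpha> powr \<alpha> * exp 1)"
      by (simp add: mult.assoc flip: exp_add)
    finally show ?thesis by (simp add: field_simps)
  qed
  then show "norm_of (Growth \<alpha>) (\<lambda>z. z ^ m)
      \<le> ennreal (2 powr \<alpha> * (\<alpha> powr \<alpha> * exp 1) / real (Suc m) powr gamma_of (Growth \<alpha>))"
    by (simp add: weighted_norm_le_iff)
qed simp

subsection \<open>Hardy spaces\<close>

text \<open>
  With \<open>b = e / q\<close> and \<open>A = sup g z (R - |z - z0|)\<^sup>b\<close>, the hypothesis gives \<open>A \<le> K' A\<^sup>1\<^sup>-\<^sup>q\<close>. Boundedness of \<open>g\<close>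
  serves only to make \<open>A\<close> finite; it does not enter the constant.
\<close>

lemma absorption_bound:
  fixes g :: "complex \<Rightarrow> real" and q e K R :: real
  assumes q: "0 < q" "q \<le> 1" and e: "0 \<le> e" and K: "0 \<le> K"
    and g0: "\<And>z. z \<in> ball z0 R \<Longrightarrow> 0 \<le> g z"
    and bdd: "\<And>z. z \<in> ball z0 R \<Longrightarrow> g z \<le> B"
    and rec: "\<And>z M. z \<in> ball z0 R \<Longrightarrow> 0 < M \<Longrightarrow>
        (\<And>w. norm (w - z0) \<le> (R + norm (z - z0)) / 2 \<Longrightarrow> g w \<le> M) \<Longrightarrow>
        g z \<le> K / (R - norm (z - z0)) powr e * M powr (1 - q)"
    and z: "z \<in> ball z0 R"
  shows "g z powr q \<le> K * 2 powr (e / q * (1 - q)) / (R - norm (z - z0)) powr e"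
proof -
  define b where "b = e / q"
  have b: "0 \<le> b" "b * q = e" using e q by (auto simp: b_def)
  define d where "d = (\<lambda>z. R - norm (z - z0))"
  have d: "0 < d z" "d z \<le> R" if "z \<in> ball z0 R" for z
    using that by (auto simp: d_def dist_norm norm_minus_commute)
  define A where "A = (SUP z\<in>ball z0 R. g z * d z powr b)"
  have bddA: "bdd_above ((\<lambda>z. g z * d z powr b) ` ball z0 R)"
  proof (rule bdd_aboveI2)
    fix z assume z: "z \<in> ball z0 R"
    show "g z * d z powr b \<le> B * R powr b"
      using bdd[OF z] g0[OF z] d[OF z] b by (intro mult_mono powr_mono2) auto
  qed
  have Aup: "g z * d z powr b \<le> A" if "z \<in> ball z0 R" for z
    unfolding A_def by (rule cSUP_upper[OF that bddA])
  define K' where "K' = K * 2 powr (b * (1 - q))"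
  have A0: "0 \<le> A" using Aup[OF z] g0[OF z] by (smt (verit) mult_nonneg_nonneg powr_ge_zero)
  have Aq: "A powr q \<le> K'"
  proof (cases "A = 0")
    case True
    then show ?thesis using K q by (simp add: K'_def)
  next
    case False
    with A0 have Apos: "0 < A" by simp
    have "g z * d z powr b \<le> K' * A powr (1 - q)" if z: "z \<in> ball z0 R" for z
    proof -
      note dz = d[OF z]
      define M where "M = A / (d z / 2) powr b"
      have M: "0 < M" using Apos dz by (simp add: M_def)
      have "g w \<le> M" if w: "norm (w - z0) \<le> (R + norm (z - z0)) / 2" for w
      proof -
        have le: "d z / 2 \<le> d w" using w by (simp add: d_def field_simps)
        have "norm (w - z0) < R" using le dz by (simp add: d_def)
        then have wb: "w \<in> ball z0 R" by (simp add: dist_norm norm_minus_commute)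
        have "g w * (d z / 2) powr b \<le> g w * d w powr b"
          using le dz g0[OF wb] b by (intro mult_left_mono powr_mono2) auto
        also have "\<dots> \<le> A" by (rule Aup[OF wb])
        finally show ?thesis using dz by (simp add: M_def field_simps)
      qed
      then have "g z \<le> K / d z powr e * M powr (1 - q)"
        unfolding d_def using rec[OF z M] by simp
      then have "g z * d z powr b \<le> K / d z powr e * M powr (1 - q) * d z powr b"
        by (intro mult_right_mono) auto
      also have "M powr (1 - q) = A powr (1 - q) / (d z / 2) powr (b * (1 - q))"
        unfolding M_def using Apos dz by (subst powr_divide) (auto simp: powr_powr)
      \<comment> \<open>As \<open>b * q = e\<close>, the exponent of \<open>d z\<close> is
        \<open>b - e\<close>. Together with \<open>d z powr e\<close> and \<open>d z powr b\<close>
        it cancels completely, so the bound passes to the supremum.\<close>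
      also have "(d z / 2) powr (b * (1 - q)) = d z powr b / (d z powr e * 2 powr (b * (1 - q)))"
        using dz b by (simp add: powr_divide powr_diff right_diff_distrib)
      also have "K / d z powr e * (A powr (1 - q) / (d z powr b / (d z powr e * 2 powr (b * (1 - q))))) * d z powr b
          = K' * A powr (1 - q)"
        using dz by (simp add: K'_def)
      finally show ?thesis .
    qed
    then have "A \<le> K' * A powr (1 - q)"
      using z cSUP_least[of "ball z0 R" "\<lambda>z. g z * d z powr b" "K' * A powr (1 - q)", folded A_def] by blast
    then have "A powr q * A powr (1 - q) \<le> K' * A powr (1 - q)"
      using Apos by (simp flip: powr_add)
    then show ?thesis using Apos by simp
  qed
  have "(g z * d z powr b) powr q \<le> A powr q"
    using Aup[OF z] g0[OF z] q by (intro powr_mono2) auto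
  then have "g z powr q * d z powr e \<le> K'"
    using Aq g0[OF z] b by (simp add: powr_mult powr_powr)
  then have "g z powr q \<le> K' / d z powr e"
    using d[OF z] by (simp add: field_simps)
  then show ?thesis by (simp add: K'_def b_def d_def)
qed

text \<open>The link between the integrals in the norms and the gauge integrals in which Cauchy's
  formula is available.\<close>

lemma nn_integral_uniform_circle:
  fixes \<phi> :: "real \<Rightarrow> real"
  assumes c: "continuous_on UNIV \<phi>" and nn: "\<And>t. 0 \<le> \<phi> t"
  shows "(\<integral>\<^sup>+t. ennreal (\<phi> t) \<partial>uniform_measure lborel {0..2 * pi}) = ennreal (integral {0..2 * pi} \<phi> / (2 * pi))"
proof -
  have [measurable]: "\<phi> \<in> borel_measurable borel"
    using c by (rule borel_measurable_continuous_onI)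
  have int: "\<phi> integrable_on {0..2 * pi}"
    using c by (intro integrable_continuous_real continuous_on_subset[OF c]) auto
  have "(\<integral>\<^sup>+t. ennreal (\<phi> t) \<partial>uniform_measure lborel {0..2 * pi})
      = (\<integral>\<^sup>+t. ennreal (\<phi> t) * indicator {0..2 * pi} t \<partial>lborel) / emeasure lborel {0..2 * pi}"
    by (rule nn_integral_uniform_measure) auto
  also have "(\<integral>\<^sup>+t. ennreal (\<phi> t) * indicator {0..2 * pi} t \<partial>lborel) = ennreal (integral {0..2 * pi} \<phi>)"
    using nn int by (intro nn_integral_has_integral_lebesgue') (auto simp: has_integral_integral)
  also have "emeasure lborel {0..2 * pi} = ennreal (2 * pi)" by simp
  also have "ennreal (integral {0..2 * pi} \<phi>) / ennreal (2 * pi) = ennreal (integral {0..2 * pi} \<phi> / (2 * pi))"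
    using nn by (intro divide_ennreal) (auto intro: integral_nonneg[OF int])
  finally show ?thesis .
qed

lemma Cauchy_integral_cis:
  assumes hol: "f holomorphic_on ball z0 R" and \<rho>: "\<rho> < R" "0 < \<rho>" and z: "norm (z - z0) < \<rho>"
  shows "((\<lambda>t. f (z0 + of_real \<rho> * cis t) / (z0 + of_real \<rho> * cis t - z) * of_real \<rho> * \<i> * cis t)
     has_integral 2 * of_real pi * \<i> * f z) {0..2 * pi}"
proof -
  have "f holomorphic_on cball z0 \<rho>"
    using \<rho> by (intro holomorphic_on_subset[OF hol]) auto
  then have "((\<lambda>u. f u / (u - z)) has_contour_integral (2 * of_real pi * \<i> * f z)) (circlepath z0 \<rho>)"
    using z by (intro Cauchy_integral_circlepath_simple)
  then show ?thesis
    unfolding circlepath_def by (subst (asm) has_contour_integral_part_circlepath_iff) auto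
qed

lemma continuous_on_circle:
  assumes hol: "f holomorphic_on ball z0 R" and \<rho>: "0 < \<rho>" "\<rho> < R"
  shows "continuous_on UNIV (\<lambda>t. f (z0 + of_real \<rho> * cis t))"
proof (rule continuous_on_compose2[OF holomorphic_on_imp_continuous_on[OF hol]])
  show "continuous_on UNIV (\<lambda>t. z0 + complex_of_real \<rho> * cis t)"
    by (intro continuous_intros)
  show "range (\<lambda>t. z0 + complex_of_real \<rho> * cis t) \<subseteq> ball z0 R"
    using \<rho> by (auto simp: dist_norm norm_mult)
qed

lemma continuous_on_circle_norm_powr:
  assumes "f holomorphic_on ball z0 R" "0 < \<rho>" "\<rho> < R" "0 < p"
  shows "continuous_on UNIV (\<lambda>t. norm (f (z0 + of_real \<rho> * cis t)) powr p)"
  using assms by (intro continuous_on_powr' continuous_on_norm continuous_on_circle) auto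

text \<open>Bounds the Cauchy kernel by its maximum on the circle. The single power of
  \<open>\<rho> - |z - z0|\<close> is what leads to the Hardy exponent \<open>1 / p\<close>; at
  \<open>z = z0\<close> the factor is 1 and the mean value inequality results.\<close>

lemma norm_le_circle_mean:
  assumes hol: "f holomorphic_on ball z0 R" and \<rho>: "\<rho> < R" and z: "norm (z - z0) < \<rho>"
  shows "norm (f z) \<le> \<rho> / (\<rho> - norm (z - z0)) *
    (integral {0..2 * pi} (\<lambda>t. norm (f (z0 + of_real \<rho> * cis t))) / (2 * pi))"
proof -
  have \<rho>0: "0 < \<rho>" using z norm_ge_zero[of "z - z0"] by linarith
  define c where "c = \<rho> / (\<rho> - norm (z - z0))"
  let ?F = "\<lambda>t. f (z0 + of_real \<rho> * cis t) / (z0 + of_real \<rho> * cis t - z) * of_real \<rho> * \<i> * cis t"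
  note F = Cauchy_integral_cis[OF hol \<rho> \<rho>0 z]
  have int: "(\<lambda>t. norm (f (z0 + of_real \<rho> * cis t))) integrable_on {0..2 * pi}"
    using continuous_on_circle[OF hol \<rho>0 \<rho>]
    by (intro integrable_continuous_real continuous_on_norm) (auto intro: continuous_on_subset)
  have "norm (integral {0..2 * pi} ?F)
      \<le> integral {0..2 * pi} (\<lambda>t. c * norm (f (z0 + of_real \<rho> * cis t)))"
  proof (rule integral_norm_bound_integral)
    show "?F integrable_on {0..2 * pi}" using F by blast
    show "(\<lambda>t. c * norm (f (z0 + of_real \<rho> * cis t))) integrable_on {0..2 * pi}"
      by (intro integrable_on_mult_right int)
    fix t
    have "\<rho> - norm (z - z0) \<le> norm (z0 + of_real \<rho> * cis t - z)"
      using norm_triangle_ineq2[of "of_real \<rho> * cis t" "z - z0"] \<rho>0 by (simp add: norm_mult algebra_simps)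
    then have "norm (f (z0 + of_real \<rho> * cis t)) * \<rho> / norm (z0 + of_real \<rho> * cis t - z)
        \<le> norm (f (z0 + of_real \<rho> * cis t)) * \<rho> / (\<rho> - norm (z - z0))"
      using z \<rho>0 by (intro divide_left_mono mult_pos_pos mult_nonneg_nonneg) auto
    then show "norm (?F t) \<le> c * norm (f (z0 + of_real \<rho> * cis t))"
      using \<rho>0 by (simp add: norm_mult norm_divide c_def mult_ac)
  qed
  also have "integral {0..2 * pi} ?F = 2 * of_real pi * \<i> * f z" using F by (rule integral_unique)
  also have "norm (2 * of_real pi * \<i> * f z) = 2 * pi * norm (f z)" by (simp add: norm_mult)
  finally have "norm (f z) \<le> c * (integral {0..2 * pi} (\<lambda>t. norm (f (z0 + of_real \<rho> * cis t))) / (2 * pi))"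
    by (simp add: pos_le_divide_eq mult_ac)
  then show ?thesis by (simp only: c_def)
qed

text \<open>Removes the root from the norms, so that only integrals of \<open>|f|\<close> to the
  power \<open>p\<close> remain to be estimated.\<close>

lemma ennreal_root_le_iff:
  assumes p: "0 < p" and M: "0 \<le> M"
  shows "ennreal_root p x \<le> ennreal M \<longleftrightarrow> x \<le> ennreal (M powr p)"
proof (cases "x = \<infinity>")
  case True
  then show ?thesis by (simp add: ennreal_root_def top_unique)
next
  case False
  then obtain y where y: "x = ennreal y" "0 \<le> y" by (cases x) auto
  have "y powr (1 / p) \<le> M \<longleftrightarrow> y \<le> M powr p"
  proof
    assume "y powr (1 / p) \<le> M"
    then have "(y powr (1 / p)) powr p \<le> M powr p" using p by (intro powr_mono2) auto
    then show "y \<le> M powr p" using y p by (simp add: powr_powr)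
  next
    assume "y \<le> M powr p"
    then have "y powr (1 / p) \<le> (M powr p) powr (1 / p)" using p y by (intro powr_mono2) auto
    then show "y powr (1 / p) \<le> M" using M p by (simp add: powr_powr)
  qed
  then show ?thesis using y M by (simp add: ennreal_root_def)
qed

text \<open>\<open>absorption_bound\<close> needs a bounded function, so it is applied on balls of
  radius \<open>s < 1\<close>. Its constant is independent of the bound on \<open>f\<close>, which
  allows \<open>s\<close> to tend to 1.\<close>

lemma norm_powr_le_of_circle_means:
  assumes q: "0 < q" "q \<le> 1" and hol: "f holomorphic_on disk" and N: "0 \<le> N"
    and mean: "\<And>r. 0 < r \<Longrightarrow> r < 1 \<Longrightarrow>
      integral {0..2 * pi} (\<lambda>t. norm (f (of_real r * cis t)) powr q) / (2 * pi) \<le> N"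
    and z: "z \<in> disk"
  shows "norm (f z) powr q \<le> 2 * N * 2 powr (1 / q * (1 - q)) / (1 - norm z)"
proof -
  have s: "norm (f z) powr q \<le> 2 * N * 2 powr (1 / q * (1 - q)) / (s - norm z)"
    if s: "norm z < s" "s < 1" for s
  proof -
    have s0: "0 < s" using s norm_ge_zero[of z] by linarith
    have "compact (f ` cball 0 s)"
      using s by (intro compact_continuous_image holomorphic_on_imp_continuous_on
        holomorphic_on_subset[OF hol]) auto
    then obtain B where B: "\<And>x. norm x \<le> s \<Longrightarrow> norm (f x) \<le> B"
      using compact_imp_bounded bounded_iff by (metis (no_types, lifting) image_eqI mem_cball_0)
    have "norm (f z) powr q \<le> 2 * N * 2 powr (1 / q * (1 - q)) / (s - norm (z - 0)) powr 1"
    proof (rule absorption_bound[where g = "\<lambda>z. norm (f z)" and B = B and R = s and e = 1 and ?z0.0 = 0])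
      fix y :: complex and M :: real assume y: "y \<in> ball 0 s" and M: "0 < M"
        and fM: "\<And>w. norm (w - 0) \<le> (s + norm (y - 0)) / 2 \<Longrightarrow> norm (f w) \<le> M"
      \<comment> \<open>The midpoint is the largest radius at which \<open>fM\<close> still bounds
        \<open>f\<close>; its distance to \<open>norm y\<close> is half of
        \<open>s - norm y\<close>, whence the factor 2.\<close>
      define r where "r = (s + norm y) / 2"
      have r: "0 < r" "r < 1" "norm y < r" "r - norm y = (s - norm y) / 2"
        using y s s0 add_pos_nonneg[OF s0 norm_ge_zero[of y]] by (auto simp: r_def field_simps)
      let ?F = "\<lambda>t. f (of_real r * cis t)"
      have cont: "continuous_on UNIV ?F"
        using continuous_on_circle[OF hol r(1,2)] by simp
      have contq: "continuous_on UNIV (\<lambda>t. norm (?F t) powr q)"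
        using continuous_on_circle_norm_powr[OF hol r(1,2) q(1)] by simp
      have "integral {0..2 * pi} (\<lambda>t. norm (?F t)) \<le> integral {0..2 * pi} (\<lambda>t. M powr (1 - q) * norm (?F t) powr q)"
      proof (rule integral_le)
        show "(\<lambda>t. norm (?F t)) integrable_on {0..2 * pi}"
          using cont by (intro integrable_continuous_real continuous_on_norm) (auto intro: continuous_on_subset)
        show "(\<lambda>t. M powr (1 - q) * norm (?F t) powr q) integrable_on {0..2 * pi}"
          using contq by (intro integrable_continuous_real continuous_on_mult continuous_on_const)
            (auto intro: continuous_on_subset)
        fix t
        have "norm (of_real r * cis t - 0) = r" using r(1) by (simp add: norm_mult)
        then have "norm (?F t) \<le> M" by (intro fM) (simp add: r_def)
        then have "norm (?F t) powr (1 - q) \<le> M powr (1 - q)" using q by (intro powr_mono2) auto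
        then have "norm (?F t) powr (1 - q) * norm (?F t) powr q \<le> M powr (1 - q) * norm (?F t) powr q"
          by (intro mult_right_mono) auto
        then show "norm (?F t) \<le> M powr (1 - q) * norm (?F t) powr q"
          by (simp flip: powr_add)
      qed
      also have "\<dots> = M powr (1 - q) * integral {0..2 * pi} (\<lambda>t. norm (?F t) powr q)" by simp
      also have "\<dots> \<le> M powr (1 - q) * (N * (2 * pi))"
        using mean[OF r(1,2)] by (intro mult_left_mono) (auto simp: field_simps)
      finally have I: "integral {0..2 * pi} (\<lambda>t. norm (?F t)) / (2 * pi) \<le> M powr (1 - q) * N"
        by (simp add: field_simps)
      have I0: "0 \<le> integral {0..2 * pi} (\<lambda>t. norm (?F t)) / (2 * pi)"
        using cont by (intro divide_nonneg_nonneg integral_nonneg integrable_continuous_real continuous_on_norm)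
          (auto intro: continuous_on_subset)
      have "norm (f y) \<le> r / (r - norm y) * (integral {0..2 * pi} (\<lambda>t. norm (?F t)) / (2 * pi))"
        using norm_le_circle_mean[OF hol r(2), of y] r(3) by simp
      also have "\<dots> \<le> 1 / (r - norm y) * (M powr (1 - q) * N)"
        using r I I0 N by (intro mult_mono divide_right_mono) auto
      also have "\<dots> = 2 * N / (s - norm (y - 0)) powr 1 * M powr (1 - q)"
        unfolding r(4) using r(3,4) by simp
      finally show "norm (f y) \<le> 2 * N / (s - norm (y - 0)) powr 1 * M powr (1 - q)" .
    qed (use q N s B in auto)
    then show ?thesis using s by simp
  qed
  have "((\<lambda>s. 2 * N * 2 powr (1 / q * (1 - q)) / (s - norm z)) \<longlongrightarrow> 2 * N * 2 powr (1 / q * (1 - q)) / (1 - norm z)) (at_left 1)"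
    using z by (intro tendsto_intros) auto
  moreover have "\<forall>\<^sub>F s in at_left 1. norm (f z) powr q \<le> 2 * N * 2 powr (1 / q * (1 - q)) / (s - norm z)"
    using s z by (auto simp: eventually_at_left intro!: exI[of _ "norm z"])
  ultimately show ?thesis by (intro tendsto_lowerbound) auto
qed

section \<open>Point evaluations and test functions in Hardy spaces\<close>

lemma norm_power_powr:
  assumes "m \<ge> 1"
  shows "norm (x ^ m :: complex) powr (p / real m) = norm x powr p"
proof (cases "x = 0")
  case False
  then show ?thesis using assms by (simp add: norm_power powr_powr flip: powr_realpow)
qed (use assms in simp)

lemma exponent_reduction:
  assumes "0 < (p::real)"
  obtains m :: nat where "m \<ge> 1" "0 < p / real m" "p / real m \<le> 1"
proof
  have "p \<le> real (nat \<lceil>p\<rceil>)" by linarith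
  moreover have "nat \<lceil>p\<rceil> \<ge> 1" using assms by linarith
  ultimately show "nat \<lceil>p\<rceil> \<ge> 1" "0 < p / real (nat \<lceil>p\<rceil>)" "p / real (nat \<lceil>p\<rceil>) \<le> 1"
    using assms by (auto simp: field_simps)
qed

lemma powr_le_imp_le_root:
  fixes x :: real
  assumes "0 \<le> x" "x powr p \<le> c * M powr p / d powr s" "0 < p" "0 \<le> c" "0 \<le> M" "0 < d"
  shows "x \<le> c powr (1 / p) * M / d powr (s / p)"
proof -
  have "x = (x powr p) powr (1 / p)" using assms by (simp add: powr_powr)
  also have "\<dots> \<le> (c * M powr p / d powr s) powr (1 / p)" using assms by (intro powr_mono2) auto
  also have "\<dots> = c powr (1 / p) * M / d powr (s / p)"
    using assms by (simp add: powr_mult powr_divide powr_powr)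
  finally show ?thesis .
qed

lemma point_eval_bound_Hardy:
  assumes p: "0 < p"
  shows "point_eval_bound (Hardy p)"
proof -
  obtain m where m: "m \<ge> 1" "0 < p / real m" "p / real m \<le> 1" using exponent_reduction[OF p] .
  define q where "q = p / real m"
  define c where "c = 2 * 2 powr (1 / q * (1 - q))"
  show ?thesis unfolding point_eval_bound_def
  proof (intro exI[of _ "c powr (1 / p)"] conjI allI impI ballI)
    fix f M z assume hol: "f holomorphic_on disk" and M: "0 \<le> M"
      and le: "norm_of (Hardy p) f \<le> ennreal M" and z: "z \<in> disk"
    have "norm (f z ^ m) powr q \<le> 2 * (M powr p) * 2 powr (1 / q * (1 - q)) / (1 - norm z)"
    proof (rule norm_powr_le_of_circle_means)
      fix r :: real assume r: "0 < r" "r < 1"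
      have cont: "continuous_on UNIV (\<lambda>t. norm (f (of_real r * cis t)) powr p)"
        using continuous_on_circle_norm_powr[OF hol r p] by simp
      have "ennreal (integral {0..2 * pi} (\<lambda>t. norm (f (of_real r * cis t)) powr p) / (2 * pi))
         = (\<integral>\<^sup>+t. ennreal (norm (f (of_real r * cis t)) powr p) \<partial>uniform_measure lborel {0..2 * pi})"
        by (rule nn_integral_uniform_circle[OF cont, symmetric]) simp
      also have "\<dots> \<le> (SUP r\<in>{0<..<1}. \<integral>\<^sup>+t. ennreal (norm (f (of_real r * cis t)) powr p)
                          \<partial>uniform_measure lborel {0..2 * pi})"
        using r by (intro SUP_upper) auto
      also have "\<dots> \<le> ennreal (M powr p)"
        using le by (simp add: hardy_norm_def ennreal_root_le_iff[OF p M])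
      finally have "integral {0..2 * pi} (\<lambda>t. norm (f (of_real r * cis t)) powr p) / (2 * pi) \<le> M powr p"
        by (simp add: ennreal_le_iff)
      then show "integral {0..2 * pi} (\<lambda>t. norm (f (of_real r * cis t) ^ m) powr q) / (2 * pi) \<le> M powr p"
        by (simp only: q_def norm_power_powr[OF m(1)])
    qed (use m z in \<open>auto simp: q_def intro!: holomorphic_intros hol\<close>)
    then have "norm (f z) powr p \<le> c * M powr p / (1 - norm z) powr 1"
      using z unfolding q_def norm_power_powr[OF m(1)] by (simp add: c_def q_def mult_ac)
    then have "norm (f z) \<le> c powr (1 / p) * M / (1 - norm z) powr (1 / p)"
      using p M z by (intro powr_le_imp_le_root) (auto simp: c_def)
    then show "norm (f z) \<le> c powr (1 / p) * M / (1 - norm z) powr gamma_of (Hardy p)" by simp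
  qed simp
qed

text \<open>The Poisson kernel identity. On the unit circle
  \<open>x - cnj b = x * cnj (1 - b * x)\<close>, so Cauchy's formula for
  \<open>1 / (1 - b * x)\<close> at the point \<open>cnj b\<close> has integrand
  \<open>\<i> / |1 - b * x|^2\<close>.\<close>

lemma integral_circle_inverse_square:
  fixes b :: complex
  assumes b: "norm b < 1"
  shows "((\<lambda>t. 1 / (norm (1 - b * cis t))\<^sup>2) has_integral 2 * pi / (1 - (norm b)\<^sup>2)) {0..2 * pi}"
proof -
  \<comment> \<open>The pole is at \<open>1 / b\<close>, outside the closed unit disk; for
    \<open>b = 0\<close> any radius above 1 will do.\<close>
  define R where "R = (if b = 0 then 2 else 1 / norm b)"
  have R: "R > 1" using b by (auto simp: R_def)
  have nz: "1 - b * x \<noteq> 0" if "x \<in> ball 0 R" for x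
  proof
    assume "1 - b * x = 0"
    then have "b * x = 1" by simp
    then have "norm b * norm x = 1" "b \<noteq> 0" by (auto simp flip: norm_mult)
    then show False using that by (simp add: R_def field_simps)
  qed
  have "(\<lambda>x. 1 / (1 - b * x)) holomorphic_on ball 0 R"
    using nz by (intro holomorphic_intros) auto
  then have "((\<lambda>t. 1 / (1 - b * (0 + of_real 1 * cis t)) / (0 + of_real 1 * cis t - cnj b) * of_real 1 * \<i> * cis t)
     has_integral 2 * of_real pi * \<i> * (1 / (1 - b * cnj b))) {0..2 * pi}"
    by (rule Cauchy_integral_cis) (use R b in auto)
  from has_integral_linear[OF this bounded_linear_Im]
  have "((\<lambda>t. Im (1 / (1 - b * cis t) / (cis t - cnj b) * \<i> * cis t))
     has_integral Im (2 * of_real pi * \<i> * (1 / (1 - b * cnj b)))) {0..2 * pi}"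
    by (simp add: o_def)
  also have "1 - b * cnj b = of_real (1 - (norm b)\<^sup>2)"
    by (simp add: complex_norm_square del: of_real_power)
  also have "Im (2 * of_real pi * \<i> * (1 / of_real (1 - (norm b)\<^sup>2))) = 2 * pi / (1 - (norm b)\<^sup>2)"
    by (simp add: Im_divide_of_real del: of_real_diff)
  also have "(\<lambda>t. Im (1 / (1 - b * cis t) / (cis t - cnj b) * \<i> * cis t)) = (\<lambda>t. 1 / (norm (1 - b * cis t))\<^sup>2)"
  proof
    fix t
    have "cis t - cnj b = cis t * cnj (1 - b * cis t)"
      by (simp add: right_diff_distrib flip: cis_cnj) (simp add: cis_cnj cis_mult)
    then have "1 / (1 - b * cis t) / (cis t - cnj b) * \<i> * cis t
       = \<i> / ((1 - b * cis t) * cnj (1 - b * cis t))"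
      by simp
    also have "(1 - b * cis t) * cnj (1 - b * cis t) = of_real ((norm (1 - b * cis t))\<^sup>2)"
      by (simp only: complex_norm_square)
    finally show "Im (1 / (1 - b * cis t) / (cis t - cnj b) * \<i> * cis t) = 1 / (norm (1 - b * cis t))\<^sup>2"
      by (simp add: Im_divide_of_real del: of_real_power)
  qed
  finally show ?thesis .
qed

text \<open>With \<open>\<gamma> = 1 / p\<close> the \<open>p\<close>-th power of
  \<open>|f_a|\<close> is \<open>(1 - |a|^2) / |1 - cnj a * z|^2\<close>. On the circle of radius
  \<open>r\<close> its mean is \<open>(1 - |a|^2) / (1 - |b|^2)\<close> with
  \<open>|b| = r |a|\<close>, hence at most 1.\<close>

lemma test_bound_Hardy:
  assumes p: "0 < p"
  shows "test_bound (Hardy p)"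
  unfolding test_bound_def
proof (intro exI[of _ 1] conjI ballI allI)
  fix a :: complex and k assume a: "a \<in> disk"
  define h where "h = (\<lambda>z. test_fun (1 / p) a z * sigma a z ^ k)"
  have "(\<integral>\<^sup>+t. ennreal (norm (h (of_real r * cis t)) powr p) \<partial>uniform_measure lborel {0..2 * pi}) \<le> 1"
    if r: "0 < r" "r < 1" for r
  proof -
    define b where "b = cnj a * of_real r"
    define \<phi> where "\<phi> = (\<lambda>t. (1 - (norm a)\<^sup>2) * (1 / (norm (1 - b * cis t))\<^sup>2))"
    have b: "norm b < 1" "(norm b)\<^sup>2 \<le> (norm a)\<^sup>2"
    proof -
      have "norm b \<le> norm a" using r by (simp add: b_def norm_mult mult_left_le)
      then show "norm b < 1" "(norm b)\<^sup>2 \<le> (norm a)\<^sup>2" using a by (auto intro: power_mono)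
    qed
    note sa = one_minus_norm_square_bounds[of a] and sb = one_minus_norm_square_bounds[OF b(1)]
    have circ: "of_real r * cis t \<in> disk" for t using r by (simp add: norm_mult)
    have hle: "norm (h (of_real r * cis t)) powr p \<le> \<phi> t" for t
    proof -
      have "norm (h (of_real r * cis t)) powr p \<le> norm (test_fun (1 / p) a (of_real r * cis t)) powr p"
        unfolding h_def using p norm_test_fun_mult_sigma_le[OF a circ] by (intro powr_mono2) auto
      also have "\<dots> = \<phi> t"
        unfolding norm_test_fun[OF a circ] \<phi>_def b_def using sa a p by (simp add: powr_powr mult.assoc)
      finally show ?thesis .
    qed
    have nz: "1 - b * cis t \<noteq> 0" for t
      using one_minus_cnj_mult_props(3)[OF a circ, of t] by (simp add: b_def mult.assoc)
    have \<phi>0: "0 \<le> \<phi> t" for t using sa a by (simp add: \<phi>_def)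
    have cont: "continuous_on UNIV \<phi>" unfolding \<phi>_def using nz by (intro continuous_intros) auto
    have "(\<integral>\<^sup>+t. ennreal (norm (h (of_real r * cis t)) powr p) \<partial>uniform_measure lborel {0..2 * pi})
       \<le> (\<integral>\<^sup>+t. ennreal (\<phi> t) \<partial>uniform_measure lborel {0..2 * pi})"
      by (intro nn_integral_mono ennreal_leI hle)
    also have "\<dots> = ennreal (integral {0..2 * pi} \<phi> / (2 * pi))"
      by (rule nn_integral_uniform_circle[OF cont \<phi>0])
    also have "integral {0..2 * pi} \<phi> = (1 - (norm a)\<^sup>2) * (2 * pi / (1 - (norm b)\<^sup>2))"
      unfolding \<phi>_def by (intro integral_unique has_integral_mult_right integral_circle_inverse_square b)
    also have "ennreal ((1 - (norm a)\<^sup>2) * (2 * pi / (1 - (norm b)\<^sup>2)) / (2 * pi)) \<le> ennreal 1"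
      using b sb by (intro ennreal_leI) (simp add: field_simps)
    finally show ?thesis by simp
  qed
  then have "hardy_norm p h \<le> ennreal 1"
    unfolding hardy_norm_def by (subst ennreal_root_le_iff[OF p]) (auto simp: SUP_le_iff)
  then show "norm_of (Hardy p) (\<lambda>z. test_fun (gamma_of (Hardy p)) a z * sigma a z ^ k) \<le> ennreal 1"
    by (simp add: h_def)
qed simp

subsection \<open>Rotation invariance of planar Lebesgue measure\<close>

lemma measurable_Complex_pair: "(\<lambda>(x, y). Complex x y) \<in> borel_measurable (lborel \<Otimes>\<^sub>M lborel)"
proof -
  have "(\<lambda>p. Complex (fst p) (snd p)) \<in> borel_measurable borel"
    by (intro borel_measurable_continuous_onI continuous_intros)
  then show ?thesis by (simp add: lborel_prod case_prod_beta)
qed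

text \<open>Lebesgue measure is determined by the volumes of boxes; the identification opens the way
  to Fubini in real and imaginary part.\<close>

lemma lborel_complex_eq_distr:
  "(lborel :: complex measure) = distr (lborel \<Otimes>\<^sub>M lborel) borel (\<lambda>(x, y). Complex x y)"
proof (rule lborel_eqI)
  note measurable_Complex_pair[measurable]
  fix l u :: complex
  assume le: "\<And>b. b \<in> Basis \<Longrightarrow> l \<bullet> b \<le> u \<bullet> b"
  have le': "Re l \<le> Re u" "Im l \<le> Im u"
    using le[of 1] le[of \<i>] by (auto simp: Basis_complex_def inner_complex_def)
  have "emeasure (distr (lborel \<Otimes>\<^sub>M lborel) borel (\<lambda>(x, y). Complex x y)) (box l u)
     = emeasure (lborel \<Otimes>\<^sub>M lborel) ((\<lambda>(x, y). Complex x y) -` box l u \<inter> space (lborel \<Otimes>\<^sub>M lborel))"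
    by (rule emeasure_distr) auto
  also have "(\<lambda>(x, y). Complex x y) -` box l u \<inter> space (lborel \<Otimes>\<^sub>M lborel)
     = {Re l<..<Re u} \<times> {Im l<..<Im u}"
    by (auto simp: in_box_complex_iff space_pair_measure)
  also have "emeasure (lborel \<Otimes>\<^sub>M lborel) \<dots> = ennreal (Re u - Re l) * ennreal (Im u - Im l)"
    using le' by (subst lborel.emeasure_pair_measure_Times) auto
  also have "\<dots> = ennreal (\<Prod>b\<in>Basis. (u - l) \<bullet> b)"
    using le' by (simp add: Basis_complex_def inner_complex_def ennreal_mult)
  finally show "emeasure (distr (lborel \<Otimes>\<^sub>M lborel) borel (\<lambda>(x, y). Complex x y)) (box l u)
     = ennreal (\<Prod>b\<in>Basis. (u - l) \<bullet> b)" .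
qed simp

lemma nn_integral_lborel_complex:
  assumes [measurable]: "F \<in> borel_measurable borel"
  shows "(\<integral>\<^sup>+z. F z \<partial>lborel) = (\<integral>\<^sup>+x. \<integral>\<^sup>+y. F (Complex x y) \<partial>lborel \<partial>lborel)" (is ?A)
    and "(\<integral>\<^sup>+z. F z \<partial>lborel) = (\<integral>\<^sup>+y. \<integral>\<^sup>+x. F (Complex x y) \<partial>lborel \<partial>lborel)" (is ?B)
proof -
  note measurable_Complex_pair[measurable]
  let ?G = "\<lambda>p. F (case p of (x, y) \<Rightarrow> Complex x y)"
  have m: "?G \<in> borel_measurable (lborel \<Otimes>\<^sub>M lborel)" by measurable
  have "(\<integral>\<^sup>+z. F z \<partial>lborel) = (\<integral>\<^sup>+p. ?G p \<partial>(lborel \<Otimes>\<^sub>M lborel))"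
    by (subst lborel_complex_eq_distr, subst nn_integral_distr) auto
  then show ?A ?B
    using lborel_pair.nn_integral_snd[OF m] lborel.nn_integral_fst[OF m] by simp_all
qed

text \<open>A shear translates each horizontal or vertical line by a constant. With the moving
  coordinate as inner variable, translation invariance on the real line suffices; the two directions
  need the two orders of integration.\<close>

lemma nn_integral_shear:
  assumes [measurable]: "F \<in> borel_measurable borel"
  shows "(\<integral>\<^sup>+z. F (z + of_real (s * Im z)) \<partial>lborel) = (\<integral>\<^sup>+z. F z \<partial>lborel)" (is ?A)
    and "(\<integral>\<^sup>+z. F (z + \<i> * of_real (s * Re z)) \<partial>lborel) = (\<integral>\<^sup>+z. F z \<partial>lborel)" (is ?B)
proof -
  have meas: "(\<lambda>z. F (z + of_real (s * Im z))) \<in> borel_measurable borel"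
    "(\<lambda>z. F (z + \<i> * of_real (s * Re z))) \<in> borel_measurable borel"
    by (auto intro!: measurable_compose[OF _ assms] borel_measurable_continuous_onI continuous_intros)
  have mx: "(\<lambda>x. F (Complex x y)) \<in> borel_measurable borel" "(\<lambda>x. F (Complex y x)) \<in> borel_measurable borel" for y
    by (rule measurable_compose[OF _ assms], rule borel_measurable_continuous_onI, intro continuous_intros)+
  have tr: "(\<integral>\<^sup>+x. F (Complex (s * y + 1 * x) y) \<partial>lborel) = (\<integral>\<^sup>+x. F (Complex x y) \<partial>lborel)"
    "(\<integral>\<^sup>+x. F (Complex y (s * y + 1 * x)) \<partial>lborel) = (\<integral>\<^sup>+x. F (Complex y x) \<partial>lborel)" for y
    using nn_integral_real_affine[OF mx(1)[of y], of 1 "s * y"]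
      nn_integral_real_affine[OF mx(2)[of y], of 1 "s * y"] by simp_all
  have "(\<integral>\<^sup>+z. F (z + of_real (s * Im z)) \<partial>lborel)
      = (\<integral>\<^sup>+y. \<integral>\<^sup>+x. F (Complex (s * y + 1 * x) y) \<partial>lborel \<partial>lborel)"
    by (subst nn_integral_lborel_complex(2)[OF meas(1)])
      (intro nn_integral_cong arg_cong[where f = F], simp add: complex_eq_iff)
  also have "\<dots> = (\<integral>\<^sup>+y. \<integral>\<^sup>+x. F (Complex x y) \<partial>lborel \<partial>lborel)"
    by (simp only: tr)
  finally show ?A by (simp add: nn_integral_lborel_complex(2)[OF assms])
  have "(\<integral>\<^sup>+z. F (z + \<i> * of_real (s * Re z)) \<partial>lborel)
      = (\<integral>\<^sup>+x. \<integral>\<^sup>+y. F (Complex x (s * x + 1 * y)) \<partial>lborel \<partial>lborel)"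
    by (subst nn_integral_lborel_complex(1)[OF meas(2)])
      (intro nn_integral_cong arg_cong[where f = F], simp add: complex_eq_iff)
  also have "\<dots> = (\<integral>\<^sup>+x. \<integral>\<^sup>+y. F (Complex x y) \<partial>lborel \<partial>lborel)"
    by (simp only: tr)
  finally show ?B by (simp add: nn_integral_lborel_complex(1)[OF assms])
qed

lemma nn_integral_rotate:
  assumes F[measurable]: "F \<in> borel_measurable borel" and u: "norm (u :: complex) = 1"
  shows "(\<integral>\<^sup>+z. F (u * z) \<partial>lborel) = (\<integral>\<^sup>+z. F z \<partial>lborel)"
proof -
  have main: "(\<integral>\<^sup>+z. G (v * z) \<partial>lborel) = (\<integral>\<^sup>+z. G z \<partial>lborel)"
    if v: "norm v = 1" "Im v \<noteq> 0" and G[measurable]: "G \<in> borel_measurable borel" for v :: complex and G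
  proof -
    \<comment> \<open>A rotation that is not \<open>\<pm>1\<close> is a product of three shears.\<close>
    define k where "k = (Re v - 1) / Im v"
    have v1: "(Re v)\<^sup>2 + (Im v)\<^sup>2 = 1" using v by (simp add: cmod_power2 flip: cmod_power2)
    define S where "S = (\<lambda>z. z + of_real (k * Im z))"
    define T where "T = (\<lambda>z. z + \<i> * of_real (Im v * Re z))"
    have [measurable]: "S \<in> borel_measurable borel" "T \<in> borel_measurable borel"
      unfolding S_def T_def by (auto intro!: borel_measurable_continuous_onI continuous_intros)
    have kv: "k * Im v = Re v - 1" using v by (simp add: k_def)
    have kk: "k + k * Re v = - Im v"
    proof -
      have "(k + k * Re v) * Im v = (Re v - 1) * (1 + Re v)"
        using kv by (metis (no_types, opaque_lifting) distrib_left mult.assoc mult.commute mult.right_neutral)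
      also have "\<dots> = - Im v * Im v" using v1 by (simp add: power2_eq_square algebra_simps)
      finally show ?thesis using v mult_right_cancel[of "Im v" "k + k * Re v" "- Im v"] by simp
    qed
    \<comment> \<open>For \<open>v = cis \<theta>\<close> the slopes are
      \<open>k = - tan (\<theta> / 2)\<close> and \<open>sin \<theta>\<close>. \<open>kv\<close> and
      \<open>kk\<close> are the half-angle identities that make the matrices agree.\<close>
    have vST: "v * z = S (T (S z))" for z
    proof (rule complex_eqI)
      have "Im (S (T (S z))) = Im z + Im v * (Re z + k * Im z)" by (simp add: S_def T_def)
      also have "\<dots> = Im v * Re z + (1 + k * Im v) * Im z" by (simp add: algebra_simps)
      finally show im: "Im (v * z) = Im (S (T (S z)))" by (simp add: kv)
      have "Re (S (T (S z))) = Re z + k * Im z + k * Im (S (T (S z)))" by (simp add: S_def T_def)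
      also have "\<dots> = Re z + k * Im z + k * (Re v * Im z + Im v * Re z)" by (simp flip: im)
      also have "\<dots> = (1 + k * Im v) * Re z + (k + k * Re v) * Im z" by (simp add: algebra_simps)
      finally show "Re (v * z) = Re (S (T (S z)))" by (simp add: kv kk)
    qed
    have "(\<integral>\<^sup>+z. G (v * z) \<partial>lborel) = (\<integral>\<^sup>+z. G (S (T (S z))) \<partial>lborel)" by (simp add: vST)
    also have "\<dots> = (\<integral>\<^sup>+z. G (S (T z)) \<partial>lborel)"
      using nn_integral_shear(1)[of "\<lambda>z. G (S (T z))" k] by (simp add: S_def)
    also have "\<dots> = (\<integral>\<^sup>+z. G (S z) \<partial>lborel)"
      using nn_integral_shear(2)[of "\<lambda>z. G (S z)" "Im v"] by (simp add: T_def)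
    also have "\<dots> = (\<integral>\<^sup>+z. G z \<partial>lborel)"
      using nn_integral_shear(1)[of G k] by (simp add: S_def)
    finally show ?thesis .
  qed
  show ?thesis
  proof (cases "Im u = 0")
    case False
    then show ?thesis using main u by simp
  next
    case True
    have r: "Re u \<noteq> 0" using u True by (auto simp: cmod_def)
    \<comment> \<open>For real \<open>u\<close> the slope \<open>k\<close> would divide by zero.
      Writing \<open>u = \<i> * (- \<i> * u)\<close> gives two rotations with nonzero imaginary
      part.\<close>
    have "(\<lambda>z. F (\<i> * z)) \<in> borel_measurable borel"
      by (auto intro!: measurable_compose[OF _ F] borel_measurable_continuous_onI continuous_intros)
    from main[OF _ _ this, of "- \<i> * u"] have "(\<integral>\<^sup>+z. F (\<i> * (- \<i> * u * z)) \<partial>lborel) = (\<integral>\<^sup>+z. F (\<i> * z) \<partial>lborel)"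
      using u r by (simp add: norm_mult)
    also have "\<dots> = (\<integral>\<^sup>+z. F z \<partial>lborel)" by (rule main) auto
    finally show ?thesis by (simp add: mult.assoc[symmetric])
  qed
qed

text \<open>Averages the rotation invariance over all angles and exchanges the integrals. It takes
  the place of polar coordinates: the inner integral is a mean over the circle through
  \<open>z\<close>.\<close>

lemma nn_integral_rotation_average:
  assumes F[measurable]: "F \<in> borel_measurable borel"
  shows "(\<integral>\<^sup>+z. F z \<partial>lborel) = (\<integral>\<^sup>+z. (\<integral>\<^sup>+t. F (cis t * z) \<partial>uniform_measure lborel {0..2 * pi}) \<partial>lborel)"
proof -
  let ?U = "uniform_measure lborel {0..2 * pi}"
  have U1: "emeasure ?U (space ?U) = 1"
    using emeasure_uniform_measure_1[of lborel "{0..2 * pi}"] by simp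
  interpret U: finite_measure ?U by (rule finite_measureI) (simp add: U1)
  interpret P: pair_sigma_finite ?U "lborel :: complex measure" ..
  have [measurable]: "(\<lambda>(t, z). cis t * z) \<in> borel_measurable (borel \<Otimes>\<^sub>M borel)"
    unfolding borel_prod case_prod_beta
    by (intro borel_measurable_continuous_onI continuous_intros)
  have "(\<lambda>(t, z). F (cis t * z)) \<in> borel_measurable (borel \<Otimes>\<^sub>M borel)" by measurable
  then have m: "(\<lambda>(t, z). F (cis t * z)) \<in> borel_measurable (?U \<Otimes>\<^sub>M lborel)"
    by (simp cong: measurable_cong_sets sets_pair_measure_cong)
  have "(\<integral>\<^sup>+z. (\<integral>\<^sup>+t. F (cis t * z) \<partial>?U) \<partial>lborel) = (\<integral>\<^sup>+t. (\<integral>\<^sup>+z. F (cis t * z) \<partial>lborel) \<partial>?U)"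
    using P.Fubini'[of "\<lambda>t z. F (cis t * z)"] m by simp
  also have "\<dots> = (\<integral>\<^sup>+t. (\<integral>\<^sup>+z. F z \<partial>lborel) \<partial>?U)"
    by (intro nn_integral_cong nn_integral_rotate) auto
  also have "\<dots> = (\<integral>\<^sup>+z. F z \<partial>lborel)" using U1 by simp
  finally show ?thesis by simp
qed

subsection \<open>Bergman spaces\<close>

text \<open>Nothing is known about \<open>f\<close> outside \<open>S\<close>; the indicator cuts off
  its arbitrary values there.\<close>

lemma measurable_norm_powr_on_open:
  fixes f :: "complex \<Rightarrow> complex"
  assumes "continuous_on S f" "open S" "0 < p"
  shows "(\<lambda>z. ennreal (norm (f z) powr p) * indicator S z) \<in> borel_measurable borel"
proof -
  have "continuous_on S (\<lambda>z. norm (f z) powr p)"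
    using assms by (intro continuous_on_powr' continuous_on_norm) auto
  then have m: "(\<lambda>z. indicator S z *\<^sub>R (norm (f z) powr p)) \<in> borel_measurable borel"
    using assms by (intro borel_measurable_continuous_on_indicator) auto
  have "(\<lambda>z. ennreal (indicator S z *\<^sub>R (norm (f z) powr p))) \<in> borel_measurable borel"
    using m by measurable
  also have "(\<lambda>z. ennreal (indicator S z *\<^sub>R (norm (f z) powr p)))
      = (\<lambda>z. ennreal (norm (f z) powr p) * indicator S z)"
    by (auto simp: indicator_def)
  finally show ?thesis .
qed

text \<open>After translation to 0 and averaging over rotations, the inner integral at
  \<open>w\<close> is the mean of \<open>|f|\<close> over the circle of radius \<open>|w|\<close>
  about \<open>z0\<close>, which is at least \<open>|f z0|\<close>.\<close>

lemma area_mean_value_le: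
  assumes hol: "f holomorphic_on ball z0 R" and R: "0 < R"
  shows "ennreal (norm (f z0) * (pi * R\<^sup>2)) \<le> (\<integral>\<^sup>+z. ennreal (norm (f z)) * indicator (ball z0 R) z \<partial>lborel)"
proof -
  let ?U = "uniform_measure lborel {0..2 * pi}"
  have U1: "emeasure ?U (space ?U) = 1"
    using emeasure_uniform_measure_1[of lborel "{0..2 * pi}"] by simp
  define G where "G = (\<lambda>w. ennreal (norm (f (z0 + w)) powr 1) * indicator (ball 0 R) w)"
  have hol0: "(\<lambda>w. f (z0 + w)) holomorphic_on ball 0 R"
  proof -
    have "(\<lambda>w. z0 + w) ` ball 0 R \<subseteq> ball z0 R" by (auto simp: dist_norm)
    moreover have "(\<lambda>w. z0 + w) holomorphic_on ball 0 R" by (intro holomorphic_intros)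
    ultimately show ?thesis using holomorphic_on_compose_gen[OF _ hol] by (simp add: o_def)
  qed
  have G[measurable]: "G \<in> borel_measurable borel"
    unfolding G_def using hol0 by (intro measurable_norm_powr_on_open holomorphic_on_imp_continuous_on) auto
  have mean: "ennreal (norm (f z0)) * indicator (ball 0 R) w \<le> (\<integral>\<^sup>+t. G (cis t * w) \<partial>?U)" for w
  proof (cases "w \<in> ball 0 R")
    case True
    show ?thesis
    proof (cases "w = 0")
      case True
      then show ?thesis using R U1 by (simp add: G_def)
    next
      case False
      \<comment> \<open>\<open>cis t * w\<close> runs through its circle from the argument of
        \<open>w\<close>; composing \<open>f\<close> with the rotation by \<open>u\<close> moves the
        start to the positive axis.\<close>
      define u where "u = sgn w"
      have u: "norm u = 1" "w = of_real (norm w) * u"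
        using False by (simp add: u_def norm_sgn, simp add: u_def sgn_eq)
      have w0: "0 < norm w" "norm w < R" using True False by auto
      have "(\<lambda>x. f (z0 + u * x)) holomorphic_on ball 0 R"
      proof -
        have "(\<lambda>x. u * x) ` ball 0 R \<subseteq> ball 0 R" using u by (auto simp: norm_mult)
        moreover have "(\<lambda>x. u * x) holomorphic_on ball 0 R" by (intro holomorphic_intros)
        ultimately show ?thesis using holomorphic_on_compose_gen[OF _ hol0] by (simp add: o_def)
      qed
      from norm_le_circle_mean[OF this w0(2), of 0] w0
      have "norm (f z0) \<le> integral {0..2 * pi} (\<lambda>t. norm (f (z0 + u * (of_real (norm w) * cis t)))) / (2 * pi)"
        by simp
      also have "(\<lambda>t. norm (f (z0 + u * (of_real (norm w) * cis t)))) = (\<lambda>t. norm (f (z0 + cis t * w)))"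
        using u(2) by (metis mult.assoc mult.commute)
      finally have le: "norm (f z0) \<le> integral {0..2 * pi} (\<lambda>t. norm (f (z0 + cis t * w))) / (2 * pi)" .
      have inb: "cis t * w \<in> ball 0 R" for t using w0 by (simp add: norm_mult)
      have cont: "continuous_on UNIV (\<lambda>t. norm (f (z0 + cis t * w)))"
        by (intro continuous_on_norm continuous_on_compose2[OF holomorphic_on_imp_continuous_on[OF hol0]]
            continuous_intros) (use inb in auto)
      have "ennreal (norm (f z0)) \<le> (\<integral>\<^sup>+t. ennreal (norm (f (z0 + cis t * w))) \<partial>?U)"
        unfolding nn_integral_uniform_circle[OF cont norm_ge_zero] by (rule ennreal_leI[OF le])
      then show ?thesis using True inb by (simp add: G_def)
    qed
  qed simp
  have "ennreal (norm (f z0) * (pi * R\<^sup>2)) = ennreal (norm (f z0)) * emeasure lborel (ball (0::complex) R)"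
    using R by (simp add: emeasure_ball unit_ball_vol_2 ennreal_mult')
  also have "\<dots> = (\<integral>\<^sup>+w. ennreal (norm (f z0)) * indicator (ball 0 R) w \<partial>(lborel :: complex measure))"
    by (rule nn_integral_cmult_indicator[symmetric]) simp
  also have "\<dots> \<le> (\<integral>\<^sup>+w. (\<integral>\<^sup>+t. G (cis t * w) \<partial>?U) \<partial>lborel)"
    by (intro nn_integral_mono mean)
  also have "\<dots> = (\<integral>\<^sup>+w. G w \<partial>lborel)" by (rule nn_integral_rotation_average[symmetric]) simp
  also have "\<dots> = (\<integral>\<^sup>+w. ennreal (norm (f (z0 + w))) * indicator (ball z0 R) (z0 + w) \<partial>lborel)"
    by (intro nn_integral_cong) (auto simp: G_def indicator_def dist_norm)
  also have "\<dots> = (\<integral>\<^sup>+z. ennreal (norm (f z)) * indicator (ball z0 R) z \<partial>distr lborel borel ((+) z0))"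
    using measurable_norm_powr_on_open[OF holomorphic_on_imp_continuous_on[OF hol], of 1]
    by (subst nn_integral_distr) auto
  finally show ?thesis by (simp add: lborel_distr_plus)
qed

text \<open>The absorption argument with area means: the ball about \<open>z\<close> of half the
  distance \<open>d\<close> to the boundary has area \<open>pi * d^2 / 4\<close>, which gives the
  exponent \<open>e = 2\<close> and the constant \<open>4 / pi\<close>.\<close>

lemma norm_powr_le_area_integral:
  assumes q: "0 < q" "q \<le> 1" and hol: "f holomorphic_on ball z0 R" and R: "0 < R"
    and bdd: "\<And>z. z \<in> ball z0 R \<Longrightarrow> norm (f z) \<le> B" and J: "0 \<le> J"
    and int: "(\<integral>\<^sup>+z. ennreal (norm (f z) powr q) * indicator (ball z0 R) z \<partial>lborel) \<le> ennreal J"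
  shows "norm (f z0) powr q \<le> 4 / pi * 2 powr (2 / q * (1 - q)) * J / R\<^sup>2"
proof -
  have "norm (f z0) powr q \<le> (4 / pi * J) * 2 powr (2 / q * (1 - q)) / (R - norm (z0 - z0)) powr 2"
  proof (rule absorption_bound[where g = "\<lambda>z. norm (f z)" and B = B])
    fix z M assume z: "z \<in> ball z0 R" and M: "0 < M"
      and fM: "\<And>w. norm (w - z0) \<le> (R + norm (z - z0)) / 2 \<Longrightarrow> norm (f w) \<le> M"
    define d where "d = R - norm (z - z0)"
    have d: "0 < d" using z by (simp add: d_def dist_norm norm_minus_commute)
    have near: "norm (w - z0) \<le> (R + norm (z - z0)) / 2" if "w \<in> ball z (d / 2)" for w
    proof -
      have "norm (w - z0) \<le> norm (w - z) + norm (z - z0)"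
        using norm_triangle_ineq[of "w - z" "z - z0"] by simp
      moreover have "norm (w - z) < d / 2" using that by (simp add: dist_norm norm_minus_commute)
      ultimately show ?thesis by (simp add: d_def field_simps)
    qed
    have sub: "ball z (d / 2) \<subseteq> ball z0 R"
    proof
      fix w assume "w \<in> ball z (d / 2)"
      from near[OF this] d show "w \<in> ball z0 R" by (simp add: d_def dist_norm norm_minus_commute)
    qed
    have "ennreal (norm (f z) * (pi * (d / 2)\<^sup>2))
        \<le> (\<integral>\<^sup>+w. ennreal (norm (f w)) * indicator (ball z (d / 2)) w \<partial>lborel)"
      using holomorphic_on_subset[OF hol sub] d by (intro area_mean_value_le) auto
    also have "\<dots> \<le> (\<integral>\<^sup>+w. ennreal (M powr (1 - q)) * (ennreal (norm (f w) powr q) * indicator (ball z0 R) w) \<partial>lborel)"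
    proof (rule nn_integral_mono)
      fix w
      show "ennreal (norm (f w)) * indicator (ball z (d / 2)) w
          \<le> ennreal (M powr (1 - q)) * (ennreal (norm (f w) powr q) * indicator (ball z0 R) w)"
      proof (cases "w \<in> ball z (d / 2)")
        case True
        have "norm (f w) powr (1 - q) \<le> M powr (1 - q)"
          using fM[OF near[OF True]] q by (intro powr_mono2) auto
        then have "norm (f w) powr (1 - q) * norm (f w) powr q \<le> M powr (1 - q) * norm (f w) powr q"
          by (intro mult_right_mono) auto
        then have "norm (f w) \<le> M powr (1 - q) * norm (f w) powr q" by (simp flip: powr_add)
        then have "ennreal (norm (f w)) \<le> ennreal (M powr (1 - q)) * ennreal (norm (f w) powr q)"
          by (subst ennreal_mult'[symmetric]) (auto intro: ennreal_leI)
        moreover have "w \<in> ball z0 R" using sub True by blast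
        ultimately show ?thesis using True by simp
      qed simp
    qed
    also have "\<dots> = ennreal (M powr (1 - q)) * (\<integral>\<^sup>+w. ennreal (norm (f w) powr q) * indicator (ball z0 R) w \<partial>lborel)"
      using measurable_norm_powr_on_open[OF holomorphic_on_imp_continuous_on[OF hol] open_ball q(1)]
      by (intro nn_integral_cmult) simp
    also have "\<dots> \<le> ennreal (M powr (1 - q)) * ennreal J" by (intro mult_left_mono int) auto
    also have "\<dots> = ennreal (M powr (1 - q) * J)" by (rule ennreal_mult'[symmetric]) simp
    finally have "norm (f z) * (pi * (d / 2)\<^sup>2) \<le> M powr (1 - q) * J"
      using J by (simp add: ennreal_le_iff)
    then have "norm (f z) \<le> 4 / pi * J / d powr 2 * M powr (1 - q)"
      using d by (simp add: field_simps power2_eq_square powr_numeral)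
    then show "norm (f z) \<le> 4 / pi * J / (R - norm (z - z0)) powr 2 * M powr (1 - q)"
      by (simp add: d_def)
  qed (use q J R bdd in auto)
  then show ?thesis using R by (simp add: powr_numeral mult_ac)
qed

lemma nn_integral_weighted_area:
  assumes m: "(\<lambda>z. ennreal (F z) * indicator disk z) \<in> borel_measurable borel" and F: "\<And>z. 0 \<le> F z"
    and \<alpha>: "-1 < \<alpha>"
  shows "(\<integral>\<^sup>+z\<in>disk. ennreal (F z) \<partial>weighted_area \<alpha>)
    = (\<integral>\<^sup>+z. ennreal ((\<alpha> + 1) / pi * (1 - (norm z)\<^sup>2) powr \<alpha> * F z) * indicator disk z \<partial>lborel)"
proof -
  let ?w = "\<lambda>z::complex. ennreal ((\<alpha> + 1) * (1 - (norm z)\<^sup>2) powr \<alpha>)"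
  have [measurable]: "disk \<in> sets borel" by simp
  have w[measurable]: "?w \<in> borel_measurable borel" by measurable
  have disk: "emeasure lborel disk = ennreal pi"
    using emeasure_ball[of 1 "0::complex"] by (simp add: unit_ball_vol_2)
  have [measurable]: "(\<lambda>z. ennreal (F z) * indicator disk z) \<in> borel_measurable lborel" using m by simp
  have mU: "(\<lambda>z. ennreal (F z) * indicator disk z) \<in> borel_measurable disk_area"
    using m by (simp add: disk_area_def cong: measurable_cong_sets)
  have "(\<integral>\<^sup>+z\<in>disk. ennreal (F z) \<partial>weighted_area \<alpha>)
      = (\<integral>\<^sup>+z. ?w z * (ennreal (F z) * indicator disk z) \<partial>disk_area)"
    unfolding weighted_area_def using mU w
    by (intro nn_integral_density) (simp_all add: disk_area_def cong: measurable_cong_sets)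
  also have "\<dots> = (\<integral>\<^sup>+z. ?w z * (ennreal (F z) * indicator disk z) * indicator disk z \<partial>lborel) / ennreal pi"
    unfolding disk_area_def disk[symmetric] by (rule nn_integral_uniform_measure) measurable
  also have "\<dots> = (\<integral>\<^sup>+z. ?w z * (ennreal (F z) * indicator disk z) * indicator disk z / ennreal pi \<partial>lborel)"
    by (rule nn_integral_divide[symmetric]) measurable
  also have "\<dots> = (\<integral>\<^sup>+z. ennreal ((\<alpha> + 1) / pi * (1 - (norm z)\<^sup>2) powr \<alpha> * F z) * indicator disk z \<partial>lborel)"
  proof (intro nn_integral_cong)
    fix z :: complex
    have "?w z * ennreal (F z) / ennreal pi = ennreal ((\<alpha> + 1) / pi * (1 - (norm z)\<^sup>2) powr \<alpha> * F z)"
      using F \<alpha> by (simp add: ennreal_mult''[symmetric] divide_ennreal)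
    then show "?w z * (ennreal (F z) * indicator disk z) * indicator disk z / ennreal pi
      = ennreal ((\<alpha> + 1) / pi * (1 - (norm z)\<^sup>2) powr \<alpha> * F z) * indicator disk z"
      by (auto simp: indicator_def)
  qed
  finally show ?thesis .
qed

text \<open>The exponent of the Bergman weight may have either sign; the sign decides which end of
  the range of \<open>x / t\<close> gives the smaller power.\<close>

lemma powr_ge_of_comparable:
  fixes x t \<alpha> :: real
  assumes "0 < t" "t / 2 \<le> x" "x \<le> 3 * t"
  shows "min ((1 / 2) powr \<alpha>) (3 powr \<alpha>) * t powr \<alpha> \<le> x powr \<alpha>"
proof (cases "0 \<le> \<alpha>")
  case True
  have "min ((1 / 2) powr \<alpha>) (3 powr \<alpha>) * t powr \<alpha> \<le> (1 / 2) powr \<alpha> * t powr \<alpha>"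
    by (intro mult_right_mono) auto
  also have "\<dots> = (1 / 2 * t) powr \<alpha>" using assms by (subst powr_mult) auto
  also have "\<dots> \<le> x powr \<alpha>" using assms True by (intro powr_mono2) auto
  finally show ?thesis .
next
  case False
  have "min ((1 / 2) powr \<alpha>) (3 powr \<alpha>) * t powr \<alpha> \<le> 3 powr \<alpha> * t powr \<alpha>"
    by (intro mult_right_mono) auto
  also have "\<dots> = (3 * t) powr \<alpha>" using assms by (subst powr_mult) auto
  also have "\<dots> \<le> x powr \<alpha>" using assms False by (intro powr_mono2') auto
  finally show ?thesis .
qed

text \<open>On the ball about \<open>z0\<close> of radius \<open>t / 2\<close> the weight is at
  least a constant times \<open>t powr \<alpha>\<close>. Dividing it out loses \<open>t\<close> to
  the power \<open>-\<alpha>\<close>, and the unweighted estimate over an area of order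
  \<open>t^2\<close> loses another \<open>-2\<close>; the \<open>p\<close>-th root turns
  \<open>\<alpha> + 2\<close> into \<open>\<gamma>\<close>.\<close>

lemma point_eval_bound_Bergman:
  assumes p: "0 < p" and \<alpha>: "-1 < \<alpha>"
  shows "point_eval_bound (Bergman p \<alpha>)"
proof -
  obtain m where m: "m \<ge> 1" "0 < p / real m" "p / real m \<le> 1" using exponent_reduction[OF p] .
  define q where "q = p / real m"
  define c\<alpha> where "c\<alpha> = min ((1 / 2) powr \<alpha>) (3 powr \<alpha>)"
  have c\<alpha>: "0 < c\<alpha>" by (simp add: c\<alpha>_def)
  define Cq where "Cq = 4 / pi * 2 powr (2 / q * (1 - q))"
  \<comment> \<open>\<open>Cq\<close> belongs to the unweighted area estimate, the quotient undoes
    the normalized weight, and 4 stems from the radius \<open>t / 2\<close>.\<close>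
  define c where "c = Cq * (pi / ((\<alpha> + 1) * c\<alpha>)) * 4"
  have c0: "0 \<le> c" using c\<alpha> \<alpha> by (simp add: c_def Cq_def)
  show ?thesis unfolding point_eval_bound_def
  proof (intro exI[of _ "c powr (1 / p)"] conjI allI impI ballI)
    fix f M z0 assume hol: "f holomorphic_on disk" and M: "0 \<le> M"
      and le: "norm_of (Bergman p \<alpha>) f \<le> ennreal M" and z0: "z0 \<in> disk"
    define t where "t = 1 - norm z0"
    have t: "0 < t" using z0 by (simp add: t_def)
    have near: "w \<in> disk" "t / 2 \<le> 1 - (norm w)\<^sup>2" "1 - (norm w)\<^sup>2 \<le> 3 * t"
      if w: "norm (w - z0) \<le> t / 2" for w
    proof -
      have "norm w \<le> norm z0 + t / 2" "norm z0 - t / 2 \<le> norm w"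
        using norm_triangle_ineq[of z0 "w - z0"] norm_triangle_ineq2[of z0 w] w
        by (auto simp: norm_minus_commute)
      then have b: "t / 2 \<le> 1 - norm w" "1 - norm w \<le> 3 * t / 2" by (auto simp: t_def field_simps)
      then show "w \<in> disk" using t by simp
      then show "t / 2 \<le> 1 - (norm w)\<^sup>2" "1 - (norm w)\<^sup>2 \<le> 3 * t"
        using b one_minus_norm_square_bounds[of w] by auto
    qed
    have sub: "cball z0 (t / 2) \<subseteq> disk" "ball z0 (t / 2) \<subseteq> disk"
      using near(1) by (auto simp: dist_norm norm_minus_commute)
    define J where "J = M powr p / ((\<alpha> + 1) / pi * (c\<alpha> * t powr \<alpha>))"
    have J0: "0 \<le> J" using c\<alpha> \<alpha> by (simp add: J_def)
    note meas = measurable_norm_powr_on_open[OF holomorphic_on_imp_continuous_on[OF hol] open_ball p]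
    have "(\<integral>\<^sup>+z. ennreal ((\<alpha> + 1) / pi * (c\<alpha> * t powr \<alpha>)) * (ennreal (norm (f z) powr p) * indicator (ball z0 (t / 2)) z) \<partial>lborel)
      \<le> (\<integral>\<^sup>+z. ennreal ((\<alpha> + 1) / pi * (1 - (norm z)\<^sup>2) powr \<alpha> * norm (f z) powr p) * indicator disk z \<partial>lborel)"
    proof (rule nn_integral_mono)
      fix z :: complex
      show "ennreal ((\<alpha> + 1) / pi * (c\<alpha> * t powr \<alpha>)) * (ennreal (norm (f z) powr p) * indicator (ball z0 (t / 2)) z)
        \<le> ennreal ((\<alpha> + 1) / pi * (1 - (norm z)\<^sup>2) powr \<alpha> * norm (f z) powr p) * indicator disk z"
      proof (cases "z \<in> ball z0 (t / 2)")
        case True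
        then have z: "norm (z - z0) \<le> t / 2" by (simp add: dist_norm norm_minus_commute)
        have "c\<alpha> * t powr \<alpha> \<le> (1 - (norm z)\<^sup>2) powr \<alpha>"
          unfolding c\<alpha>_def using near[OF z] t by (intro powr_ge_of_comparable)
        then have "(\<alpha> + 1) / pi * (c\<alpha> * t powr \<alpha>) * norm (f z) powr p
            \<le> (\<alpha> + 1) / pi * (1 - (norm z)\<^sup>2) powr \<alpha> * norm (f z) powr p"
          using \<alpha> by (intro mult_right_mono mult_left_mono) auto
        then have "ennreal ((\<alpha> + 1) / pi * (c\<alpha> * t powr \<alpha>)) * ennreal (norm (f z) powr p)
            \<le> ennreal ((\<alpha> + 1) / pi * (1 - (norm z)\<^sup>2) powr \<alpha> * norm (f z) powr p)"
          by (subst ennreal_mult''[symmetric]) (auto intro: ennreal_leI)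
        then show ?thesis using True near(1)[OF z] by simp
      qed simp
    qed
    also have "\<dots> = (\<integral>\<^sup>+z\<in>disk. ennreal (norm (f z) powr p) \<partial>weighted_area \<alpha>)"
      by (rule nn_integral_weighted_area[OF meas _ \<alpha>, symmetric]) simp
    also have "\<dots> \<le> ennreal (M powr p)"
      using le by (simp add: bergman_norm_def ennreal_root_le_iff[OF p M])
    also have "(\<integral>\<^sup>+z. ennreal ((\<alpha> + 1) / pi * (c\<alpha> * t powr \<alpha>)) * (ennreal (norm (f z) powr p) * indicator (ball z0 (t / 2)) z) \<partial>lborel)
       = ennreal ((\<alpha> + 1) / pi * (c\<alpha> * t powr \<alpha>)) * (\<integral>\<^sup>+z. ennreal (norm (f z) powr p) * indicator (ball z0 (t / 2)) z \<partial>lborel)"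
      using measurable_norm_powr_on_open[OF continuous_on_subset[OF holomorphic_on_imp_continuous_on[OF hol] sub(2)] open_ball p]
      by (intro nn_integral_cmult) simp
    finally have L: "ennreal ((\<alpha> + 1) / pi * (c\<alpha> * t powr \<alpha>)) * (\<integral>\<^sup>+z. ennreal (norm (f z) powr p) * indicator (ball z0 (t / 2)) z \<partial>lborel)
        \<le> ennreal (M powr p)" .
    define \<kappa> where "\<kappa> = (\<alpha> + 1) / pi * (c\<alpha> * t powr \<alpha>)"
    have \<kappa>: "0 < \<kappa>" using \<alpha> c\<alpha> t by (simp add: \<kappa>_def)
    have Jk: "J = M powr p / \<kappa>" by (simp add: J_def \<kappa>_def)
    have int: "(\<integral>\<^sup>+z. ennreal (norm (f z) powr p) * indicator (ball z0 (t / 2)) z \<partial>lborel) \<le> ennreal J"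
    proof -
      have "(\<integral>\<^sup>+z. ennreal (norm (f z) powr p) * indicator (ball z0 (t / 2)) z \<partial>lborel)
         = ennreal (1 / \<kappa>) * (ennreal \<kappa> *
           (\<integral>\<^sup>+z. ennreal (norm (f z) powr p) * indicator (ball z0 (t / 2)) z \<partial>lborel))"
        using \<kappa> by (simp add: mult.assoc[symmetric] ennreal_mult''[symmetric])
      also have "\<dots> \<le> ennreal (1 / \<kappa>) * ennreal (M powr p)"
        by (intro mult_left_mono L[folded \<kappa>_def]) auto
      also have "\<dots> = ennreal J" by (simp add: Jk ennreal_mult''[symmetric])
      finally show ?thesis .
    qed
    have "compact (f ` cball z0 (t / 2))"
      by (intro compact_continuous_image holomorphic_on_imp_continuous_on holomorphic_on_subset[OF hol] sub) auto
    then obtain B where "\<And>x. x \<in> cball z0 (t / 2) \<Longrightarrow> norm (f x) \<le> B"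
      using compact_imp_bounded bounded_iff by (metis (no_types, lifting) image_eqI)
    then have B: "norm (f x ^ m) \<le> B ^ m" if "x \<in> ball z0 (t / 2)" for x
      using that by (simp add: norm_power power_mono)
    have "norm (f z0 ^ m) powr q \<le> 4 / pi * 2 powr (2 / q * (1 - q)) * J / (t / 2)\<^sup>2"
    proof (rule norm_powr_le_area_integral[where f = "\<lambda>z. f z ^ m" and B = "B ^ m"])
      show "(\<lambda>z. f z ^ m) holomorphic_on ball z0 (t / 2)"
        by (intro holomorphic_intros holomorphic_on_subset[OF hol] sub)
      show "(\<integral>\<^sup>+z. ennreal (norm (f z ^ m) powr q) * indicator (ball z0 (t / 2)) z \<partial>lborel) \<le> ennreal J"
        using int unfolding q_def norm_power_powr[OF m(1)] .
    qed (use m t B J0 in \<open>auto simp: q_def\<close>)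
    also have "norm (f z0 ^ m) powr q = norm (f z0) powr p" unfolding q_def by (rule norm_power_powr[OF m(1)])
    also have "4 / pi * 2 powr (2 / q * (1 - q)) * J / (t / 2)\<^sup>2 = c * M powr p / t powr (\<alpha> + 2)"
      using t \<alpha> c\<alpha> by (simp add: c_def Cq_def J_def powr_add powr_numeral power2_eq_square)
    finally have "norm (f z0) \<le> c powr (1 / p) * M / t powr ((\<alpha> + 2) / p)"
      using p M t c0 by (intro powr_le_imp_le_root) auto
    then show "norm (f z0) \<le> c powr (1 / p) * M / (1 - norm z0) powr gamma_of (Bergman p \<alpha>)"
      by (simp add: t_def)
  qed simp
qed

section \<open>Integral estimates for the Bergman test functions\<close>

text \<open>The set where \<open>1 - |z|^2 > x\<close> is a disk of area \<open>pi * (1 - x)\<close>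
  for \<open>x\<close> in \<open>[0, 1]\<close>, so \<open>1 - |z|^2\<close> carries area to
  \<open>pi\<close> times the uniform distribution on \<open>[0, 1]\<close>. Comparing the two
  measures on half-lines proves this.\<close>

lemma nn_integral_disk_radial:
  assumes \<psi>[measurable]: "\<psi> \<in> borel_measurable borel"
  shows "(\<integral>\<^sup>+z. \<psi> (1 - (norm z)\<^sup>2) * indicator disk z \<partial>(lborel :: complex measure))
    = ennreal pi * (\<integral>\<^sup>+x. \<psi> x * indicator {0..1} x \<partial>lborel)"
proof -
  let ?r = "\<lambda>z::complex. 1 - (norm z)\<^sup>2"
  let ?M = "distr (density lborel (indicator disk)) borel ?r"
  let ?N = "density lborel (\<lambda>x. ennreal pi * indicator {0..1::real} x)"
  have dm[measurable]: "disk \<in> sets borel" by simp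
  have dI: "(indicator disk :: complex \<Rightarrow> ennreal) \<in> borel_measurable lborel" by simp
  have [measurable]: "?r \<in> borel_measurable borel" by measurable
  have eM: "emeasure ?M {x<..} = emeasure lborel (disk \<inter> {z. x < ?r z})" for x
  proof -
    have "emeasure ?M {x<..} = emeasure (density lborel (indicator disk)) (?r -` {x<..} \<inter> space (density lborel (indicator disk)))"
      by (rule emeasure_distr) auto
    also have "\<dots> = (\<integral>\<^sup>+z. indicator disk z * indicator (?r -` {x<..}) z \<partial>lborel)"
      using dI by (subst emeasure_density) (auto simp: vimage_def)
    also have "\<dots> = (\<integral>\<^sup>+z. indicator (disk \<inter> {z. x < ?r z}) z \<partial>lborel)"
      by (intro nn_integral_cong) (auto simp: indicator_def)
    also have "\<dots> = emeasure lborel (disk \<inter> {z. x < ?r z})"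
      by (rule nn_integral_indicator) auto
    finally show ?thesis .
  qed
  have eN: "emeasure ?N {x<..} = ennreal pi * emeasure lborel ({0..1} \<inter> {x<..})" for x
  proof -
    have "emeasure ?N {x<..} = (\<integral>\<^sup>+y. ennreal pi * indicator {0..1} y * indicator {x<..} y \<partial>lborel)"
      by (rule emeasure_density) auto
    also have "\<dots> = (\<integral>\<^sup>+y. ennreal pi * indicator ({0..1} \<inter> {x<..}) y \<partial>lborel)"
      by (intro nn_integral_cong) (auto simp: indicator_def)
    also have "\<dots> = ennreal pi * emeasure lborel ({0..1} \<inter> {x<..})"
      by (rule nn_integral_cmult_indicator) auto
    finally show ?thesis .
  qed
  have disk: "emeasure lborel disk = ennreal pi"
    using emeasure_ball[of 1 "0::complex"] by (simp add: unit_ball_vol_2)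
  have "?M = ?N"
  proof (rule measure_eqI_lessThan)
    fix x :: real
    show "emeasure ?M {x<..} = emeasure ?N {x<..}"
    proof -
      consider "x < 0" | "0 \<le> x" "x < 1" | "1 \<le> x" by linarith
      then show ?thesis
      proof cases
        case 1
        have "disk \<inter> {z. x < ?r z} = disk"
        proof -
          have "x < ?r z" if "z \<in> disk" for z
            using one_minus_norm_square_bounds(1)[of z] that 1 by auto
          then show ?thesis by blast
        qed
        moreover have "{0..1} \<inter> {x<..} = {0..1}" using 1 by auto
        ultimately show ?thesis unfolding eM eN by (simp add: disk)
      next
        case 2
        have "disk \<inter> {z. x < ?r z} = ball 0 (sqrt (1 - x))"
        proof (intro set_eqI iffI)
          fix z assume "z \<in> disk \<inter> {z. x < ?r z}"
          then have "(norm z)\<^sup>2 < 1 - x" by simp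
          then show "z \<in> ball 0 (sqrt (1 - x))" by (simp add: real_less_rsqrt)
        next
          fix z :: complex assume "z \<in> ball 0 (sqrt (1 - x))"
          then have n: "norm z < sqrt (1 - x)" by simp
          then have "(norm z)\<^sup>2 < (sqrt (1 - x))\<^sup>2" by (intro power_strict_mono) auto
          then have "(norm z)\<^sup>2 < 1 - x" using 2 by simp
          moreover have "sqrt (1 - x) \<le> 1" using 2 by simp
          with n have "norm z < 1" by linarith
          ultimately show "z \<in> disk \<inter> {z. x < ?r z}" using n by simp
        qed
        moreover have "{0..1} \<inter> {x<..} = {x<..1}" using 2 by auto
        ultimately show ?thesis unfolding eM eN
          using 2 emeasure_ball[of "sqrt (1 - x)" "0::complex"]
          by (simp add: unit_ball_vol_2 ennreal_mult')
      next
        case 3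
        have "\<not> x < ?r z" for z using 3 zero_le_power2[of "norm z"] by linarith
        then have "disk \<inter> {z. x < ?r z} = {}" by blast
        moreover have "{0..1} \<inter> {x<..} = {}" using 3 by auto
        ultimately show ?thesis unfolding eM eN by simp
      qed
    qed
    have "emeasure lborel (disk \<inter> {z. x < ?r z}) \<le> ennreal pi"
      unfolding disk[symmetric] by (intro emeasure_mono) auto
    then show "emeasure ?M {x<..} < \<infinity>" unfolding eM by (rule order_le_less_trans) simp
  qed auto
  have "(\<integral>\<^sup>+z. \<psi> (?r z) * indicator disk z \<partial>lborel) = (\<integral>\<^sup>+z. \<psi> (?r z) \<partial>density lborel (indicator disk))"
    using dI by (subst nn_integral_density) (auto simp: mult.commute)
  also have "\<dots> = (\<integral>\<^sup>+x. \<psi> x \<partial>?M)" by (subst nn_integral_distr) auto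
  also have "\<dots> = (\<integral>\<^sup>+x. \<psi> x \<partial>?N)" by (simp only: \<open>?M = ?N\<close>)
  also have "\<dots> = (\<integral>\<^sup>+x. ennreal pi * (\<psi> x * indicator {0..1} x) \<partial>lborel)"
    by (subst nn_integral_density) (auto simp: mult_ac intro!: nn_integral_cong)
  also have "\<dots> = ennreal pi * (\<integral>\<^sup>+x. \<psi> x * indicator {0..1} x \<partial>lborel)"
    by (rule nn_integral_cmult) auto
  finally show ?thesis .
qed

text \<open>Splitting at \<open>x = t\<close> leaves pure powers: \<open>x powr \<alpha>\<close> on
  \<open>[0, t]\<close>, integrable because \<open>\<alpha> > -1\<close>, and
  \<open>x powr (- \<alpha> - 3)\<close> on \<open>[t, 1]\<close>. The factor
  \<open>t powr (\<alpha> + 2)\<close> compensates both exactly, so the bound does not depend on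
  \<open>t\<close>.\<close>

lemma nn_integral_powr_split_le:
  fixes \<alpha> t K :: real
  assumes \<alpha>: "-1 < \<alpha>" and t: "0 < t" "t \<le> 1" and K: "0 \<le> K"
  shows "(\<integral>\<^sup>+x. ennreal (K * t powr (\<alpha> + 2) * x powr \<alpha> / max t x powr (2 * \<alpha> + 3)) * indicator {0..1} x \<partial>lborel)
    \<le> ennreal (K * (1 / (\<alpha> + 1) + 1 / (\<alpha> + 2)))"
proof -
  define K1 where "K1 = K * t powr (\<alpha> + 2) / t powr (2 * \<alpha> + 3)"
  define K2 where "K2 = K * t powr (\<alpha> + 2)"
  have K12: "0 \<le> K1" "0 \<le> K2" using K by (simp_all add: K1_def K2_def)
  let ?A = "\<lambda>x. ennreal (K1 * x powr \<alpha>) * indicator {0..t} x"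
  let ?B = "\<lambda>x. ennreal (K2 * x powr (- \<alpha> - 3)) * indicator {t..1} x"
  have le: "ennreal (K * t powr (\<alpha> + 2) * x powr \<alpha> / max t x powr (2 * \<alpha> + 3)) * indicator {0..1} x \<le> ?A x + ?B x"
    for x
  proof -
    consider "x < 0 \<or> 1 < x" | "0 \<le> x" "x \<le> t" | "t < x" "x \<le> 1" by linarith
    then show ?thesis
    proof cases
      case 2
      then have "max t x = t" by simp
      then have "K * t powr (\<alpha> + 2) * x powr \<alpha> / max t x powr (2 * \<alpha> + 3) = K1 * x powr \<alpha>"
        by (simp add: K1_def)
      then show ?thesis using 2 t by (auto simp: indicator_def)
    next
      case 3
      then have m: "max t x = x" by simp
      have "x powr \<alpha> / x powr (2 * \<alpha> + 3) = x powr (- \<alpha> - 3)"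
        by (simp add: algebra_simps flip: powr_diff)
      then have "K * t powr (\<alpha> + 2) * x powr \<alpha> / max t x powr (2 * \<alpha> + 3) = K2 * x powr (- \<alpha> - 3)"
        unfolding m by (simp add: K2_def flip: times_divide_eq_right)
      then show ?thesis using 3 t by (auto simp: indicator_def)
    qed auto
  qed
  have IA: "(\<integral>\<^sup>+x. ?A x \<partial>lborel) = ennreal (K1 * (t powr (\<alpha> + 1) / (\<alpha> + 1)))"
    using has_integral_powr_from_0[OF \<alpha>, of t] t K12
    by (intro nn_integral_has_integral_lebesgue' has_integral_mult_right) auto
  have IB: "(\<integral>\<^sup>+x. ?B x \<partial>lborel) = ennreal (K2 * ((t powr - (\<alpha> + 2) - 1) / (\<alpha> + 2)))"
  proof (intro nn_integral_has_integral_lebesgue' has_integral_mult_right)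
    let ?F = "\<lambda>x. - (x powr - (\<alpha> + 2)) / (\<alpha> + 2)"
    have cancel: "- (- c * v) / c = v" if "c \<noteq> 0" for c v :: real using that by simp
    have "((\<lambda>x. x powr (- \<alpha> - 3)) has_integral (?F 1 - ?F t)) {t..1}"
    proof (rule fundamental_theorem_of_calculus)
      fix x assume "x \<in> {t..1}"
      then have "x > 0" using t by simp
      then have "(?F has_real_derivative - (- (\<alpha> + 2) * x powr (- (\<alpha> + 2) - 1)) / (\<alpha> + 2)) (at x within {t..1})"
        by (intro DERIV_cdivide DERIV_minus has_real_derivative_powr[THEN has_field_derivative_at_within])
      also have "- (- (\<alpha> + 2) * x powr (- (\<alpha> + 2) - 1)) / (\<alpha> + 2) = x powr (- (\<alpha> + 2) - 1)"
        by (rule cancel) (use \<alpha> in simp)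
      also have "\<dots> = x powr (- \<alpha> - 3)" by (simp add: algebra_simps)
      finally show "(?F has_vector_derivative x powr (- \<alpha> - 3)) (at x within {t..1})"
        by (simp add: has_real_derivative_iff_has_vector_derivative)
    qed (use t in simp)
    moreover have "?F 1 - ?F t = (t powr - (\<alpha> + 2) - 1) / (\<alpha> + 2)" by (simp add: diff_divide_distrib)
    ultimately show "((\<lambda>x. x powr (- \<alpha> - 3)) has_integral (t powr - (\<alpha> + 2) - 1) / (\<alpha> + 2)) {t..1}"
      by (simp only:)
  qed (use K12 in auto)
  have k1: "K1 * (t powr (\<alpha> + 1) / (\<alpha> + 1)) = K * (1 / (\<alpha> + 1))"
  proof -
    have eq: "t powr (\<alpha> + 2) * t powr (\<alpha> + 1) = t powr (2 * \<alpha> + 3)" by (simp flip: powr_add)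
    have "K1 * (t powr (\<alpha> + 1) / (\<alpha> + 1))
        = K * (t powr (\<alpha> + 2) * t powr (\<alpha> + 1) / t powr (2 * \<alpha> + 3)) / (\<alpha> + 1)"
      by (simp add: K1_def)
    then show ?thesis unfolding eq using t by simp
  qed
  have k2: "K2 * ((t powr - (\<alpha> + 2) - 1) / (\<alpha> + 2)) \<le> K * (1 / (\<alpha> + 2))"
  proof -
    have "K2 * (t powr - (\<alpha> + 2) - 1) \<le> K2 * t powr - (\<alpha> + 2)" using K12 by (intro mult_left_mono) auto
    also have "\<dots> = K" using t by (simp add: K2_def mult.assoc flip: powr_add)
    finally show ?thesis using \<alpha> by (simp add: divide_right_mono)
  qed
  have "(\<integral>\<^sup>+x. ennreal (K * t powr (\<alpha> + 2) * x powr \<alpha> / max t x powr (2 * \<alpha> + 3)) * indicator {0..1} x \<partial>lborel)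
     \<le> (\<integral>\<^sup>+x. ?A x + ?B x \<partial>lborel)"
    by (intro nn_integral_mono le)
  also have "\<dots> = (\<integral>\<^sup>+x. ?A x \<partial>lborel) + (\<integral>\<^sup>+x. ?B x \<partial>lborel)"
    by (rule nn_integral_add) auto
  also have "\<dots> \<le> ennreal (K * (1 / (\<alpha> + 1))) + ennreal (K * (1 / (\<alpha> + 2)))"
    unfolding IA IB k1 by (intro add_left_mono ennreal_leI k2)
  also have "\<dots> = ennreal (K * (1 / (\<alpha> + 1) + 1 / (\<alpha> + 2)))"
    using K \<alpha> by (subst ennreal_plus[symmetric]) (auto simp: distrib_left)
  finally show ?thesis .
qed

text \<open>Of the \<open>2 \<alpha> + 4\<close> powers of the kernel, two are integrated by the
  Poisson identity and contribute one power of \<open>1 / D\<close>; the other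
  \<open>2 \<alpha> + 2\<close>, a positive number, are bounded by their value at the minimal
  modulus \<open>D\<close>.\<close>

lemma circle_mean_kernel_le:
  assumes \<alpha>: "-1 < \<alpha>" and a: "a \<in> disk" and w: "w \<in> disk"
  defines "m \<equiv> max (1 - (norm a)\<^sup>2) (1 - (norm w)\<^sup>2)"
  shows "(\<integral>\<^sup>+t. ennreal (1 / (norm (1 - cnj a * (cis t * w)))\<^sup>2 powr (\<alpha> + 2)) \<partial>uniform_measure lborel {0..2 * pi})
    \<le> ennreal (2 powr (2 * \<alpha> + 3) / m powr (2 * \<alpha> + 3))"
proof -
  define b where "b = cnj a * w"
  define D where "D = 1 - norm b"
  have nb: "norm b \<le> norm a" "norm b \<le> norm w"
    using a w by (simp_all add: b_def norm_mult mult_left_le mult_left_le_one_le)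
  \<comment> \<open>\<open>|b|\<close> is at most both \<open>|a|\<close> and \<open>|w|\<close>, so
    \<open>D\<close> controls the larger of the two distances to the boundary. This maximum makes
    the later integral over \<open>[0, 1]\<close> converge uniformly in \<open>a\<close>.\<close>
  have D: "0 < D" "m / 2 \<le> D"
    using nb a w one_minus_norm_square_bounds(3)[of a] one_minus_norm_square_bounds(3)[of w]
    by (auto simp: D_def m_def)
  have m0: "0 < m" using one_minus_norm_square_bounds(1)[of a] a by (simp add: m_def less_max_iff_disj)
  have b1: "norm b < 1" using D by (simp add: D_def)
  define \<phi> where "\<phi> = (\<lambda>t. D powr - (2 * \<alpha> + 2) * (1 / (norm (1 - b * cis t))\<^sup>2))"
  have Dle: "D \<le> norm (1 - b * cis t)" for t
    using norm_triangle_ineq2[of 1 "b * cis t"] by (simp add: D_def norm_mult)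
  have pt: "1 / (norm (1 - cnj a * (cis t * w)))\<^sup>2 powr (\<alpha> + 2) \<le> \<phi> t" for t
  proof -
    define y where "y = norm (1 - b * cis t)"
    have y: "D \<le> y" "0 < y" using Dle[of t] D by (auto simp: y_def)
    have y2: "y powr (c - 2) = y powr c * (1 / y\<^sup>2)" for c
      using y by (simp add: powr_diff powr_numeral)
    have "(norm (1 - cnj a * (cis t * w)))\<^sup>2 = y\<^sup>2" by (simp add: y_def b_def mult_ac)
    moreover have "1 / y\<^sup>2 powr (\<alpha> + 2) = y powr - (2 * \<alpha> + 2) * (1 / y\<^sup>2)"
    proof -
      have "y\<^sup>2 powr (\<alpha> + 2) = y powr (2 * (\<alpha> + 2))"
        using y by (simp add: powr_powr flip: powr_numeral)
      then have "1 / y\<^sup>2 powr (\<alpha> + 2) = y powr - (2 * (\<alpha> + 2))"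
        by (simp only: powr_minus_divide)
      also have "\<dots> = y powr (- (2 * \<alpha> + 2) - 2)" by (simp add: algebra_simps)
      also have "\<dots> = y powr - (2 * \<alpha> + 2) * (1 / y\<^sup>2)" by (rule y2)
      finally show ?thesis .
    qed
    moreover have "y powr - (2 * \<alpha> + 2) \<le> D powr - (2 * \<alpha> + 2)"
      using y D \<alpha> by (intro powr_mono2') auto
    then have "y powr - (2 * \<alpha> + 2) * (1 / y\<^sup>2) \<le> \<phi> t"
      unfolding \<phi>_def y_def[symmetric] by (intro mult_right_mono) auto
    ultimately show ?thesis by simp
  qed
  have nz: "1 - b * cis t \<noteq> 0" for t using Dle[of t] D by auto
  have cont: "continuous_on UNIV \<phi>" unfolding \<phi>_def using nz by (intro continuous_intros) auto
  have "(\<integral>\<^sup>+t. ennreal (1 / (norm (1 - cnj a * (cis t * w)))\<^sup>2 powr (\<alpha> + 2)) \<partial>uniform_measure lborel {0..2 * pi})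
     \<le> (\<integral>\<^sup>+t. ennreal (\<phi> t) \<partial>uniform_measure lborel {0..2 * pi})"
    by (intro nn_integral_mono ennreal_leI pt)
  also have "\<dots> = ennreal (integral {0..2 * pi} \<phi> / (2 * pi))"
    by (rule nn_integral_uniform_circle[OF cont]) (simp add: \<phi>_def)
  also have "integral {0..2 * pi} \<phi> = D powr - (2 * \<alpha> + 2) * (2 * pi / (1 - (norm b)\<^sup>2))"
    unfolding \<phi>_def by (intro integral_unique has_integral_mult_right integral_circle_inverse_square b1)
  also have "D powr - (2 * \<alpha> + 2) * (2 * pi / (1 - (norm b)\<^sup>2)) / (2 * pi) = D powr - (2 * \<alpha> + 2) / (1 - (norm b)\<^sup>2)"
    by simp
  also have "ennreal \<dots> \<le> ennreal (2 powr (2 * \<alpha> + 3) / m powr (2 * \<alpha> + 3))"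
  proof (rule ennreal_leI)
    have half: "(m / 2) powr - r = 2 powr r / m powr r" for r
      using m0 by (simp add: powr_minus powr_divide)
    have "D powr - (2 * \<alpha> + 2) / (1 - (norm b)\<^sup>2) \<le> D powr - (2 * \<alpha> + 2) / D"
      using one_minus_norm_square_bounds[OF b1] D by (intro divide_left_mono mult_pos_pos) (auto simp: D_def)
    also have "\<dots> = D powr (- (2 * \<alpha> + 2) - 1)"
      using powr_diff[of D "- (2 * \<alpha> + 2)" 1] D by (simp only: powr_one)
    also have "\<dots> = D powr - (2 * \<alpha> + 3)" by (simp add: algebra_simps)
    also have "\<dots> \<le> (m / 2) powr - (2 * \<alpha> + 3)" using D m0 \<alpha> by (intro powr_mono2') auto
    also have "\<dots> = 2 powr (2 * \<alpha> + 3) / m powr (2 * \<alpha> + 3)"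
      by (rule half)
    finally show "D powr - (2 * \<alpha> + 2) / (1 - (norm b)\<^sup>2) \<le> 2 powr (2 * \<alpha> + 3) / m powr (2 * \<alpha> + 3)" .
  qed
  finally show ?thesis .
qed

text \<open>The weight is radial, so rotation averaging acts only on the kernel. Its circle means
  are bounded by a function of \<open>x = 1 - |w|^2\<close>, and the remaining integral over
  \<open>x\<close> is independent of \<open>a\<close>.\<close>

lemma test_bound_Bergman:
  assumes p: "0 < p" and \<alpha>: "-1 < \<alpha>"
  shows "test_bound (Bergman p \<alpha>)"
proof -
  define K where "K = (\<alpha> + 1) / pi * 2 powr (2 * \<alpha> + 3)"
  have K: "0 \<le> K" using \<alpha> by (simp add: K_def)
  define C where "C = pi * (K * (1 / (\<alpha> + 1) + 1 / (\<alpha> + 2)))"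
  have C: "0 \<le> C" using K \<alpha> by (simp add: C_def)
  show ?thesis unfolding test_bound_def
  proof (intro exI[of _ "C powr (1 / p)"] conjI ballI allI)
    fix a :: complex and k assume a: "a \<in> disk"
    let ?U = "uniform_measure lborel {0..2 * pi}"
    define h where "h = (\<lambda>z. test_fun ((\<alpha> + 2) / p) a z * sigma a z ^ k)"
    define t where "t = 1 - (norm a)\<^sup>2"
    have t: "0 < t" "t \<le> 1" using one_minus_norm_square_bounds(1)[of a] a by (auto simp: t_def)
    define \<psi> where "\<psi> = (\<lambda>x. ennreal (K * t powr (\<alpha> + 2) * x powr \<alpha> / max t x powr (2 * \<alpha> + 3)))"
    have \<psi>[measurable]: "\<psi> \<in> borel_measurable borel" unfolding \<psi>_def by measurable
    define g where "g = (\<lambda>z::complex. (\<alpha> + 1) / pi * (1 - (norm z)\<^sup>2) powr \<alpha> * t powr (\<alpha> + 2))"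
    \<comment> \<open>The averaging lemma needs a Borel function on the whole plane;
      \<open>G\<close> is one, whereas \<open>h\<close> is controlled only on the disk.\<close>
    define G where "G = (\<lambda>z. ennreal (g z) * ennreal (1 / (norm (1 - cnj a * z))\<^sup>2 powr (\<alpha> + 2)) * indicator disk z)"
    have [measurable]: "disk \<in> sets borel" by simp
    have [measurable]: "(\<lambda>z. 1 - cnj a * z) \<in> borel_measurable borel"
      by (intro borel_measurable_continuous_onI continuous_intros)
    have G[measurable]: "G \<in> borel_measurable borel" unfolding G_def g_def by measurable
    have hhol: "h holomorphic_on disk" unfolding h_def by (rule holomorphic_test_fun_mult_sigma[OF a])
    have hle: "norm (h z) powr p \<le> t powr (\<alpha> + 2) * (1 / (norm (1 - cnj a * z))\<^sup>2 powr (\<alpha> + 2))" if z: "z \<in> disk" for z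
    proof -
      have "norm (h z) powr p \<le> norm (test_fun ((\<alpha> + 2) / p) a z) powr p"
        unfolding h_def using p norm_test_fun_mult_sigma_le[OF a z] by (intro powr_mono2) auto
      also have "\<dots> = (t / (norm (1 - cnj a * z))\<^sup>2) powr (\<alpha> + 2)"
        unfolding norm_test_fun[OF a z] t_def using p by (simp add: powr_powr)
      finally show ?thesis using t by (simp add: powr_divide)
    qed
    have g0: "0 \<le> g z" for z using \<alpha> by (simp add: g_def)
    have "(\<integral>\<^sup>+z\<in>disk. ennreal (norm (h z) powr p) \<partial>weighted_area \<alpha>)
       = (\<integral>\<^sup>+z. ennreal ((\<alpha> + 1) / pi * (1 - (norm z)\<^sup>2) powr \<alpha> * norm (h z) powr p) * indicator disk z \<partial>lborel)"
      by (rule nn_integral_weighted_area[OF measurable_norm_powr_on_open[OF holomorphic_on_imp_continuous_on[OF hhol] open_ball p] _ \<alpha>]) simp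
    also have "\<dots> \<le> (\<integral>\<^sup>+z. G z \<partial>lborel)"
    proof (rule nn_integral_mono)
      fix z
      show "ennreal ((\<alpha> + 1) / pi * (1 - (norm z)\<^sup>2) powr \<alpha> * norm (h z) powr p) * indicator disk z \<le> G z"
      proof (cases "z \<in> disk")
        case True
        have "(\<alpha> + 1) / pi * (1 - (norm z)\<^sup>2) powr \<alpha> * norm (h z) powr p
            \<le> (\<alpha> + 1) / pi * (1 - (norm z)\<^sup>2) powr \<alpha> * (t powr (\<alpha> + 2) * (1 / (norm (1 - cnj a * z))\<^sup>2 powr (\<alpha> + 2)))"
          using hle[OF True] \<alpha> by (intro mult_left_mono) auto
        also have "\<dots> = g z * (1 / (norm (1 - cnj a * z))\<^sup>2 powr (\<alpha> + 2))" by (simp add: g_def)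
        finally show ?thesis using True g0 by (simp add: G_def ennreal_leI flip: ennreal_mult)
      qed simp
    qed
    also have "\<dots> = (\<integral>\<^sup>+w. (\<integral>\<^sup>+\<theta>. G (cis \<theta> * w) \<partial>?U) \<partial>lborel)"
      by (rule nn_integral_rotation_average) simp
    also have "\<dots> \<le> (\<integral>\<^sup>+w. \<psi> (1 - (norm w)\<^sup>2) * indicator disk w \<partial>(lborel :: complex measure))"
    proof (rule nn_integral_mono)
      fix w :: complex
      show "(\<integral>\<^sup>+\<theta>. G (cis \<theta> * w) \<partial>?U) \<le> \<psi> (1 - (norm w)\<^sup>2) * indicator disk w"
      proof (cases "w \<in> disk")
        case True
        have "(\<integral>\<^sup>+\<theta>. G (cis \<theta> * w) \<partial>?U)
          = (\<integral>\<^sup>+\<theta>. ennreal (g w) * ennreal (1 / (norm (1 - cnj a * (cis \<theta> * w)))\<^sup>2 powr (\<alpha> + 2)) \<partial>?U)"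
          using True by (intro nn_integral_cong) (simp add: G_def g_def norm_mult)
        also have "\<dots> = ennreal (g w) * (\<integral>\<^sup>+\<theta>. ennreal (1 / (norm (1 - cnj a * (cis \<theta> * w)))\<^sup>2 powr (\<alpha> + 2)) \<partial>?U)"
        proof (rule nn_integral_cmult)
          have "(\<lambda>\<theta>. 1 - cnj a * (cis \<theta> * w)) \<in> borel_measurable borel"
            by (intro borel_measurable_continuous_onI continuous_intros)
          then show "(\<lambda>\<theta>. ennreal (1 / (norm (1 - cnj a * (cis \<theta> * w)))\<^sup>2 powr (\<alpha> + 2))) \<in> borel_measurable ?U"
            by simp
        qed
        also have "\<dots> \<le> ennreal (g w) * ennreal (2 powr (2 * \<alpha> + 3) / max t (1 - (norm w)\<^sup>2) powr (2 * \<alpha> + 3))"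
          unfolding t_def by (intro mult_left_mono circle_mean_kernel_le \<alpha> a True) simp
        also have "\<dots> = \<psi> (1 - (norm w)\<^sup>2)"
          unfolding \<psi>_def using g0[of w] by (simp add: g_def K_def mult_ac flip: ennreal_mult)
        finally show ?thesis using True by simp
      next
        case False
        then show ?thesis by (simp add: G_def norm_mult)
      qed
    qed
    also have "\<dots> = ennreal pi * (\<integral>\<^sup>+x. \<psi> x * indicator {0..1} x \<partial>lborel)"
      by (rule nn_integral_disk_radial) simp
    also have "\<dots> \<le> ennreal pi * ennreal (K * (1 / (\<alpha> + 1) + 1 / (\<alpha> + 2)))"
      unfolding \<psi>_def by (intro mult_left_mono nn_integral_powr_split_le \<alpha> t K) simp
    also have "\<dots> = ennreal ((C powr (1 / p)) powr p)"
      using C p by (simp add: C_def powr_powr flip: ennreal_mult')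
    finally have "bergman_norm p \<alpha> h \<le> ennreal (C powr (1 / p))"
      unfolding bergman_norm_def by (subst ennreal_root_le_iff[OF p]) auto
    then show "norm_of (Bergman p \<alpha>) (\<lambda>z. test_fun (gamma_of (Bergman p \<alpha>)) a z * sigma a z ^ k)
        \<le> ennreal (C powr (1 / p))"
      by (simp add: h_def)
  qed simp
qed

section \<open>Assembling the equivalences for the four kinds of spaces\<close>

theorem theorem1:
  fixes n :: nat
    and u :: "nat \<Rightarrow> complex \<Rightarrow> complex"
    and \<tau> :: "complex \<Rightarrow> complex"
    and \<nu> :: "complex \<Rightarrow> real"
    and X :: hspace
  assumes "\<And>k. k \<le> n \<Longrightarrow> u k holomorphic_on disk"
    and "\<tau> holomorphic_on disk"
    and "\<tau> ` disk \<subseteq> disk"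
    and "is_weight \<nu>"
  shows
    "((X = Hinfty \<or> (\<exists>\<alpha>>0. X = Growth \<alpha>)) \<longrightarrow>
        (cond_a X n u \<tau> \<nu> \<longleftrightarrow> cond_b X n u \<tau> \<nu>) \<and>
        (cond_b X n u \<tau> \<nu> \<longleftrightarrow> cond_c X n u \<tau> \<nu>) \<and>
        (cond_c X n u \<tau> \<nu> \<longleftrightarrow> cond_d X n u \<tau> \<nu>) \<and>
        (cond_d X n u \<tau> \<nu> \<longleftrightarrow> cond_e X n u \<tau> \<nu>)) \<and>
     ((\<exists>p>0. (\<exists>\<alpha>>-1. X = Bergman p \<alpha>) \<or> X = Hardy p) \<longrightarrow>
        (cond_a X n u \<tau> \<nu> \<longleftrightarrow> cond_b X n u \<tau> \<nu>) \<and>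
        (cond_b X n u \<tau> \<nu> \<longleftrightarrow> cond_c X n u \<tau> \<nu>) \<and>
        (cond_c X n u \<tau> \<nu> \<longleftrightarrow> cond_d X n u \<tau> \<nu>))"
proof -
  have \<nu>: "0 \<le> \<nu> z" if "z \<in> disk" for z
    using \<open>is_weight \<nu>\<close> that by (auto simp: is_weight_def intro: less_imp_le)
  show ?thesis
  \<comment> \<open>The instantiation splits only the outer conjunction and keeps the chains of
    equivalences whole.\<close>
  proof (intro conjI[of "_ \<longrightarrow> _"] impI)
    assume "X = Hinfty \<or> (\<exists>\<alpha>>0. X = Growth \<alpha>)"
    then have X: "0 \<le> gamma_of X" "point_eval_bound X" "test_bound X" "monomial_bound X"
      by (auto intro: point_eval_bound_Hinfty test_bound_Hinfty monomial_bound_Hinfty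
          point_eval_bound_Growth test_bound_Growth monomial_bound_Growth)
    have abcd: "(cond_a X n u \<tau> \<nu> \<longleftrightarrow> cond_b X n u \<tau> \<nu>) \<and>
        (cond_b X n u \<tau> \<nu> \<longleftrightarrow> cond_c X n u \<tau> \<nu>) \<and>
        (cond_c X n u \<tau> \<nu> \<longleftrightarrow> cond_d X n u \<tau> \<nu>)"
      by (rule cond_a_b_c_d_equivalent) (use assms \<nu> X in auto)
    moreover have "cond_e X n u \<tau> \<nu>" if "cond_c X n u \<tau> \<nu>"
      by (rule cond_c_imp_cond_e) (use assms \<nu> X that in auto)
    moreover have "cond_c X n u \<tau> \<nu>" if "cond_e X n u \<tau> \<nu>"
      by (rule cond_e_imp_cond_c) (use assms \<nu> X that in auto)
    ultimately show "(cond_a X n u \<tau> \<nu> \<longleftrightarrow> cond_b X n u \<tau> \<nu>) \<and>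
        (cond_b X n u \<tau> \<nu> \<longleftrightarrow> cond_c X n u \<tau> \<nu>) \<and>
        (cond_c X n u \<tau> \<nu> \<longleftrightarrow> cond_d X n u \<tau> \<nu>) \<and>
        (cond_d X n u \<tau> \<nu> \<longleftrightarrow> cond_e X n u \<tau> \<nu>)"
      by blast
  next
    assume "\<exists>p>0. (\<exists>\<alpha>>-1. X = Bergman p \<alpha>) \<or> X = Hardy p"
    then have X: "0 \<le> gamma_of X" "point_eval_bound X" "test_bound X"
      by (auto intro: point_eval_bound_Bergman test_bound_Bergman point_eval_bound_Hardy test_bound_Hardy)
    show "(cond_a X n u \<tau> \<nu> \<longleftrightarrow> cond_b X n u \<tau> \<nu>) \<and>
        (cond_b X n u \<tau> \<nu> \<longleftrightarrow> cond_c X n u \<tau> \<nu>) \<and>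
        (cond_c X n u \<tau> \<nu> \<longleftrightarrow> cond_d X n u \<tau> \<nu>)"
      by (rule cond_a_b_c_d_equivalent) (use assms \<nu> X in auto)
  qed
qed

end
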